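(* For every positive integer $k$, there is a prescient $(k^2m^{2/3}\log n,\ km^{2/3}\log n)$-scheme with perfect completeness for computing $F_k$ over a data stream of sparsity $m$ over universe $[n]$ in the strict turnstile update model. Any prescient $(c_a,c_v)$-scheme for this problem requires $c_a c_v=\Omega(m)$.
   Context: Data streams: a stream $\mathbf x$ is a sequence of updates $(i,\delta)$, $i\in[n]$, $\delta\in\mathbb Z$; $f_i=\sum_{(j,\delta)\in\mathbf x:\,j=i}\delta$. In the strict turnstile model $\delta$ may be negative but all frequencies always remain nonnegative. The sparsity $m$ is the number of items with nonzero final frequency. $F_k(\mathbf x)=\sum_{i\in[n]}f_i^k$. Schemes: a scheme for $F$ is a pair $(\mathfrak h,V)$. A prover with private randomness $r_P$ supplies after the $i$th stream element an annotation string $\mathfrak h_i(\mathbf x,r_P)$, which may depend on the entire stream; the verifier $V$ is a streaming algorithm with $w$ bits of memory and private randomness $r_V$ reading the interleaved annotated stream and outputting a value or $\bot$. Completeness error $\delta_c$: for all $\mathbf x$, $\Pr_{r_P,r_V}[\text{output}\ne F(\mathbf x)]\le\delta_c$ (perfect completeness if $\delta_c=0$). Soundness error $\delta_s$: for all $\mathbf x$ and all annotation sequences, $\Pr_{r_V}[\text{output}\notin\{F(\mathbf x),\bot\}]\le\delta_s$. A prescient $(c_a,c_v)$-scheme has total annotation length $O(c_a)$, space $O(c_v)$ and error $\max\{\delta_s,\delta_c\}\le 1/3$.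
   Formalization: Final frequencies are assumed at most n^d for a fixed d (the upper constant depends on d), with n ≥ 2 and 1 ≤ m ≤ n; the lower bound is for k ≥ 2 (it fails for k = 1, as F_1 needs only O(log n) bits) and annotation bound c_a ≥ 1. *)

theory Defs
  imports "HOL-Probability.Probability_Mass_Function"
begin

section \<open>Data streams in the strict turnstile model\<close>

type_synonym update = "nat \<times> int"

definition freq :: "update list \<Rightarrow> nat \<Rightarrow> int" where
  "freq x i = (\<Sum>(j, \<delta>)\<leftarrow>x. if j = i then \<delta> else 0)"

definition strict_turnstile :: "nat \<Rightarrow> update list \<Rightarrow> bool" where
  "strict_turnstile n x \<longleftrightarrow>
     (\<forall>(j, \<delta>)\<in>set x. j \<in> {1..n}) \<and>
     (\<forall>t\<le>length x. \<forall>i\<in>{1..n}. 0 \<le> freq (take t x) i)"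

definition sparsity :: "nat \<Rightarrow> update list \<Rightarrow> nat" where
  "sparsity n x = card {i \<in> {1..n}. freq x i \<noteq> 0}"

definition freq_moment :: "nat \<Rightarrow> nat \<Rightarrow> update list \<Rightarrow> int" where
  "freq_moment k n x = (\<Sum>i\<in>{1..n}. freq x i ^ k)"

text \<open>
  Bounds of the form O(log n) on the cost of handling one frequency presuppose that frequencies
  are polynomially bounded in the universe size.  The exponent d makes this explicit; only the
  final frequencies are restricted, neither the stream length nor the single updates are.
\<close>

definition turnstile_streams :: "nat \<Rightarrow> nat \<Rightarrow> update list set" where
  "turnstile_streams d n =
     {x. strict_turnstile n x \<and> (\<forall>i\<in>{1..n}. freq x i \<le> int n ^ d)}"


section \<open>Annotation schemes\<close>

text \<open>
  The verifier reads annotation strings one bit at a time, so that its memory bound also limits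
  what it can retain while reading a long string.  The end of an annotation string is visible to
  it as the next update (or the end of the input).
\<close>

datatype symbol = Update nat int | Annotation bool

text \<open>\<open>h i\<close> is the annotation string that follows the \<open>i\<close>th stream element, with \<open>i\<close> counted from 1.\<close>

definition annotated_stream :: "update list \<Rightarrow> (nat \<Rightarrow> bool list) \<Rightarrow> symbol list" where
  "annotated_stream x h =
     concat (map (\<lambda>i. Update (fst (x ! (i - 1))) (snd (x ! (i - 1))) # map Annotation (h i))
                 [1..<Suc (length x)])"

definition annotation_length :: "update list \<Rightarrow> (nat \<Rightarrow> bool list) \<Rightarrow> nat" where
  "annotation_length x h = (\<Sum>i=1..length x. length (h i))"

text \<open>
  Random strings and memory contents are coded as natural numbers; since a \<open>pmf\<close> has countable
  support this does not restrict the random source.  The prover is prescient: the annotation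
  after the \<open>i\<close>th element is a function of the entire stream.
\<close>

record prover =
  prover_coins :: "nat pmf"
  annotate :: "update list \<Rightarrow> nat \<Rightarrow> nat \<Rightarrow> bool list"
    \<comment> \<open>stream, random string, position\<close>

text \<open>The first argument of each component below is the verifier's random string; an output
  \<open>None\<close> stands for \<open>\<bottom>\<close>.\<close>

record verifier =
  verifier_coins :: "nat pmf"
  init_mem :: "nat \<Rightarrow> nat"
  step_mem :: "nat \<Rightarrow> nat \<Rightarrow> symbol \<Rightarrow> nat"
  result :: "nat \<Rightarrow> nat \<Rightarrow> int option"

definition uses_memory :: "verifier \<Rightarrow> nat \<Rightarrow> bool" where
  "uses_memory V w \<longleftrightarrow>
     (\<forall>r. init_mem V r < 2 ^ w \<and> (\<forall>s<2 ^ w. \<forall>a. step_mem V r s a < 2 ^ w))"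

definition verifier_output :: "verifier \<Rightarrow> nat \<Rightarrow> symbol list \<Rightarrow> int option" where
  "verifier_output V r xs = result V r (foldl (step_mem V r) (init_mem V r) xs)"

definition completeness_error_le ::
    "update list set \<Rightarrow> (update list \<Rightarrow> int) \<Rightarrow> prover \<Rightarrow> verifier \<Rightarrow> real \<Rightarrow> bool" where
  "completeness_error_le D F P V \<delta> \<longleftrightarrow>
     (\<forall>x\<in>D. measure_pmf.prob (pair_pmf (prover_coins P) (verifier_coins V))
        {(rP, rV). verifier_output V rV (annotated_stream x (annotate P x rP)) \<noteq> Some (F x)} \<le> \<delta>)"

definition soundness_error_le ::
    "update list set \<Rightarrow> (update list \<Rightarrow> int) \<Rightarrow> verifier \<Rightarrow> real \<Rightarrow> bool" where
  "soundness_error_le D F V \<delta> \<longleftrightarrow>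
     (\<forall>x\<in>D. \<forall>h. measure_pmf.prob (verifier_coins V)
        {rV. verifier_output V rV (annotated_stream x h) \<notin> {Some (F x), None}} \<le> \<delta>)"

text \<open>
  A scheme for the (promise) problem of computing \<open>F\<close> on the streams in \<open>D\<close>, with total annotation
  length at most \<open>a\<close> bits, at most \<open>w\<close> bits of memory, and both errors at most 1/3.
\<close>

definition prescient_scheme ::
    "update list set \<Rightarrow> (update list \<Rightarrow> int) \<Rightarrow> nat \<Rightarrow> nat \<Rightarrow> prover \<Rightarrow> verifier \<Rightarrow> bool" where
  "prescient_scheme D F a w P V \<longleftrightarrow>
     (\<forall>x\<in>D. \<forall>rP\<in>set_pmf (prover_coins P). annotation_length x (annotate P x rP) \<le> a) \<and>
     uses_memory V w \<and>
     completeness_error_le D F P V (1/3) \<and>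
     soundness_error_le D F V (1/3)"

end

theory Submission
  imports Defs "HOL-Probability.Product_PMF" "HOL-Computational_Algebra.Primes" "HOL-Computational_Algebra.Polynomial"
begin

text \<open>Upper bound: the prover announces a hash function into \<open>K^2\<close> buckets, \<open>K\<close> about \<open>m^(2/3)\<close>, together
  with the at most \<open>K\<close> items that it fails to separate; those are counted exactly. The other items
  contribute the sum over a \<open>K\<close> by \<open>K\<close> grid of the \<open>k\<close>-th powers of the bucket counts, which the verifier
  obtains from one sum-check round modulo a prime, keeping the \<open>K\<close> values of the low-degree extension
  in a random column. The hash function need not be trusted: a bucket with count \<open>a\<close>, first moment
  \<open>b\<close> and second moment \<open>c\<close> of the item numbers has \<open>a * c - b^2 \<ge> 0\<close> with equality only without
  collisions, so adding a large multiple of this defect exposes every collision.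

  Lower bound: on streams with frequencies \<open>1 + x i + y i\<close>, where \<open>x\<close> precedes \<open>y\<close>, the phase
  \<open>cis (\<theta> * F)\<close> is a tensor power of a matrix that has small correlation with all functions of a
  message of few bits about \<open>x\<close>. Repeating the verifier on a fixed annotation and summing over all
  annotations gives such a function with large correlation. The alphabet of size about \<open>m/2\<close> yields
  a correlation bound of the form \<open>m^(-\<Omega>(m))\<close>, which pays for the \<open>log m\<close> bits that specify the
  position of each annotation bit.\<close>

section \<open>Correlation of messages with phases\<close>

text \<open>With \<open>K^2\<close> buckets and a random multiplier, \<open>m\<close> items have
  about \<open>m^2 / K^2\<close> colliding pairs; at most \<open>K\<close> items can be listed,
  which forces \<open>K^3 \<ge> m^2\<close> and gives the exponent 2/3. A residue must determine a
  total of size about \<open>N ^ k\<close> times a power of \<open>N = n ^ Suc d\<close>, so it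
  takes \<open>O(d k log n)\<close> bits. Memory is \<open>O(K)\<close> residues; the sum-check
  polynomial has \<open>2 * k * K\<close> coefficients, hence one more factor \<open>k\<close> in
  the annotation. In the lower bound the annotation read along with \<open>x\<close> may depend on
  \<open>y\<close>, so it cannot belong to the message about \<open>x\<close>. Therefore one
  annotation is fixed for all inputs, at the price of a correlation of only \<open>3^(-t)\<close>,
  and what crosses the cut is the memory of \<open>t\<close> runs. Beating the number of annotations
  needs \<open>t\<close> of order \<open>a * log m\<close>; the \<open>w * t\<close> message bits
  are then compared with \<open>m * log m\<close>, and the logarithms cancel. For
  \<open>k = 1\<close> the phase of one coordinate would be a matrix of rank one: frequencies must
  enter through a strictly convex function.\<close>

lemma power_increment_strict_mono:
  fixes u v :: int
  assumes "0 \<le> v" "v < u" "2 \<le> k"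
  shows "(v + 1) ^ k - v ^ k < (u + 1) ^ k - u ^ k"
  using assms(3)
proof (induction k rule: dec_induct)
  case base
  show ?case using assms(2) by (simp add: power2_eq_square algebra_simps)
next
  case (step k)
  have split: "(t + 1) ^ Suc k - t ^ Suc k = (t + 1) * ((t + 1) ^ k - t ^ k) + t ^ k" for t :: int
    by (simp add: algebra_simps)
  have "0 \<le> (v + 1) ^ k - v ^ k"
    using assms(1) by (simp add: power_mono)
  hence "(v + 1) * ((v + 1) ^ k - v ^ k) < (u + 1) * ((u + 1) ^ k - u ^ k)"
    using step.IH assms by (intro mult_strict_mono) auto
  moreover have "v ^ k \<le> u ^ k"
    using assms by (intro power_mono) auto
  ultimately show ?case unfolding split by linarith
qed

text \<open>By strict convexity of the \<open>k\<close>-th power the difference is strictly monotone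
  in \<open>c\<close>. Its values are therefore distinct, and for a random angle their phases nearly
  cancel.\<close>

lemma shifted_power_diff_inj:
  fixes a b :: nat
  assumes "a \<noteq> b" "2 \<le> k"
  shows "inj (\<lambda>c. int (1 + a + c) ^ k - int (1 + b + c) ^ k)"
proof -
  have *: "inj (\<lambda>c. int (1 + a + c) ^ k - int (1 + b + c) ^ k)" if "b < a" for a b :: nat
  proof (rule strict_mono_imp_inj_on, rule strict_monoI_Suc)
    fix c
    show "int (1 + a + c) ^ k - int (1 + b + c) ^ k
        < int (1 + a + Suc c) ^ k - int (1 + b + Suc c) ^ k"
      using power_increment_strict_mono[of "int (1 + b + c)" "int (1 + a + c)" k] that assms(2)
      by (simp add: algebra_simps)
  qed
  show ?thesis
  proof (cases "b < a")
    case True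
    then show ?thesis by (rule *)
  next
    case False
    hence "inj (\<lambda>c. int (1 + b + c) ^ k - int (1 + a + c) ^ k)"
      using assms(1) by (intro *) auto
    thus ?thesis unfolding inj_def by (metis minus_diff_eq)
  qed
qed

text \<open>Orthogonality of characters modulo \<open>P\<close>; the bound on \<open>e\<close>
  excludes nonzero multiples of \<open>P\<close>.\<close>

lemma sum_cis_roots:
  fixes e :: int
  assumes "\<bar>e\<bar> < int P"
  shows "(\<Sum>j<P. cis (2 * pi * real j / real P * real_of_int e)) = (if e = 0 then of_nat P else 0)"
proof (cases "e = 0")
  case False
  have P: "P > 0" using assms by simp
  define z where "z = cis (2 * pi * real_of_int e / real P)"
  have "cis (2 * pi * real j / real P * real_of_int e) = z ^ j" for j
    by (simp add: z_def Complex.DeMoivre mult_ac)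
  hence "(\<Sum>j<P. cis (2 * pi * real j / real P * real_of_int e)) = (\<Sum>j<P. z ^ j)" by simp
  moreover have "z ^ P = 1"
  proof -
    have "z ^ P = cis (2 * pi * real_of_int e)"
      using P by (simp add: z_def Complex.DeMoivre)
    also have "\<dots> = 1" by (simp add: cis_multiple_2pi)
    finally show ?thesis .
  qed
  moreover have "z \<noteq> 1"
  proof
    assume "z = 1"
    hence "cos (2 * pi * real_of_int e / real P) = 1"
      unfolding z_def by (simp add: complex_eq_iff)
    then obtain n :: int where "2 * pi * real_of_int e / real P = of_int n * 2 * pi"
      unfolding cos_one_2pi_int by blast
    hence "real_of_int e = of_int n * real P" using P by (simp add: field_simps)
    hence "e = n * int P" by (metis of_int_eq_iff of_int_mult of_int_of_nat_eq)
    hence "\<bar>e\<bar> = \<bar>n\<bar> * int P" by (simp add: abs_mult)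
    moreover have "n \<noteq> 0" using \<open>e = n * int P\<close> False by auto
    hence "1 \<le> \<bar>n\<bar>" by linarith
    hence "int P \<le> \<bar>n\<bar> * int P" by (simp add: mult_le_cancel_right1)
    ultimately show False using assms by linarith
  qed
  ultimately show ?thesis using False by (simp add: geometric_sum)
qed simp

lemma norm_sum_cis_sq:
  "of_real ((cmod (\<Sum>c\<in>C. cis (f c)))\<^sup>2) = (\<Sum>c\<in>C. \<Sum>c'\<in>C. cis (f c - f c'))"
proof -
  have "of_real ((cmod (\<Sum>c\<in>C. cis (f c)))\<^sup>2) = (\<Sum>c\<in>C. cis (f c)) * cnj (\<Sum>c\<in>C. cis (f c))"
    by (rule complex_norm_square)
  also have "\<dots> = (\<Sum>c\<in>C. \<Sum>c'\<in>C. cis (f c - f c'))"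
    by (simp add: sum_product cis_cnj cis_mult)
  finally show ?thesis .
qed

text \<open>Parseval's identity: averaged over the \<open>P\<close>-th roots of unity, the squared
  norm counts the pairs on which \<open>f\<close> agrees.\<close>

lemma mean_norm_sum_cis:
  fixes f :: "'c \<Rightarrow> int"
  assumes "\<And>c c'. c \<in> C \<Longrightarrow> c' \<in> C \<Longrightarrow> \<bar>f c - f c'\<bar> < int P" "finite C"
  shows "(\<Sum>j<P. (cmod (\<Sum>c\<in>C. cis (2 * pi * real j / real P * real_of_int (f c))))\<^sup>2)
    = real P * (\<Sum>c\<in>C. real (card {c'\<in>C. f c = f c'}))"
proof -
  have "complex_of_real (\<Sum>j<P. (cmod (\<Sum>c\<in>C. cis (2 * pi * real j / real P * real_of_int (f c))))\<^sup>2)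
    = (\<Sum>j<P. \<Sum>c\<in>C. \<Sum>c'\<in>C. cis (2 * pi * real j / real P * real_of_int (f c - f c')))"
    unfolding of_real_sum norm_sum_cis_sq by (simp add: right_diff_distrib)
  also have "\<dots> = (\<Sum>c\<in>C. \<Sum>c'\<in>C. \<Sum>j<P. cis (2 * pi * real j / real P * real_of_int (f c - f c')))"
    by (subst sum.swap, rule sum.cong[OF refl], rule sum.swap)
  also have "\<dots> = (\<Sum>c\<in>C. \<Sum>c'\<in>C. if f c = f c' then of_nat P else 0)"
    using sum_cis_roots[OF assms(1)] by (intro sum.cong refl) simp
  also have "\<dots> = (\<Sum>c\<in>C. of_nat P * of_nat (card {c'\<in>C. f c = f c'}))"
    using assms(2) by (intro sum.cong refl) (simp add: sum.If_cases Int_def)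
  also have "\<dots> = complex_of_real (real P * (\<Sum>c\<in>C. real (card {c'\<in>C. f c = f c'})))"
    by (simp add: sum_distrib_left)
  finally show ?thesis using of_real_eq_iff by blast
qed

text \<open>Averaging over angles: each of the \<open>q\<close> diagonal pairs \<open>a = b\<close>
  contributes \<open>q^2\<close>, each other pair at most \<open>q\<close> by injectivity, so the
  mean is at most \<open>2 * q^3\<close>, against the trivial \<open>q^4\<close>.\<close>

lemma exists_good_angle:
  assumes "2 \<le> k"
  shows "\<exists>\<theta>. (\<Sum>a<q. \<Sum>b<q. (cmod (\<Sum>c<q. cis (\<theta> * real_of_int (int (1 + a + c) ^ k - int (1 + b + c) ^ k))))\<^sup>2)
      \<le> 2 * real q ^ 3"
proof -
  define D where "D a b c = int (1 + a + c) ^ k - int (1 + b + c) ^ k" for a b c :: nat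
  \<comment> \<open>All values of \<open>D\<close> are bounded by \<open>(1 + q + q) ^ k\<close>, so
    \<open>P\<close> exceeds the difference of any two of them.\<close>
  define P where "P = 4 * (1 + q + q) ^ k + 1"
  have D: "\<bar>D a b c\<bar> \<le> int ((1 + q + q) ^ k)" if "a < q" "b < q" "c < q" for a b c
  proof -
    have "int (1 + a + c) ^ k \<le> int (1 + q + q) ^ k" "int (1 + b + c) ^ k \<le> int (1 + q + q) ^ k"
      using that by (intro power_mono; simp)+
    moreover have "0 \<le> int (1 + a + c) ^ k" "0 \<le> int (1 + b + c) ^ k" by simp_all
    ultimately show ?thesis unfolding D_def of_nat_power by linarith
  qed
  define T where "T \<theta> = (\<Sum>a<q. \<Sum>b<q. (cmod (\<Sum>c<q. cis (\<theta> * real_of_int (D a b c))))\<^sup>2)" for \<theta>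
  define \<phi> where "\<phi> j = 2 * pi * real j / real P" for j
  have "(\<Sum>j<P. T (\<phi> j)) = (\<Sum>a<q. \<Sum>b<q. \<Sum>j<P. (cmod (\<Sum>c<q. cis (\<phi> j * real_of_int (D a b c))))\<^sup>2)"
    unfolding T_def by (subst sum.swap, rule sum.cong[OF refl], rule sum.swap)
  also have "\<dots> = (\<Sum>a<q. \<Sum>b<q. real P * (\<Sum>c<q. real (card {c'\<in>{..<q}. D a b c = D a b c'})))"
  proof (intro sum.cong refl)
    fix a b assume "a \<in> {..<q}" "b \<in> {..<q}"
    hence "\<bar>D a b c - D a b c'\<bar> < int P" if "c < q" "c' < q" for c c'
      using D[of a b c] D[of a b c'] that by (simp add: P_def)
    thus "(\<Sum>j<P. (cmod (\<Sum>c<q. cis (\<phi> j * real_of_int (D a b c))))\<^sup>2)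
      = real P * (\<Sum>c<q. real (card {c'\<in>{..<q}. D a b c = D a b c'}))"
      unfolding \<phi>_def by (intro mean_norm_sum_cis) auto
  qed
  also have "\<dots> \<le> (\<Sum>a<q. \<Sum>b<q. real P * (real q * (if a = b then real q else 1)))"
  proof (intro sum_mono mult_left_mono)
    fix a b
    have "card {c'\<in>{..<q}. D a b c = D a b c'} \<le> (if a = b then q else 1)" for c
    proof (cases "a = b")
      case True
      have "card {c'\<in>{..<q}. D a b c = D a b c'} \<le> card {..<q}" by (intro card_mono) auto
      thus ?thesis using True by simp
    next
      case False
      have "{c'\<in>{..<q}. D a b c = D a b c'} \<subseteq> {c}"
        using shifted_power_diff_inj[OF False assms] unfolding D_def inj_def by auto
      hence "card {c'\<in>{..<q}. D a b c = D a b c'} \<le> card {c}" by (intro card_mono) auto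
      thus ?thesis using False by simp
    qed
    hence "real (card {c'\<in>{..<q}. D a b c = D a b c'}) \<le> (if a = b then real q else 1)" for c
      using of_nat_mono[where ?'a = real] by (cases "a = b") fastforce+
    hence "(\<Sum>c<q. real (card {c'\<in>{..<q}. D a b c = D a b c'})) \<le> (\<Sum>c<q. if a = b then real q else 1)"
      by (rule sum_mono)
    thus "(\<Sum>c<q. real (card {c'\<in>{..<q}. D a b c = D a b c'})) \<le> real q * (if a = b then real q else 1)"
      by simp
  qed simp
  also have "\<dots> \<le> (\<Sum>a<q. \<Sum>b<q. real P * real q * (if a = b then real q else 0) + real P * real q)"
    by (intro sum_mono) auto
  also have "\<dots> = real P * (2 * real q ^ 3)"
    by (simp add: sum.distrib sum_distrib_left[symmetric] sum.delta algebra_simps power3_eq_cube)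
  finally have le: "(\<Sum>j<P. T (\<phi> j)) \<le> real P * (2 * real q ^ 3)" .
  have "\<exists>j<P. T (\<phi> j) \<le> 2 * real q ^ 3"
  proof (rule ccontr)
    assume "\<not> ?thesis"
    hence "(\<Sum>j<P. 2 * real q ^ 3) < (\<Sum>j<P. T (\<phi> j))"
      by (intro sum_strict_mono) (auto simp: P_def not_le)
    thus False using le by simp
  qed
  thus ?thesis unfolding T_def D_def by blast
qed

section \<open>Discrepancy of product phases under a partition of the inputs\<close>

lemma sum_power2_le_card_sum_squares:
  fixes f :: "'a \<Rightarrow> real"
  shows "(\<Sum>i\<in>A. f i)\<^sup>2 \<le> real (card A) * (\<Sum>i\<in>A. (f i)\<^sup>2)"
  using Cauchy_Schwarz_ineq_sum[of "\<lambda>_. 1" f A] by simp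

text \<open>\<open>cis\<close> turns the sum over coordinates into a product, and summing a product
  over all functions gives a product of sums; this is applied to \<open>y\<close>, \<open>x'\<close>
  and \<open>x\<close> in turn.\<close>

lemma sum_norm_tensor_sq:
  fixes \<phi> :: "nat \<Rightarrow> nat \<Rightarrow> real" and m q :: nat
  defines "X \<equiv> {..<m} \<rightarrow>\<^sub>E {..<q}"
  shows "(\<Sum>x\<in>X. \<Sum>x'\<in>X. (cmod (\<Sum>y\<in>X. cis (\<Sum>i<m. \<phi> (x i) (y i) - \<phi> (x' i) (y i))))\<^sup>2)
    = (\<Sum>a<q. \<Sum>b<q. (cmod (\<Sum>c<q. cis (\<phi> a c - \<phi> b c)))\<^sup>2) ^ m"
proof -
  define u where "u a b = (cmod (\<Sum>c<q. cis (\<phi> a c - \<phi> b c)))\<^sup>2" for a b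
  have cis_sum: "cis (\<Sum>i\<in>I. f i) = (\<Prod>i\<in>I. cis (f i))" if "finite I" for I :: "nat set" and f
    using that by (induction rule: finite_induct) (simp_all flip: cis_mult)
  have W: "(cmod (\<Sum>y\<in>X. cis (\<Sum>i<m. \<phi> (x i) (y i) - \<phi> (x' i) (y i))))\<^sup>2 = (\<Prod>i<m. u (x i) (x' i))" for x x'
  proof -
    have "(\<Sum>y\<in>X. cis (\<Sum>i<m. \<phi> (x i) (y i) - \<phi> (x' i) (y i)))
      = (\<Prod>i<m. \<Sum>c<q. cis (\<phi> (x i) c - \<phi> (x' i) c))"
      unfolding X_def by (simp add: prod_sum_PiE cis_sum)
    thus ?thesis by (simp add: u_def prod_norm[symmetric] prod_power_distrib)
  qed
  have "(\<Sum>x\<in>X. \<Sum>x'\<in>X. \<Prod>i<m. u (x i) (x' i)) = (\<Sum>x\<in>X. \<Prod>i<m. \<Sum>b<q. u (x i) b)"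
    unfolding X_def by (simp add: prod_sum_PiE)
  also have "\<dots> = (\<Prod>i<m. \<Sum>a<q. \<Sum>b<q. u a b)"
    unfolding X_def by (subst prod_sum_PiE) auto
  also have "\<dots> = (\<Sum>a<q. \<Sum>b<q. u a b) ^ m" by simp
  finally show ?thesis unfolding W by (simp add: u_def)
qed

text \<open>A function that depends on \<open>x\<close> only through one of \<open>S\<close> messages has small correlation with a
  product of phases: two applications of Cauchy-Schwarz leave the sum over pairs \<open>x\<close>, \<open>x'\<close>, which
  factorises over the coordinates.\<close>

lemma partition_correlation:
  fixes \<phi> :: "nat \<Rightarrow> nat \<Rightarrow> real" and m q :: nat
    and \<sigma> :: "(nat \<Rightarrow> nat) \<Rightarrow> 's" and g :: "'s \<Rightarrow> (nat \<Rightarrow> nat) \<Rightarrow> complex"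
  defines "X \<equiv> {..<m} \<rightarrow>\<^sub>E {..<q}"
  assumes B: "(\<Sum>a<q. \<Sum>b<q. (cmod (\<Sum>c<q. cis (\<phi> a c - \<phi> b c)))\<^sup>2) \<le> B"
    and S: "card (\<sigma> ` X) \<le> S"
    and g: "\<And>s y. cmod (g s y) \<le> 1"
  shows "cmod (\<Sum>x\<in>X. \<Sum>y\<in>X. cis (\<Sum>i<m. \<phi> (x i) (y i)) * g (\<sigma> x) y) ^ 4
    \<le> real S ^ 2 * (real q ^ m) ^ 4 * B ^ m"
proof -
  have fX: "finite X" and cX: "card X = q ^ m"
    by (auto simp: X_def finite_PiE card_PiE)
  define T where "T = \<sigma> ` X"
  have fT: "finite T" using fX by (simp add: T_def)
  define E where "E x y = cis (\<Sum>i<m. \<phi> (x i) (y i))" for x y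
  define Xs where "Xs s = {x\<in>X. \<sigma> x = s}" for s
  define R where "R s y = (\<Sum>x\<in>Xs s. E x y)" for s y
  define W where "W x x' = (\<Sum>y\<in>X. cis (\<Sum>i<m. \<phi> (x i) (y i) - \<phi> (x' i) (y i)))" for x x'
  define Z where "Z = (\<Sum>x\<in>X. \<Sum>y\<in>X. E x y * g (\<sigma> x) y)"
  have grp: "(\<Sum>s\<in>T. \<Sum>x\<in>Xs s. h x) = (\<Sum>x\<in>X. h x)" for h :: "_ \<Rightarrow> 'z :: comm_monoid_add"
    unfolding Xs_def T_def using fX by (intro sum.group) auto
  have "Z = (\<Sum>s\<in>T. \<Sum>x\<in>Xs s. \<Sum>y\<in>X. E x y * g s y)"
    unfolding Z_def grp[symmetric] by (intro sum.cong refl) (auto simp: Xs_def)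
  also have "\<dots> = (\<Sum>s\<in>T. \<Sum>y\<in>X. g s y * R s y)"
  proof (rule sum.cong[OF refl])
    fix s
    show "(\<Sum>x\<in>Xs s. \<Sum>y\<in>X. E x y * g s y) = (\<Sum>y\<in>X. g s y * R s y)"
      unfolding R_def by (subst sum.swap) (simp add: sum_distrib_left mult.commute)
  qed
  also have "cmod \<dots> \<le> (\<Sum>s\<in>T. \<Sum>y\<in>X. cmod (R s y))"
  proof (intro order_trans[OF norm_sum] sum_mono)
    fix s y
    show "cmod (g s y * R s y) \<le> cmod (R s y)"
      using mult_right_mono[OF g[of s y], of "cmod (R s y)"] by (simp add: norm_mult)
  qed
  finally have Z1: "cmod Z \<le> (\<Sum>s\<in>T. \<Sum>y\<in>X. cmod (R s y))" .
  have R2: "(\<Sum>y\<in>X. (cmod (R s y))\<^sup>2) \<le> (\<Sum>x\<in>Xs s. \<Sum>x'\<in>X. cmod (W x x'))" for s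
  proof -
    have "complex_of_real (\<Sum>y\<in>X. (cmod (R s y))\<^sup>2) =
        (\<Sum>y\<in>X. \<Sum>x\<in>Xs s. \<Sum>x'\<in>Xs s. cis ((\<Sum>i<m. \<phi> (x i) (y i)) - (\<Sum>i<m. \<phi> (x' i) (y i))))"
      unfolding of_real_sum R_def E_def norm_sum_cis_sq by simp
    also have "\<dots> = (\<Sum>x\<in>Xs s. \<Sum>x'\<in>Xs s. W x x')"
      unfolding W_def sum_subtractf by (subst sum.swap, rule sum.cong[OF refl], rule sum.swap)
    finally have eq: "complex_of_real (\<Sum>y\<in>X. (cmod (R s y))\<^sup>2) = (\<Sum>x\<in>Xs s. \<Sum>x'\<in>Xs s. W x x')" .
    have "(\<Sum>y\<in>X. (cmod (R s y))\<^sup>2) = cmod (complex_of_real (\<Sum>y\<in>X. (cmod (R s y))\<^sup>2))"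
      by (subst norm_of_real) (simp add: sum_nonneg)
    also have "\<dots> = cmod (\<Sum>x\<in>Xs s. \<Sum>x'\<in>Xs s. W x x')" unfolding eq ..
    also have "\<dots> \<le> (\<Sum>x\<in>Xs s. \<Sum>x'\<in>Xs s. cmod (W x x'))"
      by (intro order_trans[OF norm_sum] sum_mono) simp_all
    \<comment> \<open>Letting \<open>x'\<close> leave the class of \<open>x\<close> removes the
      partition from the inner sum; after summation over \<open>s\<close> only the number of classes
      matters.\<close>
    also have "\<dots> \<le> (\<Sum>x\<in>Xs s. \<Sum>x'\<in>X. cmod (W x x'))"
      using fX by (intro sum_mono sum_mono2) (auto simp: Xs_def)
    finally show ?thesis .
  qed
  have "(cmod Z)\<^sup>2 \<le> (\<Sum>s\<in>T. \<Sum>y\<in>X. cmod (R s y))\<^sup>2"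
    using Z1 by (intro power_mono) auto
  also have "\<dots> \<le> real (card (T \<times> X)) * (\<Sum>s\<in>T. \<Sum>y\<in>X. (cmod (R s y))\<^sup>2)"
    using sum_power2_le_card_sum_squares[of "\<lambda>(s, y). cmod (R s y)" "T \<times> X"]
    by (simp add: sum.cartesian_product case_prod_unfold)
  also have "\<dots> \<le> real (card (T \<times> X)) * (\<Sum>s\<in>T. \<Sum>x\<in>Xs s. \<Sum>x'\<in>X. cmod (W x x'))"
    by (intro mult_left_mono sum_mono R2) simp
  also have "\<dots> \<le> (real S * real q ^ m) * (\<Sum>x\<in>X. \<Sum>x'\<in>X. cmod (W x x'))"
    unfolding grp using S cX fX fT
    by (intro mult_right_mono sum_nonneg) (auto simp: card_cartesian_product T_def intro!: mult_right_mono)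
  finally have "((cmod Z)\<^sup>2)\<^sup>2 \<le> ((real S * real q ^ m) * (\<Sum>x\<in>X. \<Sum>x'\<in>X. cmod (W x x')))\<^sup>2"
    by (intro power_mono) auto
  also have "\<dots> = (real S * real q ^ m)\<^sup>2 * (\<Sum>x\<in>X. \<Sum>x'\<in>X. cmod (W x x'))\<^sup>2"
    by (simp add: power_mult_distrib)
  also have "\<dots> \<le> (real S * real q ^ m)\<^sup>2 * (real (card (X \<times> X)) * (\<Sum>x\<in>X. \<Sum>x'\<in>X. (cmod (W x x'))\<^sup>2))"
    using sum_power2_le_card_sum_squares[of "\<lambda>(s, y). cmod (W s y)" "X \<times> X"]
    by (intro mult_left_mono) (auto simp: sum.cartesian_product case_prod_unfold)
  also have "(\<Sum>x\<in>X. \<Sum>x'\<in>X. (cmod (W x x'))\<^sup>2) = (\<Sum>a<q. \<Sum>b<q. (cmod (\<Sum>c<q. cis (\<phi> a c - \<phi> b c)))\<^sup>2) ^ m"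
    unfolding W_def X_def by (rule sum_norm_tensor_sq)
  also have "(real S * real q ^ m)\<^sup>2 * (real (card (X \<times> X)) * \<dots>)
      \<le> (real S * real q ^ m)\<^sup>2 * (real (card (X \<times> X)) * B ^ m)"
    using B by (intro mult_left_mono power_mono sum_nonneg) auto
  also have "\<dots> = real S ^ 2 * (real q ^ m) ^ 4 * B ^ m"
    by (simp add: card_cartesian_product cX power_mult_distrib power4_eq_xxxx power2_eq_square algebra_simps)
  finally show ?thesis
    unfolding Z_def E_def by (simp flip: power_mult)
qed

section \<open>Lower bound\<close>

text \<open>The joint probability is the mean over \<open>a\<close> of the probability given
  \<open>a\<close>, so not all of these can exceed \<open>c\<close>. This makes the honest prover
  deterministic.\<close>

lemma exists_coins_prob_le:
  assumes "measure_pmf.prob (pair_pmf P Q) {(a, b). W a b} \<le> c"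
  shows "\<exists>a\<in>set_pmf P. measure_pmf.prob Q {b. W a b} \<le> c"
proof (rule ccontr)
  define f where "f a = measure_pmf.prob Q {b. W a b}" for a
  assume "\<not> ?thesis"
  hence gt: "c < f a" if "a \<in> set_pmf P" for a using that by (auto simp: f_def not_le)
  have int: "integrable (measure_pmf P) f"
    by (rule measure_pmf.integrable_const_bound[where B = 1]) (auto simp: f_def)
  have "ennreal (measure_pmf.prob (pair_pmf P Q) {(a, b). W a b})
      = emeasure (pair_pmf P Q) {(a, b). W a b}"
    by (simp add: measure_pmf.emeasure_eq_measure)
  also have "\<dots> = (\<integral>\<^sup>+a. \<integral>\<^sup>+b. indicator {(a, b). W a b} (a, b) \<partial>Q \<partial>P)"
    by (simp flip: nn_integral_pair_pmf')
  also have "\<dots> = (\<integral>\<^sup>+a. emeasure Q {b. W a b} \<partial>P)"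
    by (intro nn_integral_cong) (auto simp flip: nn_integral_indicator intro!: nn_integral_cong split: split_indicator)
  also have "\<dots> = (\<integral>\<^sup>+a. ennreal (f a) \<partial>P)"
    by (simp add: f_def measure_pmf.emeasure_eq_measure)
  also have "\<dots> = ennreal (measure_pmf.expectation P f)"
    using int by (rule nn_integral_eq_integral) (simp add: f_def)
  finally have "measure_pmf.prob (pair_pmf P Q) {(a, b). W a b} = measure_pmf.expectation P f"
    by (subst (asm) ennreal_inj) (auto simp: f_def integral_nonneg_AE)
  moreover have "c < measure_pmf.expectation P f"
    using int gt by (intro measure_pmf.expectation_greater) (auto simp: AE_measure_pmf_iff)
  ultimately show False using assms by simp
qed

text \<open>The phase is conjugated so that a unanimous correct verdict multiplies the phase of the
  true value to 1. For positive \<open>t\<close> any disagreement or abort gives 0, a neutral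
  contribution.\<close>

definition joint_phase :: "real \<Rightarrow> nat \<Rightarrow> (nat \<Rightarrow> int option) \<Rightarrow> complex" where
  "joint_phase \<theta> t out =
    (if \<exists>v. \<forall>j<t. out j = Some v then cis (- (\<theta> * real_of_int (THE v. \<forall>j<t. out j = Some v))) else 0)"

lemma joint_phase_cong: "(\<And>j. j < t \<Longrightarrow> out j = out' j) \<Longrightarrow> joint_phase \<theta> t out = joint_phase \<theta> t out'"
  unfolding joint_phase_def by (simp cong: all_cong)

lemma norm_joint_phase_le: "cmod (joint_phase \<theta> t out) \<le> 1"
  by (simp add: joint_phase_def)

lemma abs_Re_cis_joint_phase_le: "\<bar>Re (cis a * joint_phase \<theta> t out)\<bar> \<le> 1"
  by (rule order_trans[OF abs_Re_le_cmod]) (simp add: norm_mult norm_joint_phase_le)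

lemma joint_phase_Some:
  assumes "0 < t" "\<And>j. j < t \<Longrightarrow> out j = Some v"
  shows "joint_phase \<theta> t out = cis (- (\<theta> * real_of_int v))"
proof -
  have "(THE v. \<forall>j<t. out j = Some v) = v"
    using assms by (intro the_equality) auto
  thus ?thesis using assms by (auto simp: joint_phase_def)
qed

text \<open>A unanimous correct value gives 1, a unanimous wrong one at least -1, and then every run
  errs; everything else gives 0.\<close>

lemma Re_joint_phase_ge:
  assumes "0 < t"
  shows "Re (cis (\<theta> * real_of_int v) * joint_phase \<theta> t out)
    \<ge> of_bool (\<forall>j<t. out j = Some v) - of_bool (\<forall>j<t. out j \<notin> {Some v, None})"
proof (cases "\<exists>u. \<forall>j<t. out j = Some u")
  case True
  then obtain u where u: "\<And>j. j < t \<Longrightarrow> out j = Some u" by blast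
  have "cis (\<theta> * real_of_int v) * joint_phase \<theta> t out = cis (\<theta> * real_of_int v - \<theta> * real_of_int u)"
    using joint_phase_Some[OF assms, of out u] u by (simp add: cis_mult)
  hence "Re (cis (\<theta> * real_of_int v) * joint_phase \<theta> t out) = cos (\<theta> * real_of_int v - \<theta> * real_of_int u)"
    by (metis cis.sel(1))
  thus ?thesis using u assms by (cases "u = v") auto
next
  case False
  thus ?thesis by (auto simp: joint_phase_def)
qed

text \<open>Both events of the pointwise bound are products over independent runs, so their
  probabilities are \<open>t\<close>-th powers.\<close>

lemma expectation_joint_phase_ge:
  fixes p :: "'r pmf" and out :: "'r \<Rightarrow> int option"
  assumes "0 < t"
  shows "measure_pmf.expectation (Pi_pmf {..<t} d (\<lambda>_. p))
      (\<lambda>rs. Re (cis (\<theta> * real_of_int v) * joint_phase \<theta> t (\<lambda>j. out (rs j))))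
    \<ge> measure_pmf.prob p {r. out r = Some v} ^ t - measure_pmf.prob p {r. out r \<notin> {Some v, None}} ^ t"
proof -
  let ?P = "Pi_pmf {..<t} d (\<lambda>_. p)"
  define A where "A = Pi {..<t} (\<lambda>_. {r. out r = Some v})"
  define B where "B = Pi {..<t} (\<lambda>_. {r. out r \<notin> {Some v, None}})"
  have "measure_pmf.prob p {r. out r = Some v} ^ t - measure_pmf.prob p {r. out r \<notin> {Some v, None}} ^ t
    = measure_pmf.prob ?P A - measure_pmf.prob ?P B"
    unfolding A_def B_def by (simp add: measure_Pi_pmf_Pi)
  also have "\<dots> = measure_pmf.expectation ?P (\<lambda>rs. indicat_real A rs - indicat_real B rs)"
    by (subst Bochner_Integration.integral_diff)
       (auto intro!: measure_pmf.integrable_const_bound[where B = 1] split: split_indicator)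
  also have "\<dots> \<le> measure_pmf.expectation ?P
      (\<lambda>rs. Re (cis (\<theta> * real_of_int v) * joint_phase \<theta> t (\<lambda>j. out (rs j))))"
  proof (intro integral_mono)
    show "integrable (measure_pmf ?P) (\<lambda>rs. Re (cis (\<theta> * real_of_int v) * joint_phase \<theta> t (\<lambda>j. out (rs j))))"
      by (rule measure_pmf.integrable_const_bound[where B = 1])
         (simp_all add: abs_Re_cis_joint_phase_le del: times_complex.sel)
    show "indicat_real A rs - indicat_real B rs
      \<le> Re (cis (\<theta> * real_of_int v) * joint_phase \<theta> t (\<lambda>j. out (rs j)))" for rs
      using Re_joint_phase_ge[OF assms, of "\<lambda>j. out (rs j)" v \<theta>]
      by (simp add: A_def B_def Pi_def indicator_def of_bool_def lessThan_def)
  qed (auto intro!: measure_pmf.integrable_const_bound[where B = 1] split: split_indicator)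
  finally show ?thesis .
qed

text \<open>Repeating the verifier \<open>t\<close> times on one annotation keeps the honest success probability at
  \<open>(2/3)^t\<close> while each of the at most \<open>2^(t-1)\<close> annotations is wrong with probability \<open>(1/3)^t\<close>, so the
  honest contribution survives the sum over all annotations.\<close>

lemma exists_correlated_annotation:
  fixes p :: "'r pmf" and out :: "'h \<Rightarrow> 'i \<Rightarrow> 'r \<Rightarrow> int option" and v :: "'i \<Rightarrow> int"
  assumes fin: "finite H" "H \<noteq> {}" "finite I" and t: "0 < t" "2 * card H \<le> 2 ^ t"
    and sound: "\<And>h i. h \<in> H \<Longrightarrow> i \<in> I \<Longrightarrow> measure_pmf.prob p {r. out h i r \<notin> {Some (v i), None}} \<le> 1/3"
    and complete: "\<And>i. i \<in> I \<Longrightarrow> \<exists>h\<in>H. measure_pmf.prob p {r. out h i r = Some (v i)} \<ge> 2/3"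
  shows "\<exists>h\<in>H. \<exists>rs. real (card I) / 3 ^ t
    \<le> Re (\<Sum>i\<in>I. cis (\<theta> * real_of_int (v i)) * joint_phase \<theta> t (\<lambda>j. out h i (rs j)))"
proof (rule ccontr)
  let ?P = "Pi_pmf {..<t} undefined (\<lambda>_. p)"
  define val where "val h i rs = Re (cis (\<theta> * real_of_int (v i)) * joint_phase \<theta> t (\<lambda>j. out h i (rs j)))" for h i rs
  define c where "c = real (card I) / 3 ^ t"
  assume "\<not> ?thesis"
  hence lt: "(\<Sum>i\<in>I. val h i rs) < c" if "h \<in> H" for h rs
    using that by (auto simp: val_def c_def not_le Re_sum)
  have int: "integrable (measure_pmf ?P) (val h i)" for h i
    by (rule measure_pmf.integrable_const_bound[where B = 1])
       (simp_all add: val_def abs_Re_cis_joint_phase_le del: times_complex.sel)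
  have "(\<Sum>h\<in>H. \<Sum>i\<in>I. measure_pmf.expectation ?P (val h i)) < (\<Sum>h\<in>H. c)"
  proof (rule sum_strict_mono)
    fix h assume h: "h \<in> H"
    have "(\<Sum>i\<in>I. measure_pmf.expectation ?P (val h i)) = measure_pmf.expectation ?P (\<lambda>rs. \<Sum>i\<in>I. val h i rs)"
      using int by (subst Bochner_Integration.integral_sum) auto
    also have "\<dots> < c"
      using lt[OF h] int by (intro measure_pmf.expectation_less) auto
    finally show "(\<Sum>i\<in>I. measure_pmf.expectation ?P (val h i)) < c" .
  qed (use fin in auto)
  \<comment> \<open>At most \<open>2^(t-1)\<close> annotations, each below \<open>c\<close>,
    together stay below half of \<open>(2/3)^t\<close> per input; the estimate for fixed
    \<open>i\<close> below shows that they reach that much.\<close>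
  moreover have "(\<Sum>h\<in>H. c) \<le> 2 ^ t / 2 * c"
  proof -
    have "real (2 * card H) \<le> real (2 ^ t)" using t(2) by (rule of_nat_mono)
    hence "real (card H) \<le> 2 ^ t / 2" by simp
    hence "real (card H) * c \<le> 2 ^ t / 2 * c" by (rule mult_right_mono) (simp add: c_def)
    thus ?thesis by simp
  qed
  moreover have "2 ^ t / 2 * c \<le> (\<Sum>i\<in>I. \<Sum>h\<in>H. measure_pmf.expectation ?P (val h i))"
  proof -
    have "2 ^ t / 2 * c = (\<Sum>i\<in>I. 2 ^ t / 2 / 3 ^ t)" by (simp add: c_def)
    also have "\<dots> \<le> (\<Sum>i\<in>I. \<Sum>h\<in>H. measure_pmf.expectation ?P (val h i))"
    proof (rule sum_mono)
      fix i assume i: "i \<in> I"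
      obtain h0 where h0: "h0 \<in> H" "measure_pmf.prob p {r. out h0 i r = Some (v i)} \<ge> 2/3"
        using complete[OF i] by blast
      \<comment> \<open>Only the honest \<open>h0\<close> is credited with its success probability;
        every \<open>h\<close>, including \<open>h0\<close>, is charged the soundness error.\<close>
      have "(if h = h0 then (2/3) ^ t else 0) - (1/3) ^ t \<le> measure_pmf.expectation ?P (val h i)"
        if h: "h \<in> H" for h
      proof -
        have "(if h = h0 then (2/3) ^ t else 0) \<le> measure_pmf.prob p {r. out h i r = Some (v i)} ^ t"
          using h0 by (auto intro!: power_mono)
        moreover have "measure_pmf.prob p {r. out h i r \<notin> {Some (v i), None}} ^ t \<le> (1/3) ^ t"
          using sound[OF h i] by (intro power_mono) auto
        ultimately show ?thesis
          using expectation_joint_phase_ge[OF t(1), of p "out h i" "v i" undefined \<theta>]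
          unfolding val_def by linarith
      qed
      hence "(\<Sum>h\<in>H. (if h = h0 then (2/3) ^ t else 0) - (1/3) ^ t)
          \<le> (\<Sum>h\<in>H. measure_pmf.expectation ?P (val h i))" by (rule sum_mono)
      moreover have "(\<Sum>h\<in>H. (if h = h0 then (2/3::real) ^ t else 0) - (1/3) ^ t)
          = (2/3) ^ t - real (card H) / 3 ^ t"
        using h0 fin by (simp add: sum_subtractf power_one_over inverse_eq_divide)
      moreover have "2 ^ t / 2 / 3 ^ t \<le> (2/3::real) ^ t - real (card H) / 3 ^ t"
      proof -
        have "real (2 * card H) \<le> real (2 ^ t)" using t(2) by (rule of_nat_mono)
        thus ?thesis by (simp add: power_divide field_simps)
      qed
      ultimately show "2 ^ t / 2 / 3 ^ t \<le> (\<Sum>h\<in>H. measure_pmf.expectation ?P (val h i))" by linarith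
    qed
    finally show ?thesis .
  qed
  ultimately show False by (subst (asm) sum.swap) linarith
qed

section \<open>Hard streams formed from two inputs\<close>

lemma freq_Nil [simp]: "freq [] i = 0"
  by (simp add: freq_def)

lemma freq_Cons [simp]: "freq (u # us) i = (if fst u = i then snd u else 0) + freq us i"
  by (cases u) (simp add: freq_def)

lemma freq_append [simp]: "freq (us @ vs) i = freq us i + freq vs i"
  by (induction us) auto

lemma freq_nonneg: "(\<And>u. u \<in> set us \<Longrightarrow> 0 \<le> snd u) \<Longrightarrow> 0 \<le> freq us i"
  by (induction us) auto

lemma annotated_stream_append:
  "annotated_stream (us @ vs) h = annotated_stream us h @ annotated_stream vs (\<lambda>i. h (length us + i))"
proof -
  have "[1..<Suc (length (us @ vs))] = [1..<Suc (length us)] @ map (\<lambda>i. i + length us) [1..<Suc (length vs)]"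
  proof -
    have "map (\<lambda>i. i + length us) [1..<Suc l] = [Suc (length us)..<Suc (length us) + l]" for l
      by (induction l) auto
    thus ?thesis using upt_add_eq_append[of 1 "Suc (length us)" "length vs"] by simp
  qed
  moreover have "map (\<lambda>i. Update (fst ((us @ vs) ! (i - 1))) (snd ((us @ vs) ! (i - 1))) # map Annotation (h i))
        [1..<Suc (length us)]
      = map (\<lambda>i. Update (fst (us ! (i - 1))) (snd (us ! (i - 1))) # map Annotation (h i)) [1..<Suc (length us)]"
    by (intro map_cong refl) (auto simp: nth_append)
  moreover have "map (\<lambda>i. Update (fst ((us @ vs) ! (i - 1))) (snd ((us @ vs) ! (i - 1))) # map Annotation (h i))
        (map (\<lambda>i. i + length us) [1..<Suc (length vs)])
      = map (\<lambda>i. Update (fst (vs ! (i - 1))) (snd (vs ! (i - 1))) # map Annotation (h (length us + i)))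
        [1..<Suc (length vs)]"
    unfolding map_map by (intro map_cong refl) (auto simp: nth_append add.commute)
  ultimately show ?thesis unfolding annotated_stream_def by (simp only: map_append concat_append)
qed

lemma annotated_stream_cong:
  "(\<And>i. i \<in> {1..length us} \<Longrightarrow> h i = h' i) \<Longrightarrow> annotated_stream us h = annotated_stream us h'"
  unfolding annotated_stream_def by (intro arg_cong[of _ _ concat] map_cong refl) auto

definition item_stream :: "nat \<Rightarrow> (nat \<Rightarrow> int) \<Rightarrow> update list" where
  "item_stream m f = map (\<lambda>i. (Suc i, f i)) [0..<m]"

lemma length_item_stream [simp]: "length (item_stream m f) = m"
  by (simp add: item_stream_def)

lemma freq_item_stream: "freq (item_stream m f) i = (if i \<in> {1..m} then f (i - 1) else 0)"
proof (induction m)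
  case (Suc m)
  have "item_stream (Suc m) f = item_stream m f @ [(Suc m, f m)]" by (simp add: item_stream_def)
  thus ?case using Suc by auto
qed (simp add: item_stream_def)

text \<open>The added 1 makes all \<open>m\<close> final frequencies positive, so the sparsity is
  exactly \<open>m\<close> whatever \<open>x\<close> and \<open>y\<close> are.\<close>

definition two_party_stream :: "nat \<Rightarrow> (nat \<Rightarrow> nat) \<Rightarrow> (nat \<Rightarrow> nat) \<Rightarrow> update list" where
  "two_party_stream m x y = item_stream m (\<lambda>i. 1 + int (x i)) @ item_stream m (\<lambda>i. int (y i))"

lemma freq_two_party_stream:
  "freq (two_party_stream m x y) i = (if i \<in> {1..m} then int (1 + x (i - 1) + y (i - 1)) else 0)"
  by (simp add: two_party_stream_def freq_item_stream)

lemma two_party_stream_promise: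
  assumes "m \<le> n" "1 \<le> d" "\<And>i. i < m \<Longrightarrow> 1 + x i + y i \<le> n"
  shows "two_party_stream m x y \<in> {x \<in> turnstile_streams d n. sparsity n x = m}"
proof -
  have mem: "fst u \<in> {1..n} \<and> 0 \<le> snd u" if "u \<in> set (two_party_stream m x y)" for u
    using that assms(1) by (auto simp: two_party_stream_def item_stream_def)
  have "0 \<le> freq (take t (two_party_stream m x y)) i" for t i
    using mem by (intro freq_nonneg) (meson in_set_takeD)
  hence "strict_turnstile n (two_party_stream m x y)"
    unfolding strict_turnstile_def using mem by auto
  moreover have "freq (two_party_stream m x y) i \<le> int n ^ d" if "i \<in> {1..n}" for i
  proof -
    have "freq (two_party_stream m x y) i \<le> int n"
    proof (cases "i \<in> {1..m}")
      case True
      hence "1 + x (i - 1) + y (i - 1) \<le> n" by (intro assms(3)) auto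
      thus ?thesis unfolding freq_two_party_stream using True by (simp only: if_True of_nat_mono)
    qed (auto simp: freq_two_party_stream)
    also have "int n \<le> int n ^ d"
      using that assms(2) by (intro self_le_power) auto
    finally show ?thesis .
  qed
  moreover have "{i \<in> {1..n}. freq (two_party_stream m x y) i \<noteq> 0} = {1..m}"
    using assms(1) by (auto simp: freq_two_party_stream)
  ultimately show ?thesis by (auto simp: turnstile_streams_def sparsity_def)
qed

lemma freq_moment_two_party_stream:
  assumes "m \<le> n" "1 \<le> k"
  shows "freq_moment k n (two_party_stream m x y) = (\<Sum>i<m. int (1 + x i + y i) ^ k)"
proof -
  have "freq_moment k n (two_party_stream m x y) = (\<Sum>i\<in>{1..m}. freq (two_party_stream m x y) i ^ k)"
    unfolding freq_moment_def using assms
    by (intro sum.mono_neutral_right) (auto simp: freq_two_party_stream)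
  also have "\<dots> = (\<Sum>i<m. int (1 + x i + y i) ^ k)"
    by (rule sum.reindex_bij_witness[of _ Suc "\<lambda>i. i - 1"]) (auto simp: freq_two_party_stream)
  finally show ?thesis .
qed

text \<open>A token is an annotation bit tagged with its position, position 0 serving as padding.\<close>

definition annotation_of_tokens :: "(nat \<times> bool) list \<Rightarrow> nat \<Rightarrow> bool list" where
  "annotation_of_tokens ts i = map snd (filter (\<lambda>tok. fst tok = i) ts)"

text \<open>Tokens are appended position by position and padded to length \<open>a\<close>; position
  0 is never read, since positions count from 1. So \<open>(2 * (N + 1)) ^ a\<close> token lists
  cover all annotations of at most \<open>a\<close> bits.\<close>

lemma annotation_of_tokens_surj:
  assumes "(\<Sum>i=1..N. length (h i)) \<le> a"
  shows "\<exists>ts. set ts \<subseteq> {..N} \<times> UNIV \<and> length ts = a \<and> (\<forall>i\<in>{1..N}. annotation_of_tokens ts i = h i)"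
proof -
  have "\<exists>ts. set ts \<subseteq> {..N} \<times> UNIV \<and> length ts = (\<Sum>i=1..N. length (h i))
      \<and> (\<forall>i\<in>{1..N}. annotation_of_tokens ts i = h i)"
  proof (induction N)
    case (Suc N)
    then obtain ts where ts: "set ts \<subseteq> {..N} \<times> UNIV" "length ts = (\<Sum>i=1..N. length (h i))"
      "\<And>i. i \<in> {1..N} \<Longrightarrow> annotation_of_tokens ts i = h i" by blast
    have 1: "filter (\<lambda>tok. fst tok = Suc N) ts = []"
      using ts(1) by (auto simp: filter_empty_conv)
    have "annotation_of_tokens (ts @ map (Pair (Suc N)) (h (Suc N))) i = h i" if "i \<in> {1..Suc N}" for i
    proof (cases "i = Suc N")
      case True
      thus ?thesis using 1 by (simp add: annotation_of_tokens_def filter_map o_def)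
    next
      case False
      hence "i \<in> {1..N}" using that by auto
      thus ?thesis using ts(3)[of i] False by (simp add: annotation_of_tokens_def filter_map o_def)
    qed
    thus ?case using ts(1,2) by (intro exI[of _ "ts @ map (Pair (Suc N)) (h (Suc N))"]) (auto simp: subset_iff)
  qed simp
  then obtain ts where ts: "set ts \<subseteq> {..N} \<times> UNIV" "length ts = (\<Sum>i=1..N. length (h i))"
      "\<And>i. i \<in> {1..N} \<Longrightarrow> annotation_of_tokens ts i = h i" by blast
  define ts' where "ts' = ts @ replicate (a - length ts) (0, False)"
  have "annotation_of_tokens ts' i = h i" if "i \<in> {1..N}" for i
    using ts(3)[OF that] that by (simp add: annotation_of_tokens_def ts'_def)
  moreover have "set ts' \<subseteq> {..N} \<times> UNIV" "length ts' = a"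
    using ts(1,2) assms by (auto simp: ts'_def)
  ultimately show ?thesis by blast
qed

lemma foldl_step_mem_less:
  assumes "uses_memory V w" "s < 2 ^ w"
  shows "foldl (step_mem V r) s xs < 2 ^ w"
  using assms(2) by (induction xs arbitrary: s) (use assms(1) in \<open>auto simp: uses_memory_def\<close>)

lemma honest_annotation:
  assumes "prescient_scheme D F a w P V" "x \<in> D"
  shows "\<exists>h. annotation_length x h \<le> a \<and>
    measure_pmf.prob (verifier_coins V) {r. verifier_output V r (annotated_stream x h) \<noteq> Some (F x)} \<le> 1/3"
proof -
  have "measure_pmf.prob (pair_pmf (prover_coins P) (verifier_coins V))
      {(rP, rV). verifier_output V rV (annotated_stream x (annotate P x rP)) \<noteq> Some (F x)} \<le> 1/3"
    using assms by (auto simp: prescient_scheme_def completeness_error_le_def)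
  from exists_coins_prob_le[OF this] show ?thesis
    using assms by (auto simp: prescient_scheme_def)
qed

text \<open>Without memory the output ignores the stream, yet raising one frequency from 1 to 2
  changes the moment: two error events of probability at most 1/3 would cover everything.\<close>

lemma scheme_memory_pos:
  assumes sch: "prescient_scheme {x \<in> turnstile_streams d n. sparsity n x = m} (freq_moment k n) a w P V"
    and "2 \<le> n" "m \<in> {1..n}" "2 \<le> k" "1 \<le> d"
  shows "0 < w"
proof (rule ccontr)
  assume "\<not> 0 < w"
  hence mem: "uses_memory V 0" using sch by (simp add: prescient_scheme_def)
  have out: "verifier_output V r xs = result V r 0" for r xs
    using foldl_step_mem_less[OF mem, of "init_mem V r" r xs] mem
    by (simp add: verifier_output_def uses_memory_def)
  define F where "F x = (\<Sum>i<m. int (1 + x i + 0) ^ k)" for x :: "nat \<Rightarrow> nat"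
  have le: "measure_pmf.prob (verifier_coins V) {r. result V r 0 \<noteq> Some (F x)} \<le> 1/3"
    if "\<And>i. x i \<le> 1" for x
  proof -
    have "two_party_stream m x (\<lambda>_. 0) \<in> {x \<in> turnstile_streams d n. sparsity n x = m}"
      using assms that by (intro two_party_stream_promise) (auto intro: order_trans[of _ 2])
    from honest_annotation[OF sch this] show ?thesis
      unfolding out using assms by (auto simp: freq_moment_two_party_stream F_def)
  qed
  define x1 :: "nat \<Rightarrow> nat" where "x1 = (\<lambda>i. if i = 0 then 1 else 0)"
  have "F (\<lambda>_. 0) < F x1"
    unfolding F_def using assms by (intro sum_strict_mono_ex1) (auto simp: x1_def)
  hence "UNIV = {r. result V r 0 \<noteq> Some (F (\<lambda>_. 0))} \<union> {r. result V r 0 \<noteq> Some (F x1)}"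
    by auto
  hence "1 \<le> measure_pmf.prob (verifier_coins V)
      ({r. result V r 0 \<noteq> Some (F (\<lambda>_. 0))} \<union> {r. result V r 0 \<noteq> Some (F x1)})"
    by (metis measure_pmf.prob_space order_refl space_measure_pmf)
  also have "\<dots> \<le> 1/3 + 1/3"
    using le[of "\<lambda>_. 0"] le[of x1]
    by (intro order_trans[OF measure_Un_le] add_mono) (auto simp: x1_def)
  finally show False by simp
qed

text \<open>With \<open>u = q ^ m\<close> there are \<open>u^2\<close> input pairs, so the fourth
  power of the correlation is at least \<open>u^8 / 81^t\<close>;
  \<open>partition_correlation\<close> bounds it by \<open>u^7 * 2^m\<close> times the square of the
  number \<open>2^(w * t)\<close> of messages.\<close>

lemma scheme_correlation_bound:
  assumes sch: "prescient_scheme {x \<in> turnstile_streams d n. sparsity n x = m} (freq_moment k n) a w P V"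
    and m: "m \<le> n" and q: "0 < q" "2 * q \<le> n" and k: "2 \<le> k" and d: "1 \<le> d"
    and t: "0 < t" "2 * (4 * m + 2) ^ a \<le> 2 ^ t"
  shows "real q ^ m \<le> 81 ^ t * 2 ^ (2 * w * t) * 2 ^ m"
proof -
  obtain \<theta> where \<theta>: "(\<Sum>a<q. \<Sum>b<q. (cmod (\<Sum>c<q. cis (\<theta> * real_of_int (int (1 + a + c) ^ k - int (1 + b + c) ^ k))))\<^sup>2)
      \<le> 2 * real q ^ 3"
    using exists_good_angle[OF k] by blast
  define X where "X = {..<m} \<rightarrow>\<^sub>E {..<q}"
  define F where "F x y = (\<Sum>i<m. int (1 + x i + y i) ^ k)" for x y :: "nat \<Rightarrow> nat"
  \<comment> \<open>The streams have length \<open>2 * m\<close>; a position from 0 to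
    \<open>2 * m\<close> and a bit make \<open>4 * m + 2\<close> tokens.\<close>
  define H where "H = {ts. set ts \<subseteq> {..2 * m} \<times> (UNIV :: bool set) \<and> length ts = a}"
  define out where "out ts xy r =
    verifier_output V r (annotated_stream (two_party_stream m (fst xy) (snd xy)) (annotation_of_tokens ts))"
    for ts xy r
  have fX: "finite X" and cX: "card X = q ^ m"
    by (auto simp: X_def finite_PiE card_PiE)
  have fH: "finite H" and cH: "card H = (4 * m + 2) ^ a"
    by (auto simp: H_def finite_lists_length_eq card_lists_length_eq card_cartesian_product algebra_simps)
  have promise: "two_party_stream m x y \<in> {x \<in> turnstile_streams d n. sparsity n x = m}"
    if "x \<in> X" "y \<in> X" for x y
  proof (rule two_party_stream_promise[OF m d])
    fix i assume "i < m"
    hence "x i < q" "y i < q" using that by (auto simp: X_def PiE_iff)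
    thus "1 + x i + y i \<le> n" using q by simp
  qed
  have moment: "freq_moment k n (two_party_stream m x y) = F x y" for x y
    using m k by (simp add: freq_moment_two_party_stream F_def)
  have "\<exists>ts\<in>H. \<exists>rs. real (card (X \<times> X)) / 3 ^ t
      \<le> Re (\<Sum>xy\<in>X \<times> X. cis (\<theta> * real_of_int (F (fst xy) (snd xy))) * joint_phase \<theta> t (\<lambda>j. out ts xy (rs j)))"
  proof (rule exists_correlated_annotation[where p = "verifier_coins V"])
    show "H \<noteq> {}" using cH by auto
    show "2 * card H \<le> 2 ^ t" using t cH by simp
  next
    fix ts xy assume "xy \<in> X \<times> X"
    hence "two_party_stream m (fst xy) (snd xy) \<in> {x \<in> turnstile_streams d n. sparsity n x = m}"
      by (intro promise) auto
    thus "measure_pmf.prob (verifier_coins V) {r. out ts xy r \<notin> {Some (F (fst xy) (snd xy)), None}} \<le> 1/3"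
      using sch unfolding prescient_scheme_def soundness_error_le_def out_def moment[symmetric] by blast
  next
    fix xy assume "xy \<in> X \<times> X"
    hence "two_party_stream m (fst xy) (snd xy) \<in> {x \<in> turnstile_streams d n. sparsity n x = m}"
      by (intro promise) auto
    from honest_annotation[OF sch this] obtain h where
      h: "annotation_length (two_party_stream m (fst xy) (snd xy)) h \<le> a"
      "measure_pmf.prob (verifier_coins V) {r. verifier_output V r
        (annotated_stream (two_party_stream m (fst xy) (snd xy)) h) \<noteq> Some (F (fst xy) (snd xy))} \<le> 1/3"
      unfolding moment by blast
    have len: "length (two_party_stream m (fst xy) (snd xy)) = 2 * m" by (simp add: two_party_stream_def)
    from h(1) obtain ts where ts: "ts \<in> H" "\<And>i. i \<in> {1..2 * m} \<Longrightarrow> annotation_of_tokens ts i = h i"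
      using annotation_of_tokens_surj[of h "2 * m" a] by (auto simp: annotation_length_def len H_def)
    have eq: "annotated_stream (two_party_stream m (fst xy) (snd xy)) (annotation_of_tokens ts)
      = annotated_stream (two_party_stream m (fst xy) (snd xy)) h"
      by (rule annotated_stream_cong) (use ts(2) len in auto)
    have "{r. out ts xy r = Some (F (fst xy) (snd xy))} = - {r. out ts xy r \<noteq> Some (F (fst xy) (snd xy))}"
      by auto
    hence "measure_pmf.prob (verifier_coins V) {r. out ts xy r = Some (F (fst xy) (snd xy))}
      = 1 - measure_pmf.prob (verifier_coins V) {r. out ts xy r \<noteq> Some (F (fst xy) (snd xy))}"
      by (metis Compl_eq_Diff_UNIV measure_pmf.prob_compl sets_measure_pmf space_measure_pmf UNIV_I)
    hence "2/3 \<le> measure_pmf.prob (verifier_coins V) {r. out ts xy r = Some (F (fst xy) (snd xy))}"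
      using h(2) unfolding out_def eq by simp
    thus "\<exists>ts\<in>H. 2/3 \<le> measure_pmf.prob (verifier_coins V) {r. out ts xy r = Some (F (fst xy) (snd xy))}"
      using ts(1) by blast
  qed (use fX fH t in auto)
  then obtain ts rs where big: "real (card (X \<times> X)) / 3 ^ t
      \<le> Re (\<Sum>xy\<in>X \<times> X. cis (\<theta> * real_of_int (F (fst xy) (snd xy))) * joint_phase \<theta> t (\<lambda>j. out ts xy (rs j)))"
    by blast
  \<comment> \<open>The message about \<open>x\<close>: the memories of the \<open>t\<close> runs at
    the cut. Annotation and coins are fixed by now, so nothing else of \<open>x\<close> reaches the
    second half.\<close>
  define \<sigma> where "\<sigma> x = (\<lambda>j\<in>{..<t}. foldl (step_mem V (rs j)) (init_mem V (rs j))
      (annotated_stream (item_stream m (\<lambda>i. 1 + int (x i))) (annotation_of_tokens ts)))" for x :: "nat \<Rightarrow> nat"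
  define g where "g s y = joint_phase \<theta> t (\<lambda>j. result V (rs j) (foldl (step_mem V (rs j)) (s j)
      (annotated_stream (item_stream m (\<lambda>i. int (y i))) (\<lambda>i. annotation_of_tokens ts (m + i)))))"
    for s :: "nat \<Rightarrow> nat" and y :: "nat \<Rightarrow> nat"
  define \<phi> where "\<phi> a b = \<theta> * real_of_int (int (1 + a + b) ^ k)" for a b :: nat
  have g: "joint_phase \<theta> t (\<lambda>j. out ts (x, y) (rs j)) = g (\<sigma> x) y" for x y
    unfolding g_def out_def two_party_stream_def verifier_output_def annotated_stream_append
    by (intro joint_phase_cong) (simp add: \<sigma>_def)
  have mem: "uses_memory V w" using sch by (simp add: prescient_scheme_def)
  hence "init_mem V r < 2 ^ w" for r by (simp add: uses_memory_def)
  hence "\<sigma> x \<in> {..<t} \<rightarrow>\<^sub>E {..<2 ^ w}" for x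
    unfolding \<sigma>_def restrict_PiE_iff using foldl_step_mem_less[OF mem] by simp
  hence "\<sigma> ` X \<subseteq> {..<t} \<rightarrow>\<^sub>E {..<2 ^ w}" by blast
  hence "card (\<sigma> ` X) \<le> card ({..<t} \<rightarrow>\<^sub>E {..<(2::nat) ^ w})"
    by (intro card_mono) (auto simp: finite_PiE)
  hence c\<sigma>: "card (\<sigma> ` X) \<le> 2 ^ (w * t)" by (simp add: card_PiE power_mult)
  have B: "(\<Sum>a<q. \<Sum>b<q. (cmod (\<Sum>c<q. cis (\<phi> a c - \<phi> b c)))\<^sup>2) \<le> 2 * real q ^ 3"
    using \<theta> by (simp add: \<phi>_def right_diff_distrib)
  have "(\<Sum>xy\<in>X \<times> X. cis (\<theta> * real_of_int (F (fst xy) (snd xy))) * joint_phase \<theta> t (\<lambda>j. out ts xy (rs j)))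
      = (\<Sum>x\<in>X. \<Sum>y\<in>X. cis (\<Sum>i<m. \<phi> (x i) (y i)) * g (\<sigma> x) y)"
    unfolding sum.cartesian_product
    by (intro sum.cong refl) (auto simp: g F_def \<phi>_def sum_distrib_left)
  hence "real (card (X \<times> X)) / 3 ^ t \<le> cmod (\<Sum>x\<in>X. \<Sum>y\<in>X. cis (\<Sum>i<m. \<phi> (x i) (y i)) * g (\<sigma> x) y)"
    using order_trans[OF big complex_Re_le_cmod] by simp
  hence "(real (card (X \<times> X)) / 3 ^ t) ^ 4 \<le> cmod (\<Sum>x\<in>X. \<Sum>y\<in>X. cis (\<Sum>i<m. \<phi> (x i) (y i)) * g (\<sigma> x) y) ^ 4"
    by (intro power_mono) auto
  also have "\<dots> \<le> real (2 ^ (w * t)) ^ 2 * (real q ^ m) ^ 4 * (2 * real q ^ 3) ^ m"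
  proof -
    have "cmod (g s y) \<le> 1" for s y by (simp add: g_def norm_joint_phase_le)
    thus ?thesis using partition_correlation[OF B c\<sigma>[unfolded X_def], of g] unfolding X_def by simp
  qed
  finally have main: "(real (card (X \<times> X)) / 3 ^ t) ^ 4
    \<le> real (2 ^ (w * t)) ^ 2 * (real q ^ m) ^ 4 * (2 * real q ^ 3) ^ m" .
  define u where "u = real q ^ m"
  have u: "0 < u" using q by (simp add: u_def)
  have e1: "(real (card (X \<times> X)) / 3 ^ t) ^ 4 = u ^ 7 * u / 81 ^ t"
  proof -
    have "(3 ^ t) ^ 4 = ((3 ^ 4) ^ t :: real)" by (simp only: power_mult[symmetric] mult.commute)
    moreover have "real (card (X \<times> X)) = u * u" by (simp add: card_cartesian_product cX u_def)
    moreover have "(u * u) ^ 4 = u ^ 7 * u" by (simp add: eval_nat_numeral)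
    ultimately show ?thesis by (simp add: power_divide)
  qed
  have e2: "real (2 ^ (w * t)) ^ 2 * (real q ^ m) ^ 4 * (2 * real q ^ 3) ^ m = u ^ 7 * (2 ^ (2 * w * t) * 2 ^ m)"
  proof -
    have "(real q ^ 3) ^ m = u ^ 3" by (simp only: u_def power_mult[symmetric] mult.commute)
    hence "(2 * real q ^ 3) ^ m = 2 ^ m * u ^ 3" by (simp add: power_mult_distrib)
    moreover have "real (2 ^ (w * t)) ^ 2 = 2 ^ (2 * w * t)"
      by (simp only: of_nat_power of_nat_numeral power_mult[symmetric] ac_simps)
    moreover have "u ^ 4 * u ^ 3 = u ^ 7" by (simp flip: power_add)
    ultimately show ?thesis by (simp add: u_def mult.assoc mult.left_commute)
  qed
  have "u / 81 ^ t \<le> 2 ^ (2 * w * t) * 2 ^ m"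
  proof (rule mult_left_le_imp_le)
    show "u ^ 7 * (u / 81 ^ t) \<le> u ^ 7 * (2 ^ (2 * w * t) * 2 ^ m)" using main unfolding e1 e2 by simp
  qed (use u in simp)
  thus ?thesis by (simp add: u_def field_simps)
qed

lemma annotation_memory_tradeoff:
  assumes sch: "prescient_scheme {x \<in> turnstile_streams d n. sparsity n x = m} (freq_moment k n) a w P V"
    and "2 \<le> n" "m \<in> {1..n}" "2 \<le> k" "1 \<le> d" "1 \<le> a"
  shows "m \<le> 512 * (a * w)"
proof -
  have w: "1 \<le> w" using scheme_memory_pos[OF sch] assms by simp
  show ?thesis
  proof (cases "m < 512")
    \<comment> \<open>Small \<open>m\<close> are covered by \<open>a * w \<ge> 1\<close>. From 512
      on, \<open>4 * m + 2\<close> exceeds \<open>2^11\<close>, so that \<open>L \<ge> 12\<close>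
      below and \<open>L \<le> 2 * (L - 6)\<close>.\<close>
    case True
    have "1 * 1 \<le> a * w" using w assms by (intro mult_mono) auto
    thus ?thesis using True by linarith
  next
    case False
    \<comment> \<open>The largest alphabet with \<open>2 * q \<le> m\<close>, which keeps the
      frequencies at most \<open>n\<close>; its growth with \<open>m\<close> yields the factor
      \<open>L\<close> on the left of the final comparison.\<close>
    define q where "q = m div 2"
    obtain L where L: "4 * m + 2 \<le> 2 ^ L" "\<And>l. l < L \<Longrightarrow> 2 ^ l < 4 * m + 2"
    proof -
      define L where "L = (LEAST l. 4 * m + 2 \<le> (2::nat) ^ l)"
      have "4 * m + 2 \<le> (2::nat) ^ (4 * m + 2)" using less_exp[of "4 * m + 2"] by simp
      hence "4 * m + 2 \<le> 2 ^ L" unfolding L_def by (rule LeastI)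
      moreover have "2 ^ l < 4 * m + 2" if "l < L" for l
        using not_less_Least[of l "\<lambda>l. 4 * m + 2 \<le> (2::nat) ^ l"] that by (simp add: L_def not_le)
      ultimately show ?thesis using that by blast
    qed
    have L12: "12 \<le> L"
    proof (rule ccontr)
      assume "\<not> 12 \<le> L"
      hence "(2::nat) ^ L \<le> 2 ^ 11" by (intro power_increasing) auto
      thus False using L(1) False by simp
    qed
    have pL: "(2::nat) ^ L = 64 * 2 ^ (L - 6)" "(2::nat) ^ L = 2 * 2 ^ (L - 1)"
      using L12 power_add[of "2::nat" 6 "L - 6"] power_add[of "2::nat" 1 "L - 1"] by auto
    have "2 ^ (L - 1) < 4 * m + 2" using L12 by (intro L(2)) auto
    hence "64 * 2 ^ (L - 6) \<le> 8 * m + 2" using pL by linarith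
    \<comment> \<open>The spare factor 2 cancels \<open>2 ^ m\<close> in the correlation
      bound.\<close>
    hence q2: "2 * 2 ^ (L - 6) \<le> q" using False unfolding q_def by linarith
    define t where "t = a * L + 1"
    have "(4 * m + 2) ^ a \<le> (2 ^ L) ^ a" using L(1) by (rule power_mono) simp
    hence t: "2 * (4 * m + 2) ^ a \<le> 2 ^ t" by (simp add: t_def power_mult mult.commute)
    have "real q ^ m \<le> 81 ^ t * 2 ^ (2 * w * t) * 2 ^ m"
      using assms False by (intro scheme_correlation_bound[OF sch _ _ _ _ _ _ t]) (auto simp: q_def t_def)
    moreover have "(2 * 2 ^ (L - 6)) ^ m \<le> real q ^ m"
    proof (rule power_mono)
      show "2 * 2 ^ (L - 6) \<le> real q" using of_nat_mono[OF q2, where ?'a = real] by simp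
    qed simp
    moreover have "(81::real) ^ t \<le> (2 ^ 7) ^ t" by (intro power_mono) auto
    hence "(81::real) ^ t * (2 ^ (2 * w * t) * 2 ^ m) \<le> (2 ^ 7) ^ t * (2 ^ (2 * w * t) * 2 ^ m)"
      by (rule mult_right_mono) simp
    ultimately have "(2 * 2 ^ (L - 6)) ^ m \<le> (2 ^ 7) ^ t * 2 ^ (2 * w * t) * (2::real) ^ m"
      unfolding mult.assoc by linarith
    hence "(2 ^ (L - 6)) ^ m * 2 ^ m \<le> ((2 ^ 7) ^ t * 2 ^ (2 * w * t)) * (2::real) ^ m"
      by (simp add: power_mult_distrib mult.commute)
    hence "(2 ^ (L - 6)) ^ m \<le> (2 ^ 7) ^ t * (2::real) ^ (2 * w * t)"
      by (rule mult_right_le_imp_le) simp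
    hence "(2::real) ^ ((L - 6) * m) \<le> 2 ^ (7 * t + 2 * w * t)"
      by (simp only: power_mult power_add)
    hence "(L - 6) * m \<le> 7 * t + 2 * w * t" by simp
    also have "7 * t \<le> 7 * (w * t)" using w by simp
    hence "7 * t + 2 * w * t \<le> 9 * (w * t)" by (simp add: algebra_simps)
    also have "t \<le> 2 * (a * L)" using assms(6) L12 by (simp add: t_def)
    hence "9 * (w * t) \<le> 9 * (w * (2 * (a * L)))" by (intro mult_left_mono) auto
    finally have "(L - 6) * m \<le> L * (18 * (a * w))" by (simp add: algebra_simps)
    moreover have "L * m \<le> 2 * (L - 6) * m" using L12 by (intro mult_right_mono) auto
    moreover have "L * (18 * (a * w)) = 18 * (L * (a * w))" "L * (36 * (a * w)) = 36 * (L * (a * w))"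
      by simp_all
    ultimately have "L * m \<le> L * (36 * (a * w))" unfolding mult.assoc by linarith
    hence "m \<le> 36 * (a * w)" using L12 by (simp only: mult_le_cancel1)
    thus ?thesis by simp
  qed
qed

section \<open>Primes and polynomials modulo a prime\<close>

text \<open>Induction along the Leibniz harmonic triangle, whose entries are the numbers
  \<open>1 / (m * (n choose m))\<close>.\<close>

lemma times_binomial_dvd_common_multiple:
  assumes "1 \<le> m" "m \<le> n" "n \<le> N" and L: "\<And>j. 1 \<le> j \<Longrightarrow> j \<le> N \<Longrightarrow> j dvd L"
  shows "(of_nat L / of_nat (m * (n choose m)) :: rat) \<in> \<int>"
  using assms(1-3)
proof (induction m arbitrary: n rule: dec_induct)
  case base
  then obtain c where "L = n * c" using L[of n] by (auto simp: dvd_def)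
  thus ?case using base by simp
next
  case (step m)
  then obtain n' where n: "n = Suc n'" and mn: "m \<le> n'" by (cases n) auto
  obtain j where m: "m = Suc j" using step by (cases m) auto
  define A where "A = (of_nat (n' choose m) :: rat)"
  define B where "B = (of_nat (n' choose j) :: rat)"
  have pos: "A > 0" "B > 0" using mn m by (auto simp: A_def B_def)
  have r0: "of_nat (m * (n' choose m)) = of_nat m * A" by (simp add: A_def)
  have r1: "of_nat (Suc m * (Suc n' choose Suc m)) = of_nat (Suc n') * A"
    by (simp only: Suc_times_binomial A_def of_nat_mult)
  have r2: "of_nat (m * (Suc n' choose m)) = of_nat (Suc n') * B"
    unfolding m by (simp only: Suc_times_binomial B_def of_nat_mult)
  have "A + B = of_nat (Suc n' choose m)" unfolding m A_def B_def by simp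
  hence "of_nat m * (A + B) = of_nat (Suc n') * B" using r2 by simp
  hence "inverse (of_nat (Suc n') * A) = inverse (of_nat m * A) - inverse (of_nat (Suc n') * B)"
    using pos m by (simp add: divide_simps) (simp add: algebra_simps)
  hence "(of_nat L / of_nat (Suc m * (n choose Suc m)) :: rat)
      = of_nat L / of_nat (m * (n' choose m)) - of_nat L / of_nat (m * (n choose m))"
    unfolding n r0 r1 r2 by (simp only: divide_inverse right_diff_distrib)
  moreover have "of_nat L / of_nat (m * (n' choose m)) \<in> (\<int> :: rat set)"
    using step mn n by (intro step.IH) auto
  moreover have "of_nat L / of_nat (m * (n choose m)) \<in> (\<int> :: rat set)"
    using step mn n by (intro step.IH) auto
  ultimately show ?case by (simp only: Ints_diff)
qed

text \<open>The \<open>n\<close> numbers \<open>m * (n choose m)\<close> with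
  \<open>1 \<le> m \<le> n\<close> sum to \<open>n * 2^(n-1)\<close>, and each divides
  \<open>L\<close>, hence is at most \<open>L\<close>.\<close>

lemma two_power_le_common_multiple:
  assumes L: "\<And>j. 1 \<le> j \<Longrightarrow> j \<le> n \<Longrightarrow> j dvd L" and "0 < L" "0 < n"
  shows "2 ^ (n - 1) \<le> L"
proof -
  have le: "m * (n choose m) \<le> L" if "m \<in> {..n}" for m
  proof (cases "m = 0")
    case False
    have pos: "0 < m * (n choose m)" using that False by simp
    have "(of_nat L / of_nat (m * (n choose m)) :: rat) \<in> \<int>"
      using that False by (intro times_binomial_dvd_common_multiple[OF _ _ order_refl L]) auto
    then obtain z where "(of_nat L / of_nat (m * (n choose m)) :: rat) = of_int z" by (auto elim: Ints_cases)
    hence "(of_int (int L) :: rat) = of_int (z * int (m * (n choose m)))"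
      using pos by (simp add: field_simps del: of_nat_mult)
    hence "int L = z * int (m * (n choose m))" by (simp only: of_int_eq_iff)
    hence "m * (n choose m) dvd L" by (metis dvd_triv_right int_dvd_int_iff)
    thus ?thesis using assms(2) by (rule dvd_imp_le)
  qed simp
  have "n * 2 ^ (n - 1) = (\<Sum>m\<le>n. m * (n choose m))" by (rule choose_linear_sum[symmetric])
  also have "\<dots> = (\<Sum>m\<in>{1..n}. m * (n choose m))"
    by (rule sum.mono_neutral_right) auto
  also have "\<dots> \<le> (\<Sum>m\<in>{1..n}. L)" using le by (intro sum_mono) auto
  finally show ?thesis using assms(3) by simp
qed

text \<open>If all primes up to \<open>n = 4 * X^2\<close> were at most \<open>X\<close>, at most
  \<open>X\<close> prime powers, each at most \<open>n\<close>, would multiply to a common multiple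
  of \<open>1, ..., n\<close>; but \<open>n ^ X\<close> is less than \<open>2 ^ (n - 1)\<close>. A
  quadratic gap is enough, as only the bit length of \<open>p\<close> matters.\<close>

lemma prime_between:
  assumes "2 \<le> X"
  shows "\<exists>p::nat. prime p \<and> X < p \<and> p \<le> 4 * X\<^sup>2"
proof (rule ccontr)
  assume no: "\<not> ?thesis"
  define n where "n = 4 * X\<^sup>2"
  have n: "0 < n" "1 \<le> n" using assms by (auto simp: n_def Suc_le_eq)
  define Q where "Q = {q::nat. prime q \<and> q \<le> X}"
  \<comment> \<open>For a prime \<open>q\<close> this is the largest exponent \<open>t\<close> with
    \<open>q ^ t \<le> n\<close>.\<close>
  define e where "e q = (LEAST t. n < q ^ Suc t)" for q
  have e: "n < q ^ Suc (e q)" "q ^ e q \<le> n" if "prime q" for q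
  proof -
    have q2: "2 \<le> q" using that by (rule prime_ge_2_nat)
    have "n < 2 ^ Suc n" using less_exp[of "Suc n"] by linarith
    also have "\<dots> \<le> q ^ Suc n" using q2 by (intro power_mono) auto
    finally have "n < q ^ Suc n" .
    thus "n < q ^ Suc (e q)" unfolding e_def by (rule LeastI)
    show "q ^ e q \<le> n"
    proof (cases "e q")
      case 0
      thus ?thesis using n by simp
    next
      case (Suc t)
      hence "\<not> n < q ^ Suc t" using not_less_Least[of t "\<lambda>t. n < q ^ Suc t"] by (simp add: e_def)
      thus ?thesis using Suc by simp
    qed
  qed
  have fQ: "finite Q" by (rule finite_subset[of _ "{..X}"]) (auto simp: Q_def)
  have "Q \<subseteq> {1..X}" using prime_ge_1_nat by (auto simp: Q_def)
  hence cQ: "card Q \<le> X" using card_mono[of "{1..X}" Q] by simp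
  define L where "L = (\<Prod>q\<in>Q. q ^ e q)"
  have L0: "0 < L" unfolding L_def by (intro prod_pos) (auto simp: Q_def prime_gt_0_nat)
  have "L \<le> (\<Prod>q\<in>Q. n)" unfolding L_def using e(2) by (intro prod_mono) (auto simp: Q_def)
  also have "\<dots> = n ^ card Q" by simp
  also have "\<dots> \<le> n ^ X" using cQ n by (intro power_increasing) auto
  finally have Lle: "L \<le> n ^ X" .
  have "j dvd L" if j: "1 \<le> j" "j \<le> n" for j
  proof (rule multiplicity_le_imp_dvd)
    fix q :: nat assume q: "prime q"
    show "multiplicity q j \<le> multiplicity q L"
    proof (cases "q dvd j")
      case True
      hence "q \<le> n" using j by (auto dest: dvd_imp_le)
      hence "q \<in> Q" using no q by (auto simp: Q_def n_def not_less)
      hence "q ^ e q dvd L" unfolding L_def using fQ by (intro dvd_prodI) auto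
      hence "e q \<le> multiplicity q L"
        using q L0 by (intro multiplicity_geI) (auto simp: prime_gt_1_nat)
      moreover have "multiplicity q j \<le> e q"
      proof (rule ccontr)
        assume "\<not> ?thesis"
        hence "q ^ Suc (e q) dvd q ^ multiplicity q j" by (intro le_imp_power_dvd) auto
        also have "\<dots> dvd j" by (rule multiplicity_dvd)
        finally have "q ^ Suc (e q) \<le> j" using j by (intro dvd_imp_le) auto
        thus False using e(1)[OF q] j by linarith
      qed
      ultimately show ?thesis by linarith
    qed (simp add: not_dvd_imp_multiplicity_0)
  qed (use j in auto)
  from two_power_le_common_multiple[OF this L0 n(1)] have "2 ^ (n - 1) \<le> n ^ X" using Lle by linarith
  also have "n ^ X \<le> (2 ^ (2 + 2 * X)) ^ X"
  proof (rule power_mono)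
    have "X\<^sup>2 \<le> (2 ^ X)\<^sup>2" using less_exp[of X] by (intro power_mono) auto
    moreover have "(2::nat) ^ (2 + 2 * X) = 4 * (2 ^ X)\<^sup>2"
      by (simp only: power_add mult.commute[of 2 X] power_mult) simp
    ultimately show "n \<le> 2 ^ (2 + 2 * X)" by (simp add: n_def)
  qed simp
  also have "(2 ^ (2 + 2 * X)) ^ X = (2::nat) ^ ((2 + 2 * X) * X)" by (rule power_mult[symmetric])
  finally have "n - 1 \<le> (2 + 2 * X) * X" by simp
  hence "4 * X\<^sup>2 \<le> 2 * X + 2 * X\<^sup>2 + 1" by (simp add: n_def algebra_simps power2_eq_square)
  moreover have "2 * X \<le> X\<^sup>2" using assms by (simp add: power2_eq_square)
  moreover have "4 \<le> X\<^sup>2" using power_mono[OF assms, of 2] by simp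
  ultimately show False by linarith
qed

text \<open>Splitting off a linear factor keeps the other roots, because \<open>p\<close> is prime
  and distinct elements of \<open>{0..<p}\<close> differ modulo \<open>p\<close>. Speaking of values
  instead of coefficients keeps all polynomials over the integers.\<close>

lemma poly_mod_prime_roots:
  fixes f :: "int poly"
  assumes p: "prime p" and A: "finite A" "A \<subseteq> {0..<p}" and "\<And>r. r \<in> A \<Longrightarrow> p dvd poly f r"
    and "degree f < card A"
  shows "p dvd poly f x"
  using assms(2-5)
proof (induction "degree f" arbitrary: f A x)
  case 0
  then obtain r where "r \<in> A" by fastforce
  hence "p dvd poly f r" using 0 by blast
  moreover obtain c where "f = [:c:]" using 0(1) by (metis degree_eq_zeroE)
  ultimately show ?case by simp
next
  case (Suc n)
  then obtain r where r: "r \<in> A" by fastforce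
  define g where "g = synthetic_div f r"
  have "[:-r, 1:] * g + [:poly f r:] = f" unfolding g_def by (rule synthetic_div_correct')
  hence f: "poly f y = (y - r) * poly g y + poly f r" for y
    by (metis (no_types, lifting) ab_group_add_class.ab_diff_conv_add_uminus add.commute add.right_neutral
        mult.right_neutral mult_zero_right poly_0 poly_add poly_mult poly_pCons)
  have pr: "p dvd poly f r" using Suc r by blast
  have "p dvd poly g y" for y
  proof (rule Suc.hyps(1))
    show "n = degree g" using Suc.hyps(2) by (simp add: g_def degree_synthetic_div)
    show "finite (A - {r})" "A - {r} \<subseteq> {0..<p}" using Suc.prems by auto
    show "degree g < card (A - {r})" using Suc.hyps(2) Suc.prems r by (simp add: g_def degree_synthetic_div)
    fix r' assume r': "r' \<in> A - {r}"
    have "p dvd poly f r' - poly f r" using Suc.prems r' pr by (intro dvd_diff) auto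
    hence "p dvd (r' - r) * poly g r'" using f[of r'] by simp
    moreover have "\<not> p dvd r' - r"
    proof
      assume "p dvd r' - r"
      hence "r' mod p = r mod p" by (simp add: mod_eq_dvd_iff)
      moreover have "r' \<in> {0..<p}" "r \<in> {0..<p}" using Suc.prems r r' by auto
      ultimately show False using r' by simp
    qed
    ultimately show "p dvd poly g r'" using p by (simp add: prime_dvd_mult_iff)
  qed
  thus ?case using pr f[of x] by simp
qed

text \<open>The usual product formula; division by its value at \<open>x\<close> becomes
  multiplication by a Bezout inverse, which exists since nodes below \<open>K \<le> p\<close> are
  distinct modulo \<open>p\<close>.\<close>

lemma lagrange_basis_mod:
  fixes p :: int
  assumes "prime p" "int K \<le> p"
  shows "\<exists>\<beta> :: nat \<Rightarrow> int poly. \<forall>x<K. degree (\<beta> x) \<le> K - 1 \<and>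
    (\<forall>x'<K. p dvd poly (\<beta> x) (int x') - of_bool (x = x'))"
proof -
  have "\<exists>f :: int poly. degree f \<le> K - 1 \<and> (\<forall>x'<K. p dvd poly f (int x') - of_bool (x = x'))" if x: "x < K" for x
  proof -
    define g where "g = (\<Prod>y\<in>{..<K} - {x}. [:- int y, 1:])"
    have "degree g = (\<Sum>y\<in>{..<K} - {x}. degree [:- int y, 1:])" unfolding g_def by (rule degree_prod_sum_eq) auto
    hence dg: "degree g = K - 1" using x by simp
    have pg: "poly g z = (\<Prod>y\<in>{..<K} - {x}. z - int y)" for z unfolding g_def by (simp add: poly_prod)
    have "coprime (poly g (int x)) p"
      unfolding pg
    proof (rule prod_coprime_left)
      fix y assume y: "y \<in> {..<K} - {x}"
      have "\<not> p dvd int x - int y"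
      proof
        assume "p dvd int x - int y"
        hence "int x mod p = int y mod p" by (simp add: mod_eq_dvd_iff)
        thus False using x y assms by simp
      qed
      thus "coprime (int x - int y) p" using assms(1) by (metis prime_imp_coprime coprime_commute)
    qed
    moreover obtain u v where "u * poly g (int x) + v * p = gcd (poly g (int x)) p" using bezout_int by blast
    ultimately have uv: "u * poly g (int x) - 1 = p * (- v)" by (simp add: algebra_simps)
    have "p dvd poly (smult u g) (int x') - of_bool (x = x')" if "x' < K" for x'
    proof (cases "x = x'")
      case True
      thus ?thesis using uv by simp
    next
      case False
      hence "poly g (int x') = 0" unfolding pg using that by (intro prod_zero) auto
      thus ?thesis using False by simp
    qed
    moreover have "degree (smult u g) \<le> K - 1" using dg by (metis degree_smult_le)
    ultimately show ?thesis by blast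
  qed
  thus ?thesis by metis
qed

section \<open>Numbers encoded in blocks of annotation bits\<close>

definition bits_chunk :: "nat \<Rightarrow> bool list \<Rightarrow> nat \<Rightarrow> nat" where
  "bits_chunk B bs j = (\<Sum>t<B. if bs ! (j * B + t) then 2 ^ t else 0)"

lemma bits_chunk_surj:
  assumes "\<And>j. j < c \<Longrightarrow> v j < 2 ^ B"
  shows "\<exists>bs. length bs = c * B \<and> (\<forall>j<c. bits_chunk B bs j = v j)"
proof (intro exI conjI allI impI)
  define bs where "bs = map (\<lambda>t. bit (v (t div B)) (t mod B)) [0..<c * B]"
  show "length bs = c * B" by (simp add: bs_def)
  fix j assume j: "j < c"
  have "bs ! (j * B + t) = bit (v j) t" if "t < B" for t
  proof -
    have "Suc j * B \<le> c * B" using j by (intro mult_right_mono) auto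
    hence "j * B + t < c * B" using that by simp
    thus ?thesis using that by (simp add: bs_def)
  qed
  hence "bits_chunk B bs j = (\<Sum>t<B. push_bit t (of_bool (bit (v j) t)))"
    unfolding bits_chunk_def by (intro sum.cong) (auto simp: push_bit_eq_mult)
  also have "\<dots> = take_bit B (v j)" by (simp add: take_bit_sum lessThan_atLeast0)
  also have "\<dots> = v j" using assms[OF j] by (simp add: take_bit_nat_eq_self)
  finally show "bits_chunk B bs j = v j" .
qed

section \<open>Hashing and verifiers\<close>

lemma card_multiples_below:
  assumes "0 < M"
  shows "M * card {u\<in>{1..<p}. M dvd u} \<le> p - (1::nat)"
proof -
  have "{u\<in>{1..<p}. M dvd u} \<subseteq> (\<lambda>t. M * t) ` {1..(p - 1) div M}"
  proof
    fix u assume u: "u \<in> {u\<in>{1..<p}. M dvd u}"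
    then obtain t where t: "u = M * t" by (auto simp: dvd_def)
    have "u \<le> p - 1" using u by auto
    hence "t \<le> (p - 1) div M" using t assms by (simp add: less_eq_div_iff_mult_less_eq mult.commute)
    moreover have "1 \<le> t" using u t by (cases t) auto
    ultimately show "u \<in> (\<lambda>t. M * t) ` {1..(p - 1) div M}" using t by auto
  qed
  hence "card {u\<in>{1..<p}. M dvd u} \<le> card ((\<lambda>t. M * t) ` {1..(p - 1) div M})"
    by (intro card_mono) auto
  also have "\<dots> \<le> (p - 1) div M" using card_image_le[of "{1..(p - 1) div M}" "\<lambda>t. M * t"] by simp
  finally have "M * card {u\<in>{1..<p}. M dvd u} \<le> M * ((p - 1) div M)" by (rule mult_left_mono) simp
  also have "\<dots> \<le> p - 1" by simp
  finally show ?thesis .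
qed

text \<open>The map from \<open>a\<close> to \<open>a * (j - i) mod p\<close> is injective. A
  collision makes the two residues differ by a multiple of \<open>M\<close>, so the image
  \<open>u\<close> satisfies \<open>M dvd u\<close> or \<open>M dvd p - u\<close>, depending on the
  sign of the difference; each case leaves at most \<open>(p - 1) / M\<close> values.\<close>

lemma card_hash_collisions:
  fixes p M i j :: nat
  assumes p: "prime p" and M: "0 < M" and ij: "i < j" "j < p"
  shows "M * card {a\<in>{1..<p}. (a * i mod p) mod M = (a * j mod p) mod M} \<le> 2 * (p - 1)"
proof -
  define A where "A = {a\<in>{1..<p}. (a * i mod p) mod M = (a * j mod p) mod M}"
  define u where "u a = (a * (j - i)) mod p" for a
  define U1 where "U1 = {u\<in>{1..<p}. M dvd u}"
  define U2 where "U2 = {u\<in>{1..<p}. M dvd p - u}"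
  have p0: "0 < p" using p by (simp add: prime_gt_0_nat)
  have nd: "\<not> p dvd j - i" using ij by (auto dest: dvd_imp_le)
  have inj: "inj_on u {1..<p}"
  proof (rule inj_onI)
    fix a b assume ab: "a \<in> {1..<p}" "b \<in> {1..<p}" "u a = u b"
    have *: False if "a < b" "b < p" "u a = u b" for a b
    proof -
      have "p dvd b * (j - i) - a * (j - i)"
        using that by (subst mod_eq_dvd_iff_nat[symmetric]) (auto simp: u_def)
      hence "p dvd (b - a) * (j - i)" by (simp add: diff_mult_distrib)
      hence "p dvd b - a" using p nd by (simp add: prime_dvd_mult_iff)
      thus False using that by (auto dest: dvd_imp_le)
    qed
    show "a = b" using *[of a b] *[of b a] ab by (cases a b rule: linorder_cases) auto
  qed
  have img: "u ` A \<subseteq> U1 \<union> U2"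
  proof
    fix v assume "v \<in> u ` A"
    then obtain a where a: "a \<in> A" "v = u a" by blast
    have a1: "1 \<le> a" "a < p" using a by (auto simp: A_def)
    have "\<not> p dvd a" using a1 by (auto dest: dvd_imp_le)
    hence "\<not> p dvd a * (j - i)" using p nd by (simp add: prime_dvd_mult_iff)
    hence v: "v \<in> {1..<p}" using a p0 by (auto simp: u_def dvd_eq_mod_eq_0 Suc_le_eq)
    define x where "x = a * i mod p"
    define y where "y = a * j mod p"
    have xy: "x < p" "y < p" "x mod M = y mod M" using a p0 by (auto simp: A_def x_def y_def)
    have "int v = (int a * int j - int a * int i) mod int p"
      using ij a by (simp add: u_def zmod_int of_nat_diff right_diff_distrib)
    also have "\<dots> = (int y - int x) mod int p"
      unfolding x_def y_def zmod_int of_nat_mult by (rule mod_diff_eq[symmetric])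
    finally have iv: "int v = (int y - int x) mod int p" .
    show "v \<in> U1 \<union> U2"
    proof (cases "x \<le> y")
      case True
      hence "int v = int y - int x" using iv xy by simp
      hence "v = y - x" using True by linarith
      hence "M dvd v" using True xy mod_eq_dvd_iff_nat[of x y M] by simp
      thus ?thesis using v by (simp add: U1_def)
    next
      case False
      have "(int y - int x) mod int p = (int y - int x + int p) mod int p" by simp
      also have "\<dots> = int y - int x + int p" using False xy by (intro mod_pos_pos_trivial) auto
      finally have "p - v = x - y" using iv False xy by linarith
      hence "M dvd p - v" using False xy mod_eq_dvd_iff_nat[of y x M] by simp
      thus ?thesis using v by (simp add: U2_def)
    qed
  qed
  have "card A = card (u ` A)"
    by (rule card_image[symmetric], rule inj_on_subset[OF inj]) (auto simp: A_def)
  also have "\<dots> \<le> card (U1 \<union> U2)" using img by (intro card_mono) (auto simp: U1_def U2_def)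
  also have "\<dots> \<le> card U1 + card U2" by (rule card_Un_le)
  also have "card U2 = card U1"
    unfolding U1_def U2_def
    by (rule bij_betw_same_card[of "\<lambda>v. p - v"], rule bij_betwI[of _ _ _ "\<lambda>v. p - v"]) auto
  finally have "M * card A \<le> 2 * (M * card U1)" using M by simp
  also have "\<dots> \<le> 2 * (p - 1)" using card_multiples_below[OF M, of p] by (simp add: U1_def)
  finally show ?thesis by (simp add: A_def)
qed

text \<open>Averaging over multipliers: at most \<open>(card S)^2 / 2\<close> pairs, each colliding
  for at most \<open>2 * (p - 1) / M\<close> multipliers, give a mean of at most \<open>K\<close>
  colliding pairs. Only the larger member of a pair is counted, because removing it already breaks
  the collision.\<close>

lemma exists_hash_few_collisions:
  fixes p M K :: nat
  assumes p: "prime p" and M: "0 < M" and S: "finite S" "\<And>i. i \<in> S \<Longrightarrow> i < p" "(card S)\<^sup>2 \<le> K * M"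
  shows "\<exists>a<p. card {j\<in>S. \<exists>i\<in>S. i < j \<and> (a * i mod p) mod M = (a * j mod p) mod M} \<le> K"
proof (rule ccontr)
  define coll where "coll a t \<longleftrightarrow> (a * fst t mod p) mod M = (a * snd t mod p) mod M" for a and t :: "nat \<times> nat"
  define T where "T = {t\<in>S \<times> S. fst t < snd t}"
  assume "\<not> ?thesis"
  hence big: "K < card {j\<in>S. \<exists>i\<in>S. i < j \<and> (a * i mod p) mod M = (a * j mod p) mod M}" if "a < p" for a
    using that by (auto simp: not_le)
  have fT: "finite T" using S by (auto simp: T_def)
  have big': "K < card {t\<in>T. coll a t}" if "a < p" for a
  proof -
    have "{j\<in>S. \<exists>i\<in>S. i < j \<and> (a * i mod p) mod M = (a * j mod p) mod M} \<subseteq> snd ` {t\<in>T. coll a t}"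
      by (force simp: T_def coll_def)
    from order_trans[OF card_mono[OF _ this] card_image_le] show ?thesis
      using big[OF that] fT by fastforce
  qed
  have "2 * card T \<le> card (S \<times> S)"
  proof -
    have "card (prod.swap ` T) = card T" by (rule card_image) (auto simp: inj_on_def)
    moreover have "T \<inter> prod.swap ` T = {}" by (auto simp: T_def)
    ultimately have "card (T \<union> prod.swap ` T) = 2 * card T" using fT by (simp add: card_Un_disjoint)
    moreover have "card (T \<union> prod.swap ` T) \<le> card (S \<times> S)"
      using S by (intro card_mono) (auto simp: T_def)
    ultimately show ?thesis by simp
  qed
  hence cT: "2 * card T \<le> K * M" using S(3) by (simp add: card_cartesian_product power2_eq_square)
  have "M * ((p - 1) * Suc K) = M * (\<Sum>a\<in>{1..<p}. Suc K)" by simp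
  also have "\<dots> \<le> M * (\<Sum>a\<in>{1..<p}. card {t\<in>T. coll a t})"
    using big' by (intro mult_left_mono sum_mono) (auto simp: Suc_le_eq)
  also have "(\<Sum>a\<in>{1..<p}. card {t\<in>T. coll a t}) = (\<Sum>t\<in>T. card {a\<in>{1..<p}. coll a t})"
    using fT by (intro sum_multicount_gen) auto
  also have "M * \<dots> = (\<Sum>t\<in>T. M * card {a\<in>{1..<p}. coll a t})" by (rule sum_distrib_left)
  also have "\<dots> \<le> (\<Sum>t\<in>T. 2 * (p - 1))"
    unfolding coll_def using S(2) by (intro sum_mono card_hash_collisions[OF p M]) (auto simp: T_def)
  also have "\<dots> = (p - 1) * (2 * card T)" by simp
  also have "\<dots> \<le> (p - 1) * (K * M)" using cT by (intro mult_left_mono) auto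
  finally have "((p - 1) * M) * Suc K \<le> ((p - 1) * M) * K" by (simp add: ac_simps)
  moreover have "0 < (p - 1) * M" using M prime_gt_1_nat[OF p] by simp
  ultimately have "Suc K \<le> K" using mult_le_cancel1[of "(p - 1) * M"] by blast
  thus False by simp
qed

text \<open>A deterministic machine \<open>pstep\<close> of unbounded memory may be run in small memory as long as
  what the verifier needs of its state is a function \<open>\<alpha> r\<close> compatible with the steps.\<close>

lemma verifier_of_abstraction:
  fixes pstep :: "'g \<Rightarrow> symbol \<Rightarrow> 'g" and \<alpha> :: "nat \<Rightarrow> 'g \<Rightarrow> 's"
  assumes St: "finite St" "card St \<le> 2 ^ w"
    and inv0: "I g0" and inv_step: "\<And>g s. I g \<Longrightarrow> I (pstep g s)"
    and mem: "\<And>r g. I g \<Longrightarrow> \<alpha> r g \<in> St"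
    and cong: "\<And>r g g' s. I g \<Longrightarrow> I g' \<Longrightarrow> \<alpha> r g = \<alpha> r g' \<Longrightarrow> \<alpha> r (pstep g s) = \<alpha> r (pstep g' s)"
  shows "\<exists>V. verifier_coins V = coins \<and> uses_memory V w \<and>
    (\<forall>r xs. verifier_output V r xs = res r (\<alpha> r (foldl pstep g0 xs)))"
proof -
  have "card St \<le> card {..<(2::nat) ^ w}" using St by simp
  then obtain c where c: "c ` St \<subseteq> {..<(2::nat) ^ w}" "inj_on c St"
    using card_le_inj[OF St(1), of "{..<(2::nat) ^ w}"] by auto
  \<comment> \<open>An arbitrary state with code \<open>s\<close> is stepped; by \<open>cong\<close>
    the choice does not matter. Codes that stem from no state map to 0, as the memory bound concerns
    all numbers below \<open>2 ^ w\<close>.\<close>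
  define step where "step r s a = (let g = (SOME g. I g \<and> c (\<alpha> r g) = s) in
    if I g \<and> c (\<alpha> r g) = s then c (\<alpha> r (pstep g a)) else 0)" for r s a
  define V where "V = \<lparr>verifier_coins = coins, init_mem = \<lambda>r. c (\<alpha> r g0), step_mem = step,
    result = \<lambda>r s. res r (inv_into St c s)\<rparr>"
  have less: "c (\<alpha> r g) < 2 ^ w" if "I g" for r g using c mem[OF that] by auto
  have st: "step r (c (\<alpha> r g)) a = c (\<alpha> r (pstep g a))" if g: "I g" for r g a
  proof -
    define g' where "g' = (SOME g'. I g' \<and> c (\<alpha> r g') = c (\<alpha> r g))"
    have g': "I g' \<and> c (\<alpha> r g') = c (\<alpha> r g)" 
      unfolding g'_def by (rule someI[where x = g]) (use g in simp)
    hence "\<alpha> r g' = \<alpha> r g" using c(2) mem g by (auto dest: inj_onD)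
    hence "\<alpha> r (pstep g' a) = \<alpha> r (pstep g a)" using g g' by (intro cong) auto
    thus ?thesis using g' by (simp add: step_def g'_def[symmetric])
  qed
  have "I (foldl pstep g0 xs) \<and> foldl (step r) (c (\<alpha> r g0)) xs = c (\<alpha> r (foldl pstep g0 xs))" for r xs
    by (induction xs rule: rev_induct) (simp_all add: inv0 inv_step st)
  hence "verifier_output V r xs = res r (\<alpha> r (foldl pstep g0 xs))" for r xs
    unfolding verifier_output_def by (simp add: V_def inv_into_f_f[OF c(2)] mem)
  moreover have "uses_memory V w"
    using less inv0 inv_step unfolding uses_memory_def by (auto simp: V_def step_def Let_def)
  moreover have "verifier_coins V = coins" by (simp add: V_def)
  ultimately show ?thesis by blast
qed

text \<open>The control states of the verifier, keeping everything read so far: an annotation of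
  \<open>l1\<close> bits configures the verifier after the first update, another one of \<open>l2\<close> bits is read after
  the last update.\<close>

datatype transcript = Start | Reject | Config update "bool list" | Active "bool list" "update list" "bool list"

text \<open>The first update is held back: no annotation can precede it, and its effect on the
  sketch depends on the configuration. An update after a bit of the final message leads to
  \<open>Reject\<close>, so this message always refers to the complete stream.\<close>

fun transcript_step :: "nat \<Rightarrow> nat \<Rightarrow> transcript \<Rightarrow> symbol \<Rightarrow> transcript" where
  "transcript_step l1 l2 Start (Update i \<delta>) = Config (i, \<delta>) []"
| "transcript_step l1 l2 Start (Annotation b) = Reject"
| "transcript_step l1 l2 Reject s = Reject"
| "transcript_step l1 l2 (Config u bs) (Update i \<delta>) = Reject"
| "transcript_step l1 l2 (Config u bs) (Annotation b) =
    (if Suc (length bs) < l1 then Config u (bs @ [b]) else Active (bs @ [b]) [u] [])"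
| "transcript_step l1 l2 (Active bs xs us) (Update i \<delta>) =
    (if us = [] then Active bs (xs @ [(i, \<delta>)]) [] else Reject)"
| "transcript_step l1 l2 (Active bs xs us) (Annotation b) =
    (if length us < l2 then Active bs xs (us @ [b]) else Reject)"

definition transcript_bounded :: "nat \<Rightarrow> nat \<Rightarrow> transcript \<Rightarrow> bool" where
  "transcript_bounded l1 l2 g = (case g of
      Config u bs \<Rightarrow> length bs < l1
    | Active bs xs us \<Rightarrow> length bs = l1 \<and> length us \<le> l2
    | _ \<Rightarrow> True)"

lemma transcript_bounded_step:
  "0 < l1 \<Longrightarrow> transcript_bounded l1 l2 g \<Longrightarrow> transcript_bounded l1 l2 (transcript_step l1 l2 g s)"
  by (cases "(l1, l2, g, s)" rule: transcript_step.cases) (auto simp: transcript_bounded_def)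

fun updates_of :: "symbol list \<Rightarrow> update list" where
  "updates_of [] = []"
| "updates_of (Update i \<delta> # ss) = (i, \<delta>) # updates_of ss"
| "updates_of (Annotation b # ss) = updates_of ss"

lemma updates_of_append [simp]: "updates_of (ss @ ts) = updates_of ss @ updates_of ts"
  by (induction ss rule: updates_of.induct) auto

lemma updates_of_map_Annotation [simp]: "updates_of (map Annotation bs) = []"
  by (induction bs) auto

lemma annotated_stream_Nil [simp]: "annotated_stream [] h = []"
  by (simp add: annotated_stream_def)

lemma annotated_stream_single: "annotated_stream [u] h = Update (fst u) (snd u) # map Annotation (h 1)"
  by (simp add: annotated_stream_def)

lemma updates_of_annotated_stream [simp]: "updates_of (annotated_stream x h) = x"
  by (induction x rule: rev_induct) (simp_all add: annotated_stream_append annotated_stream_single)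

text \<open>For soundness: no annotation, however malformed, can falsify the recorded updates
  without leading to \<open>Reject\<close>.\<close>

lemma transcript_updates:
  "case foldl (transcript_step l1 l2) Start ss of
      Start \<Rightarrow> updates_of ss = []
    | Config u bs \<Rightarrow> updates_of ss = [u]
    | Active bs xs us \<Rightarrow> updates_of ss = xs
    | Reject \<Rightarrow> True"
proof (induction ss rule: rev_induct)
  case (snoc s ss)
  thus ?case
    by (cases "foldl (transcript_step l1 l2) Start ss"; cases s) auto
qed simp

lemma transcript_config_bits:
  "length bs + length cs = l1 \<Longrightarrow> cs \<noteq> [] \<Longrightarrow>
    foldl (transcript_step l1 l2) (Config u bs) (map Annotation cs) = Active (bs @ cs) [u] []"
proof (induction cs arbitrary: bs)
  case (Cons c cs)
  show ?case
  proof (cases "cs = []")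
    case False
    hence "Suc (length bs) < l1" using Cons.prems by (cases cs) auto
    thus ?thesis using Cons.IH[of "bs @ [c]"] Cons.prems False by simp
  qed (use Cons.prems in auto)
qed simp

lemma transcript_final_bits:
  "length us + length cs \<le> l2 \<Longrightarrow>
    foldl (transcript_step l1 l2) (Active bs xs us) (map Annotation cs) = Active bs xs (us @ cs)"
  by (induction cs arbitrary: us) auto

lemma transcript_updates_only:
  "(\<And>i. i \<in> {1..length x} \<Longrightarrow> h i = []) \<Longrightarrow>
    foldl (transcript_step l1 l2) (Active bs xs []) (annotated_stream x h) = Active bs (xs @ x) []"
  by (induction x rule: rev_induct) (simp_all add: annotated_stream_append annotated_stream_single)

lemma transcript_honest:
  assumes "x \<noteq> []" "length bs = l1" "length us = l2" "0 < l1"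
    and h: "h = (\<lambda>i. (if i = 1 then bs else []) @ (if i = length x then us else []))"
  shows "foldl (transcript_step l1 l2) Start (annotated_stream x h) = Active bs x us"
proof -
  obtain u v where x: "x = u # v" using assms(1) by (cases x) auto
  have app: "annotated_stream x h = annotated_stream [u] h @ annotated_stream v (\<lambda>i. h (1 + i))"
    using annotated_stream_append[of "[u]" v h] by (simp add: x)
  have cfg: "foldl (transcript_step l1 l2) (Config u []) (map Annotation bs) = Active bs [u] []"
    using assms by (subst transcript_config_bits) auto
  show ?thesis
  proof (cases "v = []")
    \<comment> \<open>Both strings follow the only update; the length \<open>l1\<close> alone
      separates them.\<close>
    case True
    have "annotated_stream [u] h = Update (fst u) (snd u) # map Annotation bs @ map Annotation us"
      by (simp add: annotated_stream_single h x True)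
    thus ?thesis unfolding app using assms True x cfg by (simp add: transcript_final_bits)
  next
    case False
    then obtain v' z where v: "v = v' @ [z]" by (cases v rule: rev_cases) auto
    have 1: "annotated_stream [u] h = Update (fst u) (snd u) # map Annotation bs"
      by (simp add: annotated_stream_single h x v)
    have 2: "annotated_stream v (\<lambda>i. h (1 + i)) =
        annotated_stream v' (\<lambda>i. h (1 + i)) @ Update (fst z) (snd z) # map Annotation us"
      unfolding v annotated_stream_append annotated_stream_single using assms(4) by (simp add: h x v)
    have 3: "foldl (transcript_step l1 l2) (Active bs [u] []) (annotated_stream v' (\<lambda>i. h (1 + i)))
        = Active bs (u # v') []"
      by (subst transcript_updates_only) (auto simp: h x v)
    show ?thesis unfolding app 1 2 using assms(3) cfg 3 x v by (simp add: transcript_final_bits)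
  qed
qed

section \<open>Moments of buckets\<close>

lemma sum_power_le_power_sum:
  fixes f :: "'a \<Rightarrow> int"
  assumes "finite S" "\<And>i. i \<in> S \<Longrightarrow> 0 \<le> f i" "1 \<le> k"
  shows "(\<Sum>i\<in>S. f i ^ k) \<le> (\<Sum>i\<in>S. f i) ^ k"
proof -
  obtain k' where k: "k = Suc k'" using assms(3) by (cases k) auto
  have "(\<Sum>i\<in>S. f i ^ k) \<le> (\<Sum>i\<in>S. f i * (\<Sum>i\<in>S. f i) ^ k')"
    unfolding k power_Suc using assms
    by (intro sum_mono mult_left_mono power_mono member_le_sum) auto
  thus ?thesis by (simp add: k sum_distrib_right)
qed

lemma power_sum_eq_sum_power:
  fixes f :: "'a \<Rightarrow> int"
  assumes "finite S" "\<And>i j. i \<in> S \<Longrightarrow> j \<in> S \<Longrightarrow> i \<noteq> j \<Longrightarrow> f i * f j = 0" "1 \<le> k"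
  shows "(\<Sum>i\<in>S. f i) ^ k = (\<Sum>i\<in>S. f i ^ k)"
proof (cases "\<exists>i\<in>S. f i \<noteq> 0")
  case True
  then obtain i where i: "i \<in> S" "f i \<noteq> 0" by blast
  hence 0: "f j = 0" if "j \<in> S - {i}" for j using assms(2)[of i j] that by auto
  hence "(\<Sum>j\<in>S. f j) = f i" "(\<Sum>j\<in>S. f j ^ k) = f i ^ k"
    using i assms by (auto simp: sum.remove[of S i])
  thus ?thesis by simp
qed (use assms in simp)

text \<open>Lagrange's identity with weights \<open>f\<close>, obtained by expanding the
  square.\<close>

lemma second_moment_determinant:
  fixes f g :: "'a \<Rightarrow> int"
  shows "2 * ((\<Sum>i\<in>S. f i) * (\<Sum>i\<in>S. f i * g i ^ 2) - (\<Sum>i\<in>S. f i * g i)\<^sup>2)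
    = (\<Sum>i\<in>S. \<Sum>j\<in>S. f i * f j * (g i - g j)\<^sup>2)"
proof -
  have "(\<Sum>i\<in>S. \<Sum>j\<in>S. f i * f j * (g i - g j)\<^sup>2)
    = (\<Sum>i\<in>S. \<Sum>j\<in>S. (f i * g i ^ 2) * f j + f i * (f j * g j ^ 2) - 2 * ((f i * g i) * (f j * g j)))"
    by (intro sum.cong refl) (simp add: power2_eq_square algebra_simps)
  also have "\<dots> = (\<Sum>i\<in>S. f i * g i ^ 2) * (\<Sum>i\<in>S. f i) + (\<Sum>i\<in>S. f i) * (\<Sum>i\<in>S. f i * g i ^ 2)
     - 2 * ((\<Sum>i\<in>S. f i * g i) * (\<Sum>i\<in>S. f i * g i))"
    by (simp add: sum.distrib sum_subtractf sum_product flip: sum_distrib_left)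
  finally show ?thesis by (simp add: power2_eq_square algebra_simps)
qed

lemma second_moment_determinant_nonneg:
  fixes f g :: "'a \<Rightarrow> int"
  assumes "\<And>i. i \<in> S \<Longrightarrow> 0 \<le> f i"
  shows "0 \<le> (\<Sum>i\<in>S. f i) * (\<Sum>i\<in>S. f i * g i ^ 2) - (\<Sum>i\<in>S. f i * g i)\<^sup>2"
proof -
  have "0 \<le> 2 * ((\<Sum>i\<in>S. f i) * (\<Sum>i\<in>S. f i * g i ^ 2) - (\<Sum>i\<in>S. f i * g i)\<^sup>2)"
    unfolding second_moment_determinant using assms by (intro sum_nonneg) auto
  thus ?thesis by (simp only: zero_le_mult_iff) simp
qed

text \<open>The double sum of Lagrange's identity has nonnegative terms, so it vanishes termwise;
  injectivity of \<open>g\<close> keeps the square factor nonzero for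
  \<open>i \<noteq> j\<close>.\<close>

lemma second_moment_determinant_eq_0_iff:
  fixes f g :: "'a \<Rightarrow> int"
  assumes "finite S" "\<And>i. i \<in> S \<Longrightarrow> 0 \<le> f i" "inj_on g S"
  shows "(\<Sum>i\<in>S. f i) * (\<Sum>i\<in>S. f i * g i ^ 2) - (\<Sum>i\<in>S. f i * g i)\<^sup>2 = 0
    \<longleftrightarrow> (\<forall>i\<in>S. \<forall>j\<in>S. i \<noteq> j \<longrightarrow> f i * f j = 0)"
proof -
  have "(\<Sum>i\<in>S. f i) * (\<Sum>i\<in>S. f i * g i ^ 2) - (\<Sum>i\<in>S. f i * g i)\<^sup>2 = 0
      \<longleftrightarrow> (\<Sum>i\<in>S. \<Sum>j\<in>S. f i * f j * (g i - g j)\<^sup>2) = 0"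
    by (simp only: second_moment_determinant[symmetric] mult_eq_0_iff) simp
  also have "\<dots> \<longleftrightarrow> (\<forall>i\<in>S. (\<Sum>j\<in>S. f i * f j * (g i - g j)\<^sup>2) = 0)"
    using assms by (intro sum_nonneg_eq_0_iff sum_nonneg) auto
  also have "\<dots> \<longleftrightarrow> (\<forall>i\<in>S. \<forall>j\<in>S. f i * f j * (g i - g j)\<^sup>2 = 0)"
    using assms by (intro ball_cong refl sum_nonneg_eq_0_iff) auto
  also have "\<dots> \<longleftrightarrow> (\<forall>i\<in>S. \<forall>j\<in>S. i \<noteq> j \<longrightarrow> f i * f j = 0)"
    using assms(3) by (auto simp: inj_on_def)
  finally show ?thesis .
qed

text \<open>The contribution of a bucket with item count \<open>a\<close>, first moment \<open>b\<close> and second moment \<open>c\<close> (of the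
  item numbers). The determinant vanishes exactly if all occurrences in the bucket are of one item,
  so a total below \<open>\<Lambda>\<close> certifies the absence of collisions.\<close>

definition bucket_term :: "nat \<Rightarrow> int \<Rightarrow> 'a::comm_ring_1 \<Rightarrow> 'a \<Rightarrow> 'a \<Rightarrow> 'a" where
  "bucket_term k \<Lambda> a b c = a ^ k + of_int \<Lambda> * (a * c - b\<^sup>2)"

text \<open>No assumption on collisions is made: \<open>hash\<close> stands for whatever function
  the prover announced, \<open>I\<close> for the items not listed as exceptional.\<close>

locale hashed_items =
  fixes I :: "nat set" and f :: "nat \<Rightarrow> int" and hash :: "nat \<Rightarrow> 'b" and Bk :: "'b set" and k n :: nat and N :: int
  assumes finite_I: "finite I" and I_le: "\<And>i. i \<in> I \<Longrightarrow> i \<le> n" and finite_Bk: "finite Bk"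
    and hash_Bk: "\<And>i. i \<in> I \<Longrightarrow> hash i \<in> Bk"
    and f_nonneg: "\<And>i. i \<in> I \<Longrightarrow> 0 \<le> f i" and sum_f: "(\<Sum>i\<in>I. f i) \<le> N" and k_pos: "1 \<le> k"
begin

definition moment :: "nat \<Rightarrow> 'b \<Rightarrow> int" where
  "moment c b = (\<Sum>i\<in>{i\<in>I. hash i = b}. f i * int i ^ c)"

definition defect :: "'b \<Rightarrow> int" where
  "defect b = moment 0 b * moment 2 b - (moment 1 b)\<^sup>2"

definition total :: int where
  "total = (\<Sum>b\<in>Bk. bucket_term k (N ^ k + 1) (moment 0 b) (moment 1 b) (moment 2 b))"

lemma total_eq: "total = (\<Sum>b\<in>Bk. moment 0 b ^ k) + (N ^ k + 1) * (\<Sum>b\<in>Bk. defect b)"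
  by (simp add: total_def bucket_term_def defect_def sum.distrib sum_distrib_left)

lemma moment_nonneg: "0 \<le> moment c b"
  unfolding moment_def using f_nonneg by (intro sum_nonneg) auto

lemma N_nonneg: "0 \<le> N"
  using sum_nonneg[of I f] f_nonneg sum_f by fastforce

lemma sum_moment: "(\<Sum>b\<in>Bk. moment c b) = (\<Sum>i\<in>I. f i * int i ^ c)"
  unfolding moment_def using finite_I finite_Bk hash_Bk by (intro sum.group) auto

lemma defect_nonneg: "0 \<le> defect b"
  using second_moment_determinant_nonneg[of "{i\<in>I. hash i = b}" f int] f_nonneg
  by (simp add: defect_def moment_def)

lemma sum_moment_power_le: "(\<Sum>b\<in>Bk. moment 0 b ^ k) \<le> N ^ k"
proof -
  have "(\<Sum>b\<in>Bk. moment 0 b ^ k) \<le> (\<Sum>b\<in>Bk. moment 0 b) ^ k"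
    using finite_Bk moment_nonneg k_pos by (intro sum_power_le_power_sum) auto
  also have "\<dots> \<le> N ^ k"
    using sum_f f_nonneg by (intro power_mono) (auto simp: sum_moment intro: sum_nonneg)
  finally show ?thesis .
qed

lemma sum_defect_le: "(\<Sum>b\<in>Bk. defect b) \<le> N * (N * int n ^ 2)"
proof -
  have m2: "moment 2 b \<le> N * int n ^ 2" for b
  proof -
    have "moment 2 b \<le> (\<Sum>i\<in>{i\<in>I. hash i = b}. f i * int n ^ 2)"
      unfolding moment_def using f_nonneg I_le by (intro sum_mono mult_left_mono power_mono) auto
    also have "\<dots> \<le> (\<Sum>i\<in>I. f i * int n ^ 2)"
      using finite_I f_nonneg by (intro sum_mono2) auto
    also have "\<dots> = (\<Sum>i\<in>I. f i) * int n ^ 2" by (simp add: sum_distrib_right)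
    also have "\<dots> \<le> N * int n ^ 2" using sum_f by (intro mult_right_mono) auto
    finally show ?thesis .
  qed
  have "(\<Sum>b\<in>Bk. defect b) \<le> (\<Sum>b\<in>Bk. moment 0 b * (N * int n ^ 2))"
  proof (rule sum_mono)
    fix b
    have "moment 0 b * moment 2 b \<le> moment 0 b * (N * int n ^ 2)"
      using m2 moment_nonneg by (intro mult_left_mono) auto
    moreover have "0 \<le> (moment 1 b)\<^sup>2" by simp
    ultimately show "defect b \<le> moment 0 b * (N * int n ^ 2)" unfolding defect_def by linarith
  qed
  also have "\<dots> = (\<Sum>i\<in>I. f i) * (N * int n ^ 2)" using sum_moment[of 0] by (simp flip: sum_distrib_right)
  also have "\<dots> \<le> N * (N * int n ^ 2)" using sum_f N_nonneg by (intro mult_right_mono) auto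
  finally show ?thesis .
qed

lemma total_nonneg: "0 \<le> total"
  unfolding total_eq using moment_nonneg defect_nonneg N_nonneg
  by (intro add_nonneg_nonneg mult_nonneg_nonneg sum_nonneg) auto

text \<open>This covers hash functions with many collisions too, so a prime above the bound lets the
  residue determine \<open>total\<close> even for a dishonest configuration.\<close>

lemma total_le: "total \<le> N ^ k + (N ^ k + 1) * (N * (N * int n ^ 2))"
  unfolding total_eq using sum_moment_power_le sum_defect_le N_nonneg by (intro add_mono mult_left_mono) auto

lemma total_eq_moment:
  assumes "\<And>i j. i \<in> I \<Longrightarrow> j \<in> I \<Longrightarrow> i \<noteq> j \<Longrightarrow> hash i = hash j \<Longrightarrow> f i * f j = 0"
  shows "total = (\<Sum>i\<in>I. f i ^ k)" and "total < N ^ k + 1"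
proof -
  have "defect b = 0" for b
    using second_moment_determinant_eq_0_iff[of "{i\<in>I. hash i = b}" f int] f_nonneg finite_I assms
    by (auto simp: defect_def moment_def)
  hence t: "total = (\<Sum>b\<in>Bk. moment 0 b ^ k)" by (simp add: total_eq)
  also have "\<dots> = (\<Sum>b\<in>Bk. \<Sum>i\<in>{i\<in>I. hash i = b}. f i ^ k)"
  proof (rule sum.cong[OF refl])
    fix b
    have "(\<Sum>i\<in>{i\<in>I. hash i = b}. f i) ^ k = (\<Sum>i\<in>{i\<in>I. hash i = b}. f i ^ k)"
      using finite_I k_pos assms by (intro power_sum_eq_sum_power) auto
    thus "moment 0 b ^ k = (\<Sum>i\<in>{i\<in>I. hash i = b}. f i ^ k)" by (simp add: moment_def)
  qed
  also have "\<dots> = (\<Sum>i\<in>I. f i ^ k)"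
    using finite_I finite_Bk hash_Bk by (intro sum.group) auto
  finally show "total = (\<Sum>i\<in>I. f i ^ k)" .
  show "total < N ^ k + 1" using t sum_moment_power_le by simp
qed

text \<open>The defects are nonnegative integers, so a nonzero sum of them would already push
  \<open>total\<close> to \<open>N ^ k + 1\<close>.\<close>

lemma total_small_imp_moment:
  assumes "total < N ^ k + 1"
  shows "total = (\<Sum>i\<in>I. f i ^ k)"
proof (rule total_eq_moment(1))
  have L: "0 < N ^ k + 1" using N_nonneg by (simp add: add_nonneg_pos)
  have "(N ^ k + 1) * (\<Sum>b\<in>Bk. defect b) \<le> total"
    unfolding total_eq using moment_nonneg by (simp add: sum_nonneg)
  hence "(N ^ k + 1) * (\<Sum>b\<in>Bk. defect b) < (N ^ k + 1) * 1" using assms by simp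
  hence "(\<Sum>b\<in>Bk. defect b) < 1" using L by (simp only: mult_less_cancel_left_pos)
  moreover have "0 \<le> (\<Sum>b\<in>Bk. defect b)" using defect_nonneg by (intro sum_nonneg) auto
  ultimately have "(\<Sum>b\<in>Bk. defect b) = 0" by linarith
  hence d0: "defect b = 0" if "b \<in> Bk" for b
    using that sum_nonneg_eq_0_iff[of Bk defect] finite_Bk defect_nonneg by blast
  fix i j assume ij: "i \<in> I" "j \<in> I" "i \<noteq> j" "hash i = hash j"
  have "\<forall>i\<in>{l\<in>I. hash l = hash j}. \<forall>j\<in>{l\<in>I. hash l = hash j}. i \<noteq> j \<longrightarrow> f i * f j = 0"
    using second_moment_determinant_eq_0_iff[of "{l\<in>I. hash l = hash j}" f int] f_nonneg finite_I
      d0[OF hash_Bk[OF ij(2)]]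
    by (simp add: defect_def moment_def)
  thus "f i * f j = 0" using ij by auto
qed

end

section \<open>The sum-check verifier\<close>

lemma dvd_mult_diff_mult:
  fixes p :: "'a::comm_ring_1"
  assumes "p dvd a - a'" "p dvd b - b'"
  shows "p dvd a * b - a' * b'"
proof -
  have "a * b - a' * b' = a * (b - b') + (a - a') * b'" by (simp add: algebra_simps)
  thus ?thesis using assms by simp
qed

lemma dvd_bucket_term_diff:
  fixes p :: "'a::comm_ring_1"
  assumes "p dvd a - a'" "p dvd b - b'" "p dvd c - c'"
  shows "p dvd bucket_term k \<Lambda> a b c - bucket_term k \<Lambda> a' b' c'"
proof -
  have "p dvd a ^ k - a' ^ k"
    by (induction k) (use assms(1) in \<open>simp_all add: dvd_mult_diff_mult\<close>)
  moreover have "p dvd (a * c - a' * c') - (b * b - b' * b')"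
    using dvd_diff[OF dvd_mult_diff_mult[OF assms(1,3)] dvd_mult_diff_mult[OF assms(2,2)]] .
  ultimately have "p dvd (a ^ k - a' ^ k) + of_int \<Lambda> * ((a * c - a' * c') - (b * b - b' * b'))"
    by (intro dvd_add dvd_mult)
  thus ?thesis by (simp add: bucket_term_def power2_eq_square algebra_simps)
qed

section \<open>Linear sketches and bitwise evaluation of the message\<close>

definition linear_sketch :: "(nat \<Rightarrow> int) \<Rightarrow> update list \<Rightarrow> int" where
  "linear_sketch w xs = (\<Sum>u\<leftarrow>xs. snd u * w (fst u))"

lemma linear_sketch_snoc [simp]: "linear_sketch w (xs @ [u]) = linear_sketch w xs + snd u * w (fst u)"
  by (simp add: linear_sketch_def)

lemma linear_sketch_eq_sum_freq:
  assumes "\<And>i. i \<notin> {1..n} \<Longrightarrow> w i = 0"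
  shows "linear_sketch w xs = (\<Sum>i\<in>{1..n}. freq xs i * w i)"
proof (induction xs)
  case (Cons u xs)
  have "(\<Sum>i\<in>{1..n}. (if fst u = i then snd u else 0) * w i) = snd u * w (fst u)"
    using assms[of "fst u"] by (cases "fst u \<in> {1..n}") (auto simp: if_distrib[of "\<lambda>t. t * _"] sum.delta cong: if_cong)
  thus ?case using Cons by (simp add: linear_sketch_def distrib_right sum.distrib)
qed (simp add: linear_sketch_def)

text \<open>Coefficient \<open>j\<close> is the number encoded by the \<open>j\<close>-th block of
  \<open>B\<close> bits. Each bit adds its own monomial, so values of the polynomial can be updated
  bit by bit without storing the message.\<close>

definition message_poly :: "nat \<Rightarrow> bool list \<Rightarrow> int poly" where
  "message_poly B us = (\<Sum>i<length us. monom (of_bool (us ! i) * 2 ^ (i mod B)) (i div B))"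

lemma message_poly_Nil [simp]: "message_poly B [] = 0"
  by (simp add: message_poly_def)

lemma message_poly_snoc:
  "message_poly B (us @ [b]) = message_poly B us + monom (of_bool b * 2 ^ (length us mod B)) (length us div B)"
proof -
  have "(\<Sum>i<length us. monom (of_bool ((us @ [b]) ! i) * 2 ^ (i mod B)) (i div B)) = message_poly B us"
    unfolding message_poly_def by (intro sum.cong refl) (simp add: nth_append)
  thus ?thesis by (simp add: message_poly_def)
qed

lemma degree_message_poly:
  assumes "length us \<le> D * B"
  shows "degree (message_poly B us) \<le> D - 1"
  unfolding message_poly_def
proof (rule degree_sum_le)
  fix i assume "i \<in> {..<length us}"
  hence "i < D * B" using assms by simp
  hence "i div B < D" by (rule less_mult_imp_div_less)
  thus "degree (monom (of_bool (us ! i) * 2 ^ (i mod B) :: int) (i div B)) \<le> D - 1"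
    by (intro order_trans[OF degree_monom_le]) simp
qed simp

lemma poly_message_poly:
  assumes "length us = D * B"
  shows "poly (message_poly B us) z = (\<Sum>j<D. int (bits_chunk B us j) * z ^ j)"
proof -
  have "poly (message_poly B us) z = (\<Sum>i<D * B. of_bool (us ! i) * 2 ^ (i mod B) * z ^ (i div B))"
    by (simp add: message_poly_def poly_sum poly_monom assms)
  also have "\<dots> = (\<Sum>j<D. \<Sum>i\<in>{j * B..<j * B + B}. of_bool (us ! i) * 2 ^ (i mod B) * z ^ (i div B))"
    by (rule sum.nat_group[symmetric])
  also have "\<dots> = (\<Sum>j<D. int (bits_chunk B us j) * z ^ j)"
  proof (rule sum.cong[OF refl])
    fix j
    have "(\<Sum>i\<in>{j * B..<j * B + B}. of_bool (us ! i) * 2 ^ (i mod B) * z ^ (i div B))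
        = (\<Sum>t<B. of_bool (us ! (j * B + t)) * 2 ^ t * z ^ j)"
      by (subst sum.atLeastLessThan_shift_0) (auto simp: lessThan_atLeast0 intro!: sum.cong)
    also have "\<dots> = int (bits_chunk B us j) * z ^ j"
      unfolding bits_chunk_def of_nat_sum sum_distrib_right by (intro sum.cong) auto
    finally show "(\<Sum>i\<in>{j * B..<j * B + B}. of_bool (us ! i) * 2 ^ (i mod B) * z ^ (i div B))
        = int (bits_chunk B us j) * z ^ j" .
  qed
  finally show ?thesis .
qed


type_synonym memory = "nat \<times> nat \<times> int \<times> bool list \<times> int list \<times> nat \<times> int \<times> int"

text \<open>The polynomials \<open>\<beta> x\<close> form the Lagrange basis modulo \<open>p\<close> for the nodes \<open>0, ..., K - 1\<close>.\<close>

locale sumcheck =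
  fixes n k d K B p :: nat and \<beta> :: "nat \<Rightarrow> int poly"
  assumes n_pos: "1 \<le> n" and k_pos: "1 \<le> k" and K_pos: "1 \<le> K"
    and p_prime: "prime p" and p_less: "p < 2 ^ B" and soundness_size: "3 * (2 * k * K) \<le> p"
    and n_less: "n ^ Suc d < p"
    and total_less: "(int n ^ Suc d) ^ k + ((int n ^ Suc d) ^ k + 1) * (int n ^ Suc d * (int n ^ Suc d * int n ^ 2)) < int p"
    and \<beta>: "\<And>x. x < K \<Longrightarrow> degree (\<beta> x) \<le> K - 1"
      "\<And>x x'. x < K \<Longrightarrow> x' < K \<Longrightarrow> int p dvd poly (\<beta> x) (int x') - of_bool (x = x')"
begin

definition hash :: "bool list \<Rightarrow> nat \<Rightarrow> nat" where
  "hash bs i = (bits_chunk B bs 0 * i mod p) mod (K * K)"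

definition exceptional :: "bool list \<Rightarrow> nat \<Rightarrow> bool" where
  "exceptional bs i \<longleftrightarrow> (\<exists>j<K. bits_chunk B bs (Suc j) = i)"

text \<open>Row \<open>hash mod K\<close>, column \<open>hash div K\<close>: an item enters the
  low-degree extension of its row through the Lagrange polynomial of its column.\<close>

definition weight :: "bool list \<Rightarrow> nat \<Rightarrow> nat \<Rightarrow> nat \<Rightarrow> int poly" where
  "weight bs c y i = (if i \<in> {1..n} \<and> \<not> exceptional bs i \<and> hash bs i mod K = y
     then smult (int i ^ c) (\<beta> (hash bs i div K)) else 0)"

text \<open>Counting only the first occurrence keeps a prover from inflating the answer by listing
  an item twice.\<close>

definition listed_first :: "bool list \<Rightarrow> nat \<Rightarrow> nat \<Rightarrow> int" where
  "listed_first bs j i =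
     of_bool (i \<in> {1..n} \<and> bits_chunk B bs (Suc j) = i \<and> (\<forall>j'<j. bits_chunk B bs (Suc j') \<noteq> i))"

text \<open>Slot \<open>c * K + y\<close> with \<open>c < 3\<close> holds the extension of the \<open>c\<close>-th moments of row \<open>y\<close> to the column \<open>\<rho>\<close>,
  slot \<open>3 * K + j\<close> the frequency of the \<open>j\<close>-th listed item, or 0 if it was listed before.\<close>

definition slot_weight :: "bool list \<Rightarrow> int \<Rightarrow> nat \<Rightarrow> nat \<Rightarrow> int" where
  "slot_weight bs \<rho> s i =
     (if s < 3 * K then poly (weight bs (s div K) (s mod K) i) \<rho> else listed_first bs (s - 3 * K) i)"

definition slots :: "bool list \<Rightarrow> int \<Rightarrow> update list \<Rightarrow> int list" where
  "slots bs \<rho> xs = map (\<lambda>s. linear_sketch (slot_weight bs \<rho> s) xs mod int p) [0..<4 * K]"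

text \<open>Room for \<open>2 * k * K\<close> coefficients, more than the degree of the claimed
  polynomial.\<close>

definition final_length :: nat where
  "final_length = 2 * k * K * B"

text \<open>One block for the hash multiplier and \<open>K\<close> blocks for listed items.\<close>

definition config_length :: nat where
  "config_length = Suc K * B"

text \<open>The components are a tag, the item and the increment of the first update, the configuration bits,
  the slots, and for the final message read so far its length, its value at \<open>\<rho>\<close> and the sum of its
  values over the nodes. The item is set to 0 if it is out of range, like all its weights.\<close>

fun memory_of :: "int \<Rightarrow> transcript \<Rightarrow> memory" where
  "memory_of \<rho> Start = (0, 0, 0, [], replicate (4 * K) 0, 0, 0, 0)"
| "memory_of \<rho> Reject = (1, 0, 0, [], replicate (4 * K) 0, 0, 0, 0)"
| "memory_of \<rho> (Config u bs) =
    (2, if fst u \<in> {1..n} then fst u else 0, snd u mod int p, bs, replicate (4 * K) 0, 0, 0, 0)"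
| "memory_of \<rho> (Active bs xs us) = (3, 0, 0, bs, slots bs \<rho> xs, length us,
    poly (message_poly B us) \<rho> mod int p, (\<Sum>x<K. poly (message_poly B us) (int x)) mod int p)"

definition memory_states :: "memory set" where
  "memory_states = {..<4} \<times> {..n} \<times> {0..<int p} \<times> {bs. set bs \<subseteq> UNIV \<and> length bs \<le> config_length}
     \<times> {T. set T \<subseteq> {0..<int p} \<and> length T = 4 * K} \<times> {..final_length} \<times> {0..<int p} \<times> {0..<int p}"

lemma p_pos: "0 < p"
  using p_prime by (rule prime_gt_0_nat)

lemma n_less_p: "n < p"
proof -
  have "n \<le> n ^ Suc d" using n_pos by (intro self_le_power) auto
  thus ?thesis using n_less by linarith
qed

lemma B_pos: "1 \<le> B"
  using p_less prime_gt_1_nat[OF p_prime] by (cases B) auto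

lemma slots_bounds: "set (slots bs \<rho> xs) \<subseteq> {0..<int p}" "length (slots bs \<rho> xs) = 4 * K"
proof -
  show "set (slots bs \<rho> xs) \<subseteq> {0..<int p}"
    using p_pos unfolding slots_def by (auto simp: image_subset_iff)
  show "length (slots bs \<rho> xs) = 4 * K" unfolding slots_def by simp
qed

lemma memory_of_in_states:
  assumes "transcript_bounded config_length final_length g"
  shows "memory_of \<rho> g \<in> memory_states"
proof -
  have Z: "set (replicate (4 * K) 0) \<subseteq> {0..<int p}" using p_pos by auto
  have m: "z mod int p \<in> {0..<int p}" for z using p_pos by simp
  have 0: "0 \<in> {0..<int p}" using p_pos by simp
  show ?thesis
    unfolding memory_states_def using assms
    by (cases g; simp only: memory_of.simps mem_Times_iff fst_conv snd_conv mem_Collect_eq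
        transcript_bounded_def transcript.case length_replicate)
      (use Z m 0 slots_bounds in \<open>simp_all\<close>)
qed

lemma finite_memory_states: "finite memory_states"
  unfolding memory_states_def
  by (intro finite_cartesian_product finite_lists_length_le finite_lists_length_eq finite_lessThan finite_atMost
      finite_atLeastLessThan_int finite)

lemma card_memory_states: "card memory_states \<le> 2 ^ (17 * K * B)"
proof -
  have bits: "card {bs. set bs \<subseteq> (UNIV :: bool set) \<and> length bs \<le> l} \<le> 2 ^ Suc l" for l
  proof -
    have "card {bs. set bs \<subseteq> (UNIV :: bool set) \<and> length bs \<le> l} = (\<Sum>i\<le>l. 2 ^ i)"
      by (subst card_lists_length_le) auto
    also have "\<dots> \<le> 2 ^ Suc l" by (induction l) auto
    finally show ?thesis .
  qed
  \<comment> \<open>Both \<open>2 * k * K\<close> and \<open>B\<close> are below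
    \<open>2 ^ B\<close>, so the counter of message bits fits in \<open>2 * B\<close> bits.\<close>
  have D: "2 * k * K < 2 ^ B" using soundness_size p_less k_pos K_pos by linarith
  have "final_length < 2 ^ B * 2 ^ B"
    unfolding final_length_def using D less_exp[of B] by (intro mult_strict_mono) auto
  hence fl: "Suc final_length \<le> 2 ^ B * 2 ^ B" by simp
  have "card memory_states = 4 * (Suc n * (p * (card {bs. set bs \<subseteq> (UNIV :: bool set) \<and> length bs \<le> config_length}
      * (p ^ (4 * K) * (Suc final_length * (p * p))))))"
    unfolding memory_states_def by (simp add: card_cartesian_product card_lists_length_eq)
  also have "\<dots> \<le> 2 ^ 2 * (2 ^ B * (2 ^ B * (2 ^ Suc config_length
      * ((2 ^ B) ^ (4 * K) * ((2 ^ B * 2 ^ B) * (2 ^ B * 2 ^ B))))))"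
    using bits[of config_length] fl p_less n_less_p
    by (intro mult_mono power_mono) auto
  also have "\<dots> = 2 ^ (2 + B + B + Suc config_length + B * (4 * K) + B + B + B + B)"
    unfolding power_mult[symmetric] power_add by (simp only: ac_simps)
  also have "\<dots> \<le> 2 ^ (17 * K * B)"
  proof (rule power_increasing)
    have "B \<le> K * B" using K_pos by simp
    moreover have "config_length = B + K * B" "B * (4 * K) = 4 * (K * B)" "17 * K * B = 17 * (K * B)"
      by (simp_all add: config_length_def)
    ultimately show "2 + B + B + Suc config_length + B * (4 * K) + B + B + B + B \<le> 17 * K * B"
      using B_pos by linarith
  qed simp
  finally show ?thesis .
qed

lemma slot_weight_outside: "i \<notin> {1..n} \<Longrightarrow> slot_weight bs \<rho> s i = 0"
  by (simp add: slot_weight_def weight_def listed_first_def del: atLeastAtMost_iff)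

lemma slots_single_cong:
  assumes "(if i \<in> {1..n} then i else 0) = (if i' \<in> {1..n} then i' else 0)" "\<delta> mod int p = \<delta>' mod int p"
  shows "slots bs \<rho> [(i, \<delta>)] = slots bs \<rho> [(i', \<delta>')]"
proof -
  have "slot_weight bs \<rho> s i = slot_weight bs \<rho> s i'" for s
    using assms(1) slot_weight_outside[of _ bs \<rho> s] by (auto split: if_splits)
  moreover have "(\<delta> * w) mod int p = (\<delta>' * w) mod int p" for w
    using assms(2) by (metis mod_mult_left_eq)
  ultimately show ?thesis unfolding slots_def linear_sketch_def by simp
qed

lemma slots_snoc_cong:
  assumes "slots bs \<rho> xs = slots bs \<rho> xs'"
  shows "slots bs \<rho> (xs @ [u]) = slots bs \<rho> (xs' @ [u])"
proof -
  have "linear_sketch (slot_weight bs \<rho> s) xs mod int p = linear_sketch (slot_weight bs \<rho> s) xs' mod int p"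
    if "s < 4 * K" for s
    using assms that unfolding slots_def by (auto simp: map_eq_conv)
  thus ?thesis unfolding slots_def by (auto intro: mod_add_cong)
qed

text \<open>Slots are linear in the updates and both message values are additive in the bits, so
  residues suffice; the place value of the next bit depends only on the stored length.\<close>

lemma memory_of_step_cong:
  assumes "memory_of \<rho> g = memory_of \<rho> g'"
  shows "memory_of \<rho> (transcript_step config_length final_length g s)
    = memory_of \<rho> (transcript_step config_length final_length g' s)"
proof (cases g)
  case Start
  hence "g' = Start" using assms by (cases g') auto
  thus ?thesis using Start by simp
next
  case Reject
  hence "g' = Reject" using assms by (cases g') auto
  thus ?thesis using Reject by simp
next
  case (Config u bs)
  then obtain u' where g': "g' = Config u' bs" using assms by (cases g') auto
  obtain i \<delta> i' \<delta>' where u: "u = (i, \<delta>)" "u' = (i', \<delta>')" by (metis prod.exhaust)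
  have eq: "(if i \<in> {1..n} then i else 0) = (if i' \<in> {1..n} then i' else 0)" "\<delta> mod int p = \<delta>' mod int p"
    using assms unfolding Config g' u memory_of.simps fst_conv snd_conv by (simp_all only: prod.inject)
  show ?thesis
  proof (cases s)
    case (Update j e)
    thus ?thesis by (simp add: Config g')
  next
    case (Annotation b)
    thus ?thesis using assms slots_single_cong[OF eq] by (simp add: Config g' u)
  qed
next
  case (Active bs xs us)
  then obtain xs' us' where g': "g' = Active bs xs' us'" using assms by (cases g') auto
  have eq: "slots bs \<rho> xs = slots bs \<rho> xs'" "length us = length us'"
    "poly (message_poly B us) \<rho> mod int p = poly (message_poly B us') \<rho> mod int p"
    "(\<Sum>x<K. poly (message_poly B us) (int x)) mod int p = (\<Sum>x<K. poly (message_poly B us') (int x)) mod int p"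
    using assms unfolding Active g' by auto
  have nil: "us = [] \<longleftrightarrow> us' = []" using eq(2) by (metis length_0_conv)
  show ?thesis
  proof (cases s)
    case (Update j e)
    show ?thesis
    proof (cases "us = []")
      case True
      hence "us' = []" using nil by simp
      thus ?thesis using True slots_snoc_cong[OF eq(1), of "(j, e)"] by (simp add: Active g' Update)
    next
      case False
      hence "us' \<noteq> []" using nil by simp
      thus ?thesis using False by (simp add: Active g' Update)
    qed
  next
    case (Annotation b)
    define q where "q = monom (of_bool b * 2 ^ (length us' mod B) :: int) (length us' div B)"
    have 1: "(poly (message_poly B us) \<rho> + poly q \<rho>) mod int p
        = (poly (message_poly B us') \<rho> + poly q \<rho>) mod int p"
      by (rule mod_add_cong[OF eq(3) refl])
    have 2: "((\<Sum>x<K. poly (message_poly B us) (int x)) + (\<Sum>x<K. poly q (int x))) mod int p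
        = ((\<Sum>x<K. poly (message_poly B us') (int x)) + (\<Sum>x<K. poly q (int x))) mod int p"
      by (rule mod_add_cong[OF eq(4) refl])
    show ?thesis
    proof (cases "length us' < final_length")
      case True
      thus ?thesis unfolding Active g' Annotation transcript_step.simps eq(2) if_P[OF True] memory_of.simps
          message_poly_snoc q_def[symmetric] poly_add sum.distrib length_append
        using 1 2 eq(1) by simp
    qed (simp add: Active g' Annotation eq(2))
  qed
qed

end

section \<open>Soundness of the sum-check round\<close>

lemma poly_bucket_term:
  "poly (bucket_term k \<Lambda> a b c) z = bucket_term k \<Lambda> (poly a z) (poly b z) (poly c z :: int)"
  by (simp add: bucket_term_def of_int_poly)

lemma degree_bucket_term:
  fixes a b c :: "int poly"
  assumes "degree a \<le> l" "degree b \<le> l" "degree c \<le> l" "1 \<le> k"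
  shows "degree (bucket_term k \<Lambda> a b c) \<le> 2 * k * l"
proof -
  have kl: "k * l \<le> 2 * k * l" "2 * l \<le> 2 * k * l" using assms(4) by auto
  have "degree (a ^ k) \<le> degree a * k" by (rule degree_power_le)
  also have "\<dots> \<le> l * k" using assms(1) by (rule mult_right_mono) simp
  finally have 1: "degree (a ^ k) \<le> 2 * k * l" unfolding mult.commute[of l k] using kl(1) by (rule order_trans)
  have "degree (a * c) \<le> 2 * k * l"
    using degree_mult_le[of a c] assms kl by linarith
  moreover have "degree (b\<^sup>2) \<le> 2 * k * l"
    using degree_mult_le[of b b] assms kl unfolding power2_eq_square by linarith
  ultimately have "degree (a * c - b\<^sup>2) \<le> 2 * k * l" by (rule degree_diff_le)
  hence 2: "degree (of_int \<Lambda> * (a * c - b\<^sup>2)) \<le> 2 * k * l"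
    using degree_mult_le[of "of_int \<Lambda>" "a * c - b\<^sup>2"] by simp
  show ?thesis unfolding bucket_term_def using 1 2 by (rule degree_add_le)
qed

context sumcheck
begin

definition N :: int where
  "N = int n ^ Suc d"

definition \<Lambda> :: int where
  "\<Lambda> = N ^ k + 1"

definition regular_items :: "bool list \<Rightarrow> nat set" where
  "regular_items bs = {i\<in>{1..n}. \<not> exceptional bs i}"

definition sketch_poly :: "bool list \<Rightarrow> update list \<Rightarrow> nat \<Rightarrow> nat \<Rightarrow> int poly" where
  "sketch_poly bs x c y = (\<Sum>i\<in>{1..n}. smult (freq x i) (weight bs c y i))"

text \<open>The sum-check polynomial: the rows are summed out, the column remains as the
  variable.\<close>

definition claim_poly :: "bool list \<Rightarrow> update list \<Rightarrow> int poly" where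
  "claim_poly bs x = (\<Sum>y<K. bucket_term k \<Lambda> (sketch_poly bs x 0 y) (sketch_poly bs x 1 y) (sketch_poly bs x 2 y))"

text \<open>Tag 0 is reached only by the empty stream. The test \<open>a2 < \<Lambda>\<close>
  rejects colliding hash functions, the test on \<open>a1\<close> wrong polynomials.\<close>

definition answer :: "int \<Rightarrow> memory \<Rightarrow> int option" where
  "answer \<rho> = (\<lambda>(tag, _, _, _, T, t, a1, a2).
     if tag = 0 then Some 0
     else if tag = 3 \<and> t = final_length \<and>
       a1 = (\<Sum>y<K. bucket_term k \<Lambda> (T ! y) (T ! (K + y)) (T ! (2 * K + y))) mod int p \<and> a2 < \<Lambda>
     then Some (a2 + (\<Sum>j<K. T ! (3 * K + j) ^ k)) else None)"

lemma hash_less: "hash bs i < K * K"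
  unfolding hash_def using K_pos by simp

lemma hash_div_less: "hash bs i div K < K"
  using hash_less by (rule less_mult_imp_div_less)

lemma N_less: "N < int p"
  unfolding N_def using n_less by (simp only: of_nat_power[symmetric] of_nat_less_iff)

lemma freq_bounds:
  assumes "x \<in> turnstile_streams d n" "i \<in> {1..n}"
  shows "0 \<le> freq x i" "freq x i \<le> int n ^ d" "freq x i < int p"
proof -
  show "0 \<le> freq x i" "freq x i \<le> int n ^ d"
    using assms by (force simp: turnstile_streams_def strict_turnstile_def)+
  note \<open>freq x i \<le> int n ^ d\<close>
  also have "int n ^ d \<le> N" unfolding N_def using n_pos by (intro power_increasing) auto
  finally show "freq x i < int p" using N_less by simp
qed

lemma hashed_items:
  assumes "x \<in> turnstile_streams d n"
  shows "hashed_items (regular_items bs) (freq x) (hash bs) {..<K * K} k n N"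
proof
  have "(\<Sum>i\<in>regular_items bs. freq x i) \<le> (\<Sum>i\<in>{1..n}. freq x i)"
    using freq_bounds(1)[OF assms] by (intro sum_mono2) (auto simp: regular_items_def)
  also have "\<dots> \<le> (\<Sum>i\<in>{1..n}. int n ^ d)" by (intro sum_mono freq_bounds(2)[OF assms])
  also have "\<dots> = N" by (simp add: N_def)
  finally show "(\<Sum>i\<in>regular_items bs. freq x i) \<le> N" .
  show "finite (regular_items bs)" by (simp add: regular_items_def)
  show "\<And>i. i \<in> regular_items bs \<Longrightarrow> i \<le> n" by (simp add: regular_items_def)
  show "hash bs i \<in> {..<K * K}" for i using hash_less by simp
  show "0 \<le> freq x i" if "i \<in> regular_items bs" for i
    using that freq_bounds(1)[OF assms] by (simp add: regular_items_def)
  show "1 \<le> k" by (rule k_pos)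
qed simp

lemma poly_sketch_poly: "poly (sketch_poly bs x c y) z = (\<Sum>i\<in>{1..n}. freq x i * poly (weight bs c y i) z)"
  by (simp add: sketch_poly_def poly_sum)

lemma slots_nth_sketch:
  assumes "c < 3" "y < K"
  shows "slots bs \<rho> x ! (c * K + y) = poly (sketch_poly bs x c y) \<rho> mod int p"
proof -
  have "Suc c * K \<le> 3 * K" using assms(1) by (intro mult_right_mono) auto
  moreover have "c * K + y < Suc c * K" using assms(2) by simp
  ultimately have s: "c * K + y < 3 * K" by (rule less_le_trans[rotated])
  have "slots bs \<rho> x ! (c * K + y) = linear_sketch (slot_weight bs \<rho> (c * K + y)) x mod int p"
    using s by (simp add: slots_def)
  also have "slot_weight bs \<rho> (c * K + y) = (\<lambda>i. poly (weight bs c y i) \<rho>)"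
    using s assms by (intro ext) (simp add: slot_weight_def)
  also have "linear_sketch \<dots> x = poly (sketch_poly bs x c y) \<rho>"
    unfolding poly_sketch_poly by (rule linear_sketch_eq_sum_freq) (auto simp: weight_def)
  finally show ?thesis .
qed

lemma degree_sketch_poly: "degree (sketch_poly bs x c y) \<le> K - 1"
  unfolding sketch_poly_def
proof (rule degree_sum_le)
  fix i
  have "degree (weight bs c y i) \<le> K - 1"
    using \<beta>(1)[OF hash_div_less] by (simp add: weight_def)
  thus "degree (smult (freq x i) (weight bs c y i)) \<le> K - 1" using degree_smult_le order_trans by blast
qed simp

lemma degree_claim_poly: "degree (claim_poly bs x) \<le> 2 * k * K - 1"
proof -
  have "degree (claim_poly bs x) \<le> 2 * k * (K - 1)"
    unfolding claim_poly_def using degree_sketch_poly k_pos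
    by (intro degree_sum_le degree_bucket_term) auto
  also have "\<dots> \<le> 2 * k * K - 1" using k_pos K_pos by (cases K) auto
  finally show ?thesis .
qed

lemma sketch_check_iff:
  "q mod int p = (\<Sum>y<K. bucket_term k \<Lambda> (slots bs \<rho> x ! y) (slots bs \<rho> x ! (K + y)) (slots bs \<rho> x ! (2 * K + y))) mod int p
    \<longleftrightarrow> int p dvd q - poly (claim_poly bs x) \<rho>"
proof -
  have dm: "int p dvd z mod int p - z" for z by (simp add: mod_eq_dvd_iff[symmetric])
  have "int p dvd (\<Sum>y<K. bucket_term k \<Lambda> (slots bs \<rho> x ! y) (slots bs \<rho> x ! (K + y)) (slots bs \<rho> x ! (2 * K + y)))
      - poly (claim_poly bs x) \<rho>"
    unfolding claim_poly_def poly_sum poly_bucket_term sum_subtractf[symmetric]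
  proof (rule dvd_sum)
    fix y assume "y \<in> {..<K}"
    hence y: "y < K" by simp
    show "int p dvd bucket_term k \<Lambda> (slots bs \<rho> x ! y) (slots bs \<rho> x ! (K + y)) (slots bs \<rho> x ! (2 * K + y))
      - bucket_term k \<Lambda> (poly (sketch_poly bs x 0 y) \<rho>) (poly (sketch_poly bs x 1 y) \<rho>) (poly (sketch_poly bs x 2 y) \<rho>)"
      using slots_nth_sketch[of 0 y bs \<rho> x] slots_nth_sketch[of 1 y bs \<rho> x] slots_nth_sketch[of 2 y bs \<rho> x] y
      by (intro dvd_bucket_term_diff) (simp_all add: dm)
  qed
  hence "(\<Sum>y<K. bucket_term k \<Lambda> (slots bs \<rho> x ! y) (slots bs \<rho> x ! (K + y)) (slots bs \<rho> x ! (2 * K + y))) mod int p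
      = poly (claim_poly bs x) \<rho> mod int p" by (simp only: mod_eq_dvd_iff)
  thus ?thesis by (simp only: mod_eq_dvd_iff[symmetric])
qed

text \<open>At the node \<open>X\<close> the Lagrange polynomial of an item's column is 1 or 0
  modulo \<open>p\<close>, according to whether that column is \<open>X\<close>; only the items of
  bucket \<open>X * K + y\<close> survive.\<close>

lemma sketch_at_bucket:
  assumes "X < K" "y < K" "x \<in> turnstile_streams d n"
  shows "int p dvd poly (sketch_poly bs x c y) (int X)
    - hashed_items.moment (regular_items bs) (freq x) (hash bs) c (X * K + y)"
proof -
  interpret hashed_items "regular_items bs" "freq x" "hash bs" "{..<K * K}" k n N
    using assms(3) by (rule hashed_items)
  have "moment c (X * K + y) = (\<Sum>i\<in>{1..n}. if i \<in> regular_items bs \<and> hash bs i = X * K + y then freq x i * int i ^ c else 0)"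
    unfolding moment_def by (rule sum.mono_neutral_cong_left) (auto simp: regular_items_def)
  moreover have "int p dvd freq x i * poly (weight bs c y i) (int X)
      - (if i \<in> regular_items bs \<and> hash bs i = X * K + y then freq x i * int i ^ c else 0)"
    if i: "i \<in> {1..n}" for i
  proof (cases "\<not> exceptional bs i \<and> hash bs i mod K = y")
    case True
    have "hash bs i = X * K + y \<longleftrightarrow> hash bs i div K = X"
      using True assms(2) by (metis div_mult_mod_eq div_mult_self3 div_less add.right_neutral mult.commute
          less_nat_zero_code add_0)
    hence "freq x i * poly (weight bs c y i) (int X)
      - (if i \<in> regular_items bs \<and> hash bs i = X * K + y then freq x i * int i ^ c else 0)
      = freq x i * int i ^ c * (poly (\<beta> (hash bs i div K)) (int X) - of_bool (hash bs i div K = X))"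
      using True i by (simp add: weight_def regular_items_def algebra_simps)
    thus ?thesis using \<beta>(2)[OF hash_div_less assms(1)] by simp
  next
    case False
    hence "\<not> (i \<in> regular_items bs \<and> hash bs i = X * K + y)"
      using assms(2) by (auto simp: regular_items_def)
    moreover have "weight bs c y i = 0" using False by (auto simp: weight_def)
    ultimately show ?thesis by (simp only: if_False poly_0 mult_zero_right diff_self dvd_0_right)
  qed
  ultimately show ?thesis
    unfolding poly_sketch_poly by (simp only: sum_subtractf[symmetric] dvd_sum)
qed

text \<open>The values at the nodes add up to the total over the grid modulo \<open>p\<close>;
  equality of integers follows because the total lies in \<open>{0..<p}\<close>.\<close>

lemma claim_poly_sum:
  assumes "x \<in> turnstile_streams d n"
  shows "(\<Sum>X<K. poly (claim_poly bs x) (int X)) mod int p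
    = hashed_items.total (regular_items bs) (freq x) (hash bs) {..<K * K} k N"
proof -
  interpret hashed_items "regular_items bs" "freq x" "hash bs" "{..<K * K}" k n N
    using assms by (rule hashed_items)
  have "total = (\<Sum>X<K. \<Sum>b\<in>{X * K..<X * K + K}. bucket_term k \<Lambda> (moment 0 b) (moment 1 b) (moment 2 b))"
    unfolding total_def \<Lambda>_def by (rule sum.nat_group[symmetric])
  also have "\<dots> = (\<Sum>X<K. \<Sum>y<K. bucket_term k \<Lambda> (moment 0 (X * K + y)) (moment 1 (X * K + y)) (moment 2 (X * K + y)))"
    by (rule sum.cong[OF refl], subst sum.atLeastLessThan_shift_0) (auto simp: lessThan_atLeast0 intro!: sum.cong)
  finally have t: "total = \<dots>" .
  have "int p dvd (\<Sum>X<K. poly (claim_poly bs x) (int X)) - total"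
    unfolding t claim_poly_def poly_sum poly_bucket_term sum_subtractf[symmetric]
    using assms by (intro dvd_sum dvd_bucket_term_diff sketch_at_bucket) auto
  hence "(\<Sum>X<K. poly (claim_poly bs x) (int X)) mod int p = total mod int p" by (simp add: mod_eq_dvd_iff)
  also have "\<dots> = total"
    using total_nonneg total_le total_less unfolding N_def[symmetric] by (intro mod_pos_pos_trivial) auto
  finally show ?thesis .
qed

text \<open>Each slot counts a single item at most, with frequency below \<open>p\<close>, so its
  residue is exact and powers pass through the sum. For each exceptional item exactly one slot
  counts it.\<close>

lemma slots_exceptional:
  assumes "x \<in> turnstile_streams d n"
  shows "(\<Sum>j<K. slots bs \<rho> x ! (3 * K + j) ^ k) = (\<Sum>i\<in>{1..n} - regular_items bs. freq x i ^ k)"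
proof -
  have one: "listed_first bs j i * listed_first bs j i' = 0" if "i \<noteq> i'" for j i i'
    using that by (auto simp: listed_first_def)
  have slot: "slots bs \<rho> x ! (3 * K + j) ^ k = (\<Sum>i\<in>{1..n}. freq x i ^ k * listed_first bs j i)" if j: "j < K" for j
  proof -
    have sw: "slot_weight bs \<rho> (3 * K + j) = listed_first bs j" by (intro ext) (simp add: slot_weight_def)
    have "slots bs \<rho> x ! (3 * K + j) = linear_sketch (listed_first bs j) x mod int p"
      using j by (simp add: slots_def sw)
    also have "linear_sketch (listed_first bs j) x = (\<Sum>i\<in>{1..n}. freq x i * listed_first bs j i)"
      by (rule linear_sketch_eq_sum_freq) (auto simp: listed_first_def)
    also have "\<dots> mod int p = \<dots>"
    proof (rule mod_pos_pos_trivial)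
      have b: "0 \<le> freq x i * listed_first bs j i" "freq x i * listed_first bs j i \<le> freq x i" if "i \<in> {1..n}" for i
        using freq_bounds(1)[OF assms that] by (auto simp: listed_first_def)
      thus "0 \<le> (\<Sum>i\<in>{1..n}. freq x i * listed_first bs j i)" by (intro sum_nonneg) auto
      have "(\<Sum>i\<in>{1..n}. freq x i * listed_first bs j i) \<le> (\<Sum>i\<in>{1..n}. int n ^ d)"
        using b(2) freq_bounds(2)[OF assms] by (intro sum_mono) (meson order_trans)
      also have "\<dots> = N" by (simp add: N_def)
      finally show "(\<Sum>i\<in>{1..n}. freq x i * listed_first bs j i) < int p" using N_less by simp
    qed
    finally have "slots bs \<rho> x ! (3 * K + j) ^ k = (\<Sum>i\<in>{1..n}. freq x i * listed_first bs j i) ^ k" by simp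
    also have "\<dots> = (\<Sum>i\<in>{1..n}. (freq x i * listed_first bs j i) ^ k)"
      using k_pos one[of _ _ j] by (intro power_sum_eq_sum_power) (auto simp: ac_simps)
    also have "\<dots> = (\<Sum>i\<in>{1..n}. freq x i ^ k * listed_first bs j i)"
      using k_pos by (intro sum.cong refl) (auto simp: listed_first_def power_mult_distrib)
    finally show ?thesis .
  qed
  have lf: "(\<Sum>j<K. listed_first bs j i) = of_bool (exceptional bs i)" if i: "i \<in> {1..n}" for i
  proof (cases "exceptional bs i")
    case True
    define j0 where "j0 = (LEAST j. j < K \<and> bits_chunk B bs (Suc j) = i)"
    have j0: "j0 < K" "bits_chunk B bs (Suc j0) = i"
      using LeastI_ex[of "\<lambda>j. j < K \<and> bits_chunk B bs (Suc j) = i"] True unfolding exceptional_def j0_def by auto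
    have least: "j0 \<le> j" if "j < K" "bits_chunk B bs (Suc j) = i" for j
      unfolding j0_def using that by (intro Least_le) auto
    have "listed_first bs j i = of_bool (j = j0)" if "j < K" for j
    proof (cases "j = j0")
      case True
      moreover have "bits_chunk B bs (Suc j') \<noteq> i" if "j' < j0" for j'
        using least[of j'] that j0(1) by (meson leD less_trans)
      ultimately show ?thesis using j0(2) i by (simp add: listed_first_def)
    next
      case False
      hence "bits_chunk B bs (Suc j) = i \<Longrightarrow> j0 < j" using least[OF that] by simp
      thus ?thesis using j0(2) False by (auto simp: listed_first_def)
    qed
    hence "(\<Sum>j<K. listed_first bs j i) = (\<Sum>j<K. of_bool (j = j0))" by (intro sum.cong) auto
    thus ?thesis using True j0(1) by (simp add: of_bool_def)
  next
    case False
    hence "listed_first bs j i = 0" if "j < K" for j using that by (auto simp: listed_first_def exceptional_def)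
    thus ?thesis using False by simp
  qed
  have "(\<Sum>j<K. slots bs \<rho> x ! (3 * K + j) ^ k) = (\<Sum>j<K. \<Sum>i\<in>{1..n}. freq x i ^ k * listed_first bs j i)"
    using slot by (intro sum.cong) auto
  also have "\<dots> = (\<Sum>i\<in>{1..n}. freq x i ^ k * (\<Sum>j<K. listed_first bs j i))"
    by (subst sum.swap) (simp add: sum_distrib_left)
  also have "\<dots> = (\<Sum>i\<in>{1..n}. freq x i ^ k * of_bool (exceptional bs i))"
    using lf by (intro sum.cong) auto
  also have "\<dots> = (\<Sum>i\<in>{1..n} - regular_items bs. freq x i ^ k)"
    by (rule sum.mono_neutral_cong_right) (auto simp: regular_items_def)
  finally show ?thesis .
qed

lemma freq_moment_split:
  "freq_moment k n x = (\<Sum>i\<in>regular_items bs. freq x i ^ k) + (\<Sum>i\<in>{1..n} - regular_items bs. freq x i ^ k)"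
  unfolding freq_moment_def
  by (subst add.commute, rule sum.subset_diff) (auto simp: regular_items_def)

lemma answer_Active:
  assumes "x \<in> turnstile_streams d n"
  shows "answer \<rho> (memory_of \<rho> (Active bs x us)) =
    (if length us = final_length \<and> int p dvd poly (message_poly B us - claim_poly bs x) \<rho> \<and>
        (\<Sum>X<K. poly (message_poly B us) (int X)) mod int p < \<Lambda>
     then Some ((\<Sum>X<K. poly (message_poly B us) (int X)) mod int p + (\<Sum>i\<in>{1..n} - regular_items bs. freq x i ^ k))
     else None)"
  unfolding answer_def memory_of.simps prod.case sketch_check_iff slots_exceptional[OF assms] poly_diff
  by simp

lemma message_sum_eq_total:
  assumes "x \<in> turnstile_streams d n" "\<And>z. int p dvd poly (message_poly B us - claim_poly bs x) z"
  shows "(\<Sum>X<K. poly (message_poly B us) (int X)) mod int p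
    = hashed_items.total (regular_items bs) (freq x) (hash bs) {..<K * K} k N"
proof -
  have "int p dvd (\<Sum>X<K. poly (message_poly B us) (int X)) - (\<Sum>X<K. poly (claim_poly bs x) (int X))"
    unfolding sum_subtractf[symmetric] using assms(2) by (intro dvd_sum) simp
  thus ?thesis using claim_poly_sum[OF assms(1), of bs] by (metis mod_eq_dvd_iff)
qed

text \<open>The remaining way to cheat is a bad configuration with a truthful polynomial; then the
  residue is the true total, and passing the threshold certifies it.\<close>

lemma answer_true_claim:
  assumes "x \<in> turnstile_streams d n" "\<And>z. int p dvd poly (message_poly B us - claim_poly bs x) z"
  shows "answer \<rho> (memory_of \<rho> (Active bs x us)) \<in> {Some (freq_moment k n x), None}"
proof -
  interpret hashed_items "regular_items bs" "freq x" "hash bs" "{..<K * K}" k n N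
    using assms(1) by (rule hashed_items)
  show ?thesis
    unfolding answer_Active[OF assms(1)] message_sum_eq_total[OF assms] \<Lambda>_def freq_moment_split[of x bs]
    using total_small_imp_moment by auto
qed

text \<open>The annotation is fixed, so the message does not depend on \<open>r\<close>. If its
  polynomial differs modulo \<open>p\<close> from \<open>claim_poly\<close> somewhere, the two agree
  at fewer than \<open>2 * k * K\<close> points, at most a third of \<open>p\<close>; otherwise
  \<open>answer_true_claim\<close> serves every \<open>r\<close>.\<close>

lemma wrong_answer_bound:
  assumes x: "x \<in> turnstile_streams d n"
  shows "3 * card {r\<in>{..<p}. answer (int r) (memory_of (int r)
      (foldl (transcript_step config_length final_length) Start (annotated_stream x h)))
      \<notin> {Some (freq_moment k n x), None}} \<le> p"
proof -
  define g where "g = foldl (transcript_step config_length final_length) Start (annotated_stream x h)"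
  have upd: "case g of Start \<Rightarrow> x = [] | Config u bs \<Rightarrow> x = [u] | Active bs xs us \<Rightarrow> x = xs | Reject \<Rightarrow> True"
    using transcript_updates[where ?l1.0 = config_length and ?l2.0 = final_length and ss = "annotated_stream x h"]
    unfolding g_def updates_of_annotated_stream .
  show ?thesis
    unfolding g_def[symmetric]
  proof (cases g)
    case Start
    hence "x = []" using upd by simp
    hence "freq_moment k n x = 0" using k_pos by (simp add: freq_moment_def)
    thus "3 * card {r\<in>{..<p}. answer (int r) (memory_of (int r) g) \<notin> {Some (freq_moment k n x), None}} \<le> p"
      by (simp add: Start answer_def)
  next
    case Reject
    thus "3 * card {r\<in>{..<p}. answer (int r) (memory_of (int r) g) \<notin> {Some (freq_moment k n x), None}} \<le> p"
      by (simp add: answer_def)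
  next
    case (Config u bs)
    thus "3 * card {r\<in>{..<p}. answer (int r) (memory_of (int r) g) \<notin> {Some (freq_moment k n x), None}} \<le> p"
      by (simp add: answer_def)
  next
    case (Active bs xs us)
    hence g: "g = Active bs x us" using upd by simp
    define q where "q = message_poly B us - claim_poly bs x"
    show "3 * card {r\<in>{..<p}. answer (int r) (memory_of (int r) g) \<notin> {Some (freq_moment k n x), None}} \<le> p"
    proof (cases "length us = final_length \<and> (\<exists>z. \<not> int p dvd poly q z)")
      case False
      have "answer (int r) (memory_of (int r) g) \<in> {Some (freq_moment k n x), None}" for r
      proof (cases "length us = final_length")
        case True
        thus ?thesis using answer_true_claim[OF x, of us bs] False unfolding g q_def by blast
      next
        case False
        thus ?thesis unfolding g answer_Active[OF x] by simp
      qed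
      thus ?thesis by simp
    next
      case True
      define R where "R = {r\<in>{0..<int p}. int p dvd poly q r}"
      have fR: "finite R" unfolding R_def by (rule finite_subset[of _ "{0..<int p}"]) auto
      have "degree q \<le> 2 * k * K - 1"
        unfolding q_def using degree_claim_poly True
        by (intro degree_diff_le degree_message_poly) (auto simp: final_length_def)
      moreover have "\<not> degree q < card R"
      proof
        assume "degree q < card R"
        moreover have "prime (int p)" "finite R" "R \<subseteq> {0..<int p}" "\<And>r. r \<in> R \<Longrightarrow> int p dvd poly q r"
          using p_prime fR by (auto simp: R_def)
        ultimately have "int p dvd poly q z" for z using poly_mod_prime_roots by blast
        thus False using True by blast
      qed
      moreover have "1 * 1 \<le> 2 * k * K" using k_pos K_pos by (intro mult_mono) auto
      ultimately have cR: "card R < 2 * k * K" by linarith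
      have "{r\<in>{..<p}. answer (int r) (memory_of (int r) g) \<notin> {Some (freq_moment k n x), None}} \<subseteq> nat ` R"
      proof
        fix r assume r: "r \<in> {r\<in>{..<p}. answer (int r) (memory_of (int r) g) \<notin> {Some (freq_moment k n x), None}}"
        have "int p dvd poly q (int r)"
        proof (rule ccontr)
          assume "\<not> int p dvd poly q (int r)"
          hence "answer (int r) (memory_of (int r) g) = None" unfolding g answer_Active[OF x] q_def by simp
          thus False using r by simp
        qed
        hence "int r \<in> R" using r by (simp add: R_def)
        thus "r \<in> nat ` R" by (metis imageI nat_int)
      qed
      hence "card {r\<in>{..<p}. answer (int r) (memory_of (int r) g) \<notin> {Some (freq_moment k n x), None}} \<le> card (nat ` R)"
        using fR by (intro card_mono) auto
      also have "\<dots> \<le> card R" using fR by (rule card_image_le)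
      finally show ?thesis using cR soundness_size by linarith
    qed
  qed
qed

end

section \<open>The honest prover and the assembled scheme\<close>

context sumcheck
begin

text \<open>The larger member of every colliding pair of occurring items is listed; the hash lemma
  leaves at most \<open>K\<close> of them because \<open>m^2 \<le> K^3\<close>.\<close>

lemma exists_config:
  assumes x: "x \<in> turnstile_streams d n" and m: "sparsity n x \<le> m" "m\<^sup>2 \<le> K * (K * K)"
  shows "\<exists>bs. length bs = config_length \<and>
    (\<forall>i\<in>regular_items bs. \<forall>j\<in>regular_items bs. i \<noteq> j \<longrightarrow> hash bs i = hash bs j \<longrightarrow> freq x i * freq x j = 0)"
proof -
  define S where "S = {i\<in>{1..n}. freq x i \<noteq> 0}"
  have S: "finite S" by (simp add: S_def)
  have Sp: "i < p" if "i \<in> S" for i using that n_less_p by (simp add: S_def)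
  have "(card S)\<^sup>2 \<le> m\<^sup>2" using m(1) by (intro power_mono) (simp_all add: S_def sparsity_def)
  hence cS: "(card S)\<^sup>2 \<le> K * (K * K)" using m(2) by linarith
  have "0 < K * K" using K_pos by simp
  then obtain a where a: "a < p" and
    few: "card {j\<in>S. \<exists>i\<in>S. i < j \<and> (a * i mod p) mod (K * K) = (a * j mod p) mod (K * K)} \<le> K"
    using exists_hash_few_collisions[OF p_prime _ S Sp cS] by blast
  define E where "E = {j\<in>S. \<exists>i\<in>S. i < j \<and> (a * i mod p) mod (K * K) = (a * j mod p) mod (K * K)}"
  have fE: "finite E" using S by (simp add: E_def)
  obtain e where e: "bij_betw e {0..<card E} E" using ex_bij_betw_nat_finite[OF fE] by blast
  define v where "v j = (case j of 0 \<Rightarrow> a | Suc j \<Rightarrow> if j < card E then e j else 0)" for j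
  have "v j < 2 ^ B" for j
  proof -
    have "e j' < p" if "j' < card E" for j'
    proof -
      have "e j' \<in> E" using e that by (auto simp: bij_betw_def)
      thus ?thesis using Sp by (simp add: E_def)
    qed
    hence "v j < p" using a p_pos by (simp add: v_def split: nat.split)
    thus ?thesis using p_less by simp
  qed
  then obtain bs where bs: "length bs = Suc K * B" "\<And>j. j < Suc K \<Longrightarrow> bits_chunk B bs j = v j"
    using bits_chunk_surj[of "Suc K" v B] by blast
  have a_eq: "bits_chunk B bs 0 = a" using bs(2)[of 0] by (simp add: v_def)
  have exc: "exceptional bs j" if "j \<in> E" for j
  proof -
    have "j \<in> e ` {0..<card E}" using e that by (simp add: bij_betw_def)
    then obtain l where l: "l < card E" "e l = j" by auto
    have "l < K" using l(1) few by (simp add: E_def)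
    moreover have "bits_chunk B bs (Suc l) = j" using bs(2)[of "Suc l"] l \<open>l < K\<close> by (simp add: v_def)
    ultimately show ?thesis unfolding exceptional_def by blast
  qed
  have *: "freq x i * freq x j = 0"
    if "i \<in> regular_items bs" "j \<in> regular_items bs" "i < j" "hash bs i = hash bs j" for i j
  proof (rule ccontr)
    assume "freq x i * freq x j \<noteq> 0"
    hence "i \<in> S" "j \<in> S" using that by (simp_all add: S_def regular_items_def)
    hence "j \<in> E" using that unfolding E_def hash_def a_eq by blast
    thus False using exc that by (simp add: regular_items_def)
  qed
  have "freq x i * freq x j = 0"
    if "i \<in> regular_items bs" "j \<in> regular_items bs" "i \<noteq> j" "hash bs i = hash bs j" for i j
  proof (cases "i < j")
    case True
    thus ?thesis using * that by blast
  next
    case False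
    hence "freq x j * freq x i = 0" using that by (intro *) auto
    thus ?thesis by (simp add: mult.commute)
  qed
  thus ?thesis using bs(1) unfolding config_length_def by blast
qed

text \<open>Coefficients reduced modulo \<open>p\<close> fit into \<open>B\<close> bits, and the
  values stay congruent.\<close>

lemma exists_message:
  "\<exists>us. length us = final_length \<and> (\<forall>z. int p dvd poly (message_poly B us - claim_poly bs x) z)"
proof -
  define G where "G = claim_poly bs x"
  define D where "D = 2 * k * K"
  define v where "v j = nat (coeff G j mod int p)" for j
  have iv: "int (v j) = coeff G j mod int p" for j using p_pos by (simp add: v_def)
  have "v j < 2 ^ B" for j
  proof -
    have "int (v j) < int p" unfolding iv using p_pos by simp
    thus ?thesis using p_less by linarith
  qed
  then obtain us where us: "length us = D * B" "\<And>j. j < D \<Longrightarrow> bits_chunk B us j = v j"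
    using bits_chunk_surj[of D v B] by blast
  have "1 * 1 \<le> 2 * k * K" using k_pos K_pos by (intro mult_mono) auto
  hence dG: "degree G < D" using degree_claim_poly[of bs x] unfolding G_def D_def by linarith
  have "int p dvd poly (message_poly B us - G) z" for z
  proof -
    have "poly G z = (\<Sum>j<D. coeff G j * z ^ j)"
      unfolding poly_altdef using dG by (intro sum.mono_neutral_left) (auto simp: coeff_eq_0)
    moreover have "poly (message_poly B us) z = (\<Sum>j<D. (coeff G j mod int p) * z ^ j)"
      using us by (simp add: poly_message_poly[of us D] iv)
    ultimately have "poly (message_poly B us - G) z = (\<Sum>j<D. (coeff G j mod int p - coeff G j) * z ^ j)"
      by (simp add: sum_subtractf left_diff_distrib)
    also have "int p dvd \<dots>"
      by (intro dvd_sum dvd_mult2) (simp add: mod_eq_dvd_iff[symmetric])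
    finally show ?thesis .
  qed
  thus ?thesis using us(1) unfolding final_length_def D_def G_def by blast
qed

lemma answer_honest:
  assumes x: "x \<in> turnstile_streams d n" and us: "length us = final_length"
    "\<And>z. int p dvd poly (message_poly B us - claim_poly bs x) z"
    and bs: "\<And>i j. i \<in> regular_items bs \<Longrightarrow> j \<in> regular_items bs \<Longrightarrow> i \<noteq> j \<Longrightarrow> hash bs i = hash bs j \<Longrightarrow>
      freq x i * freq x j = 0"
  shows "answer \<rho> (memory_of \<rho> (Active bs x us)) = Some (freq_moment k n x)"
proof -
  interpret hashed_items "regular_items bs" "freq x" "hash bs" "{..<K * K}" k n N
    using x by (rule hashed_items)
  have "total = (\<Sum>i\<in>regular_items bs. freq x i ^ k)" "total < \<Lambda>"
    unfolding \<Lambda>_def using bs total_eq_moment by blast+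
  thus ?thesis
    unfolding answer_Active[OF x] message_sum_eq_total[OF x us(2)] freq_moment_split[of x bs]
    using us by simp
qed

lemma scheme_exists:
  assumes m: "m\<^sup>2 \<le> K * (K * K)"
  shows "\<exists>P V. prescient_scheme {x \<in> turnstile_streams d n. sparsity n x \<le> m} (freq_moment k n)
      (config_length + final_length) (17 * K * B) P V \<and>
    completeness_error_le {x \<in> turnstile_streams d n. sparsity n x \<le> m} (freq_moment k n) P V 0"
proof -
  let ?D = "{x \<in> turnstile_streams d n. sparsity n x \<le> m}"
  have cl: "0 < config_length" using B_pos by (simp add: config_length_def)
  have "\<exists>V. verifier_coins V = pmf_of_set {..<p} \<and> uses_memory V (17 * K * B) \<and>
    (\<forall>r xs. verifier_output V r xs = answer (int (r mod p)) (memory_of (int (r mod p))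
      (foldl (transcript_step config_length final_length) Start xs)))"
  proof (rule verifier_of_abstraction[where \<alpha> = "\<lambda>r. memory_of (int (r mod p))" and St = memory_states
        and res = "\<lambda>r. answer (int (r mod p))" and I = "transcript_bounded config_length final_length"])
    show "transcript_bounded config_length final_length Start" by (simp add: transcript_bounded_def)
  qed (rule finite_memory_states card_memory_states memory_of_in_states memory_of_step_cong
      transcript_bounded_step[OF cl], assumption?)+
  then obtain V where V: "verifier_coins V = pmf_of_set {..<p}" "uses_memory V (17 * K * B)"
    "\<And>r xs. verifier_output V r xs = answer (int (r mod p)) (memory_of (int (r mod p))
      (foldl (transcript_step config_length final_length) Start xs))" by blast
  have "\<exists>bs us. length bs = config_length \<and> length us = final_length \<and>
    (\<forall>\<rho>. answer \<rho> (memory_of \<rho> (Active bs x us)) = Some (freq_moment k n x))" if xD: "x \<in> ?D" for x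
  proof -
    obtain bs where bs: "length bs = config_length"
      "\<forall>i\<in>regular_items bs. \<forall>j\<in>regular_items bs. i \<noteq> j \<longrightarrow> hash bs i = hash bs j \<longrightarrow> freq x i * freq x j = 0"
      using exists_config[OF _ _ m, of x] xD by blast
    obtain us where us: "length us = final_length"
      "\<forall>z. int p dvd poly (message_poly B us - claim_poly bs x) z" using exists_message by blast
    have "answer \<rho> (memory_of \<rho> (Active bs x us)) = Some (freq_moment k n x)" for \<rho>
      using xD bs us by (intro answer_honest) auto
    thus ?thesis using bs us by blast
  qed
  hence "\<forall>x\<in>?D. \<exists>c. length (fst c) = config_length \<and> length (snd c) = final_length \<and>
    (\<forall>\<rho>. answer \<rho> (memory_of \<rho> (Active (fst c) x (snd c))) = Some (freq_moment k n x))" by force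
  from bchoice[OF this] obtain c where c: "\<forall>x\<in>?D. length (fst (c x)) = config_length \<and>
    length (snd (c x)) = final_length \<and>
    (\<forall>\<rho>. answer \<rho> (memory_of \<rho> (Active (fst (c x)) x (snd (c x)))) = Some (freq_moment k n x))" by blast
  define cfg where "cfg x = fst (c x)" for x
  define fin where "fin x = snd (c x)" for x
  have cf: "length (cfg x) = config_length" "length (fin x) = final_length"
    "answer \<rho> (memory_of \<rho> (Active (cfg x) x (fin x))) = Some (freq_moment k n x)" if "x \<in> ?D" for x \<rho>
    using c that unfolding cfg_def fin_def by blast+
  define h where "h x i = (if i = 1 then cfg x else []) @ (if i = length x then fin x else [])" for x i
  define P where "P = \<lparr>prover_coins = return_pmf 0, annotate = \<lambda>x r. h x\<rparr>"
  have len: "annotation_length x (annotate P x rP) \<le> config_length + final_length" if "x \<in> ?D" for x rP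
  proof -
    have "annotation_length x (annotate P x rP)
        = (\<Sum>i=1..length x. if i = 1 then length (cfg x) else 0) + (\<Sum>i=1..length x. if i = length x then length (fin x) else 0)"
      unfolding annotation_length_def sum.distrib[symmetric] by (intro sum.cong) (auto simp: P_def h_def)
    also have "\<dots> \<le> length (cfg x) + length (fin x)" by (intro add_mono) (simp_all add: sum.delta)
    finally show ?thesis using cf(1,2)[OF that] by simp
  qed
  have out: "verifier_output V rV (annotated_stream x (annotate P x rP)) = Some (freq_moment k n x)"
    if "x \<in> ?D" for x rP rV
  proof (cases "x = []")
    case True
    thus ?thesis using k_pos by (simp add: V(3) answer_def freq_moment_def)
  next
    case False
    have "foldl (transcript_step config_length final_length) Start (annotated_stream x (annotate P x rP))
        = Active (cfg x) x (fin x)"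
      using False cl cf(1,2)[OF that] by (intro transcript_honest) (auto simp: P_def h_def)
    thus ?thesis unfolding V(3) using cf(3)[OF that] by simp
  qed
  have complete: "completeness_error_le ?D (freq_moment k n) P V 0"
    unfolding completeness_error_le_def using out by simp
  have "soundness_error_le ?D (freq_moment k n) V (1/3)"
    unfolding soundness_error_le_def
  proof (intro ballI allI)
    fix x h assume x: "x \<in> ?D"
    let ?W = "{r. verifier_output V r (annotated_stream x h) \<notin> {Some (freq_moment k n x), None}}"
    have "{..<p} \<inter> ?W = {r\<in>{..<p}. answer (int r) (memory_of (int r)
        (foldl (transcript_step config_length final_length) Start (annotated_stream x h)))
        \<notin> {Some (freq_moment k n x), None}}"
      unfolding V(3) by auto
    hence "3 * card ({..<p} \<inter> ?W) \<le> p" using wrong_answer_bound[of x h] x by simp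
    hence "real (card ({..<p} \<inter> ?W)) / real p \<le> 1/3" using p_pos by (simp add: pos_divide_le_eq)
    moreover have "measure_pmf.prob (verifier_coins V) ?W = real (card ({..<p} \<inter> ?W)) / real p"
      unfolding V(1) using p_pos by (subst measure_pmf_of_set) auto
    ultimately show "measure_pmf.prob (verifier_coins V) ?W \<le> 1/3" by (simp only:)
  qed
  moreover have "completeness_error_le ?D (freq_moment k n) P V (1/3)"
    using complete unfolding completeness_error_le_def by (meson order_trans zero_le_divide_1_iff zero_le_numeral)
  ultimately have "prescient_scheme ?D (freq_moment k n) (config_length + final_length) (17 * K * B) P V"
    unfolding prescient_scheme_def using len V(2) by blast
  thus ?thesis using complete by blast
qed

end

section \<open>Choice of parameters and the resulting costs\<close>

lemma scheme_parameters:
  fixes n k d m :: nat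
  assumes n: "2 \<le> n" and k: "1 \<le> k" and d: "1 \<le> d" and m: "m \<in> {1..n}"
  shows "\<exists>K B p \<beta>. sumcheck n k d K B p \<beta> \<and> m\<^sup>2 \<le> K * (K * K) \<and>
    real K \<le> 2 * real m powr (2/3) \<and> real B \<le> 30 * (real d + 1) * real k * log 2 (real n)"
proof -
  define s where "s = real m powr (2/3)"
  define K where "K = nat \<lceil>s\<rceil>"
  have s1: "1 \<le> s" unfolding s_def using m by (intro ge_one_powr_ge_zero) auto
  have sm: "s \<le> real m" unfolding s_def using m powr_mono[of "2/3" 1 "real m"] by simp
  have Ks: "s \<le> real K" "real K \<le> 2 * s" using s1 unfolding K_def by linarith+
  have K: "1 \<le> K" "K \<le> n"
  proof -
    show "1 \<le> K" using Ks s1 by linarith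
    have "K \<le> m" using sm unfolding K_def by (simp add: nat_le_iff ceiling_le_iff)
    thus "K \<le> n" using m by simp
  qed
  have mK: "m\<^sup>2 \<le> K * (K * K)"
  proof -
    have "(real m)\<^sup>2 = s ^ 3"
      unfolding s_def using m by (simp add: powr_power powr_numeral)
    also have "\<dots> \<le> real K ^ 3" using Ks s1 by (intro power_mono) auto
    finally have "real (m\<^sup>2) \<le> real (K ^ 3)" by simp
    hence "m\<^sup>2 \<le> K ^ 3" by (simp only: of_nat_le_iff)
    thus ?thesis by (simp add: power3_eq_cube)
  qed
  define l where "l = nat \<lceil>log 2 (real n)\<rceil>"
  have l1: "1 \<le> log 2 (real n)" using n by simp
  have ll: "log 2 (real n) \<le> real l" "real l \<le> 2 * log 2 (real n)" using l1 unfolding l_def by linarith+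
  have nl: "n \<le> 2 ^ l"
  proof -
    have "real n \<le> 2 powr real l" using ll(1) n by (subst (asm) log_le_iff) auto
    thus ?thesis by (simp add: powr_realpow)
  qed
  define N where "N = n ^ Suc d"
  \<comment> \<open>Leaves room for all demands on \<open>p\<close>: the bound on the total is at
    most \<open>2 * N ^ (k + 4)\<close> because \<open>n^2 \<le> N\<close>, and
    \<open>6 * k * K \<le> N ^ (k + 3)\<close>.\<close>
  define X where "X = N ^ (k + 5)"
  have N2: "n\<^sup>2 \<le> N" unfolding N_def using n d by (intro power_increasing) auto
  have "2\<^sup>2 \<le> n\<^sup>2" using n by (intro power_mono) auto
  hence N4: "4 \<le> N" using N2 by simp
  have nN: "n \<le> N" unfolding N_def using n by (intro self_le_power) auto
  have NX: "N ^ j \<le> X" if "j \<le> k + 5" for j unfolding X_def using that N4 by (intro power_increasing) auto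
  have "2 \<le> X" using NX[of 1] N4 by simp
  then obtain p where p: "prime p" "X < p" "p \<le> 4 * X\<^sup>2" using prime_between by blast
  \<comment> \<open>The main term covers \<open>X^2\<close>; the 3 covers the factor 4 and makes the
    bound on \<open>p\<close> strict.\<close>
  define B where "B = l * (Suc d * (2 * k + 10)) + 3"
  have pB: "p < 2 ^ B"
  proof -
    have "X\<^sup>2 = n ^ (Suc d * (2 * k + 10))"
      unfolding X_def N_def power_mult[symmetric] by (simp add: algebra_simps)
    also have "\<dots> \<le> (2 ^ l) ^ (Suc d * (2 * k + 10))" using nl by (rule power_mono) simp
    also have "\<dots> = 2 ^ (l * (Suc d * (2 * k + 10)))" by (simp only: power_mult)
    finally have "4 * X\<^sup>2 \<le> 4 * 2 ^ (l * (Suc d * (2 * k + 10)))" by simp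
    also have "\<dots> < 2 ^ B" by (simp add: B_def power_add)
    finally show ?thesis using p(3) by simp
  qed
  have size: "3 * (2 * k * K) \<le> p"
  proof -
    have "k < 2 ^ k" by (rule less_exp)
    also have "(2::nat) ^ k \<le> N ^ k" using N4 by (intro power_mono) auto
    finally have kN: "k \<le> N ^ k" by simp
    have N16: "6 \<le> N\<^sup>2" using power_mono[OF N4, of 2] by simp
    have "6 * k * K \<le> N\<^sup>2 * N ^ k * N" using kN N16 K(2) nN by (intro mult_mono) auto
    also have "\<dots> = N ^ (k + 3)" by (simp add: power_add numeral_eq_Suc)
    also have "\<dots> \<le> X" by (rule NX) simp
    finally show ?thesis using p(2) by simp
  qed
  have np: "n ^ Suc d < p" using NX[of 1] p(2) by (simp add: N_def)
  have total: "(int n ^ Suc d) ^ k + ((int n ^ Suc d) ^ k + 1) * (int n ^ Suc d * (int n ^ Suc d * int n ^ 2)) < int p"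
  proof -
    have Nk: "1 \<le> N ^ k" using N4 by simp
    have "N ^ k + (N ^ k + 1) * (N * (N * n\<^sup>2)) \<le> N ^ k * N ^ 4 + (2 * N ^ k) * (N * (N * N))"
      using Nk N2 N4 by (intro add_mono mult_mono) auto
    also have "\<dots> \<le> N ^ k * N ^ 4 + N ^ k * N ^ 4"
    proof -
      have "2 * (N * (N * N)) \<le> N * (N * (N * N))" using N4 by (intro mult_mono) auto
      hence "N ^ k * (2 * (N * (N * N))) \<le> N ^ k * (N * (N * (N * N)))" by (intro mult_left_mono) auto
      thus ?thesis by (simp add: power4_eq_xxxx mult.assoc mult.left_commute)
    qed
    also have "\<dots> = 2 * N ^ (k + 4)" by (simp add: power_add)
    also have "\<dots> \<le> N * N ^ (k + 4)" using N4 by (intro mult_right_mono) auto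
    also have "\<dots> = X" by (simp add: X_def power_add numeral_eq_Suc)
    finally have "N ^ k + (N ^ k + 1) * (N * (N * n\<^sup>2)) < p" using p(2) by simp
    hence "int (N ^ k + (N ^ k + 1) * (N * (N * n\<^sup>2))) < int p" by (simp only: of_nat_less_iff)
    thus ?thesis
      by (simp only: N_def of_nat_add of_nat_mult of_nat_power of_nat_1)
  qed
  have "\<exists>\<beta> :: nat \<Rightarrow> int poly. \<forall>x<K. degree (\<beta> x) \<le> K - 1 \<and>
      (\<forall>x'<K. int p dvd poly (\<beta> x) (int x') - of_bool (x = x'))"
  proof (rule lagrange_basis_mod)
    show "prime (int p)" using p(1) by simp
    show "int K \<le> int p" using K(2) nN NX[of 1] p(2) by simp
  qed
  then obtain \<beta> :: "nat \<Rightarrow> int poly" where \<beta>: "\<And>x. x < K \<Longrightarrow> degree (\<beta> x) \<le> K - 1"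
    "\<And>x x'. x < K \<Longrightarrow> x' < K \<Longrightarrow> int p dvd poly (\<beta> x) (int x') - of_bool (x = x')" by blast
  \<comment> \<open>From \<open>2 * k + 10 \<le> 12 * k\<close> and the additive 3 comes a factor
    15; rounding the logarithm up at most doubles it.\<close>
  have rB: "real B \<le> 30 * (real d + 1) * real k * log 2 (real n)"
  proof -
    have l': "1 \<le> l" using ll(1) l1 by linarith
    have "1 * 1 \<le> l * (Suc d * k)" using l' k by (intro mult_mono) auto
    moreover have "l * (Suc d * (2 * k + 10)) \<le> l * (Suc d * (12 * k))" using k by (intro mult_left_mono) auto
    moreover have "l * (Suc d * (12 * k)) = 12 * (l * (Suc d * k))" by simp
    ultimately have "B \<le> 15 * (l * (Suc d * k))" unfolding B_def by linarith
    hence "real B \<le> real (15 * (l * (Suc d * k)))" by (rule of_nat_mono)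
    also have "\<dots> = real l * (15 * (real d + 1) * real k)" by (simp add: algebra_simps)
    also have "\<dots> \<le> (2 * log 2 (real n)) * (15 * (real d + 1) * real k)"
      using ll(2) by (intro mult_right_mono) auto
    finally show ?thesis by (simp add: algebra_simps)
  qed
  have "1 \<le> n" using n by simp
  hence "sumcheck n k d K B p \<beta>"
    using k K(1) p(1) pB size np total \<beta> by (rule sumcheck.intro)
  thus ?thesis using mK Ks(2) rB unfolding s_def by blast
qed

text \<open>The constant is \<open>17 * 2 * 30\<close>: 17 from the number of memory states, 2 from
  rounding \<open>K\<close>, 30 from \<open>B\<close>. The annotation has a factor 4 in place of
  17.\<close>

lemma prescient_scheme_upper_bound:
  fixes n k d m :: nat
  assumes "2 \<le> n" "1 \<le> k" "1 \<le> d" "m \<in> {1..n}"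
  shows "\<exists>P V a w.
     prescient_scheme {x \<in> turnstile_streams d n. sparsity n x \<le> m} (freq_moment k n) a w P V \<and>
     completeness_error_le {x \<in> turnstile_streams d n. sparsity n x \<le> m} (freq_moment k n) P V 0 \<and>
     real a \<le> 1020 * (real d + 1) * (real k ^ 2 * real m powr (2/3) * log 2 (real n)) \<and>
     real w \<le> 1020 * (real d + 1) * (real k * real m powr (2/3) * log 2 (real n))"
proof -
  obtain K B p \<beta> where sc: "sumcheck n k d K B p \<beta>" and m: "m\<^sup>2 \<le> K * (K * K)"
    and K: "real K \<le> 2 * real m powr (2/3)" and B: "real B \<le> 30 * (real d + 1) * real k * log 2 (real n)"
    using scheme_parameters[OF assms] by blast
  interpret sumcheck n k d K B p \<beta> by (rule sc)
  obtain P V where PV: "prescient_scheme {x \<in> turnstile_streams d n. sparsity n x \<le> m} (freq_moment k n)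
      (config_length + final_length) (17 * K * B) P V"
    "completeness_error_le {x \<in> turnstile_streams d n. sparsity n x \<le> m} (freq_moment k n) P V 0"
    using scheme_exists[OF m] by blast
  define u where "u = (real d + 1) * (real k * real m powr (2/3) * log 2 (real n))"
  have u0: "0 \<le> u" unfolding u_def using assms by simp
  have KB: "real K * real B \<le> 60 * u"
  proof -
    have "real K * real B \<le> (2 * real m powr (2/3)) * (30 * (real d + 1) * real k * log 2 (real n))"
      using K B by (intro mult_mono) auto
    thus ?thesis by (simp add: u_def algebra_simps)
  qed
  have "real (17 * K * B) = 17 * (real K * real B)" by simp
  hence w: "real (17 * K * B) \<le> 1020 * u" using KB by linarith
  have "config_length + final_length \<le> 4 * k * (K * B)"
  proof -
    have "B \<le> K * B" using K_pos by simp
    moreover have "K * B \<le> k * (K * B)" using k_pos by simp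
    moreover have "config_length = B + K * B" "final_length = 2 * (k * (K * B))" "4 * k * (K * B) = 4 * (k * (K * B))"
      by (simp_all add: config_length_def final_length_def)
    ultimately show ?thesis by linarith
  qed
  hence "real (config_length + final_length) \<le> real (4 * k * (K * B))" by (rule of_nat_mono)
  also have "\<dots> = 4 * real k * (real K * real B)" by simp
  also have "\<dots> \<le> 4 * real k * (60 * u)" using KB by (intro mult_left_mono) auto
  also have "\<dots> \<le> 1020 * (real k * u)" using u0 by simp
  finally have a: "real (config_length + final_length) \<le> 1020 * (real k * u)" .
  have e: "1020 * (real k * u) = 1020 * (real d + 1) * (real k ^ 2 * real m powr (2/3) * log 2 (real n))"
    "1020 * u = 1020 * (real d + 1) * (real k * real m powr (2/3) * log 2 (real n))"
    by (simp_all add: u_def power2_eq_square)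
  show ?thesis using PV a w unfolding e by blast
qed

theorem theorem4p5:
  fixes d :: nat
  assumes "d \<ge> 1"
  shows "(\<exists>C>0. \<forall>k\<ge>1. \<forall>n\<ge>2. \<forall>m\<in>{1..n}. \<exists>P V a w.
           prescient_scheme {x \<in> turnstile_streams d n. sparsity n x \<le> m} (freq_moment k n) a w P V \<and>
           completeness_error_le {x \<in> turnstile_streams d n. sparsity n x \<le> m} (freq_moment k n) P V 0 \<and>
           real a \<le> C * (real k ^ 2 * real m powr (2/3) * log 2 (real n)) \<and>
           real w \<le> C * (real k * real m powr (2/3) * log 2 (real n))) \<and>
         (\<exists>c>0. \<forall>k\<ge>2. \<forall>n\<ge>2. \<forall>m\<in>{1..n}. \<forall>P V a w.
           prescient_scheme {x \<in> turnstile_streams d n. sparsity n x = m} (freq_moment k n) a w P V \<and>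
           a \<ge> 1 \<longrightarrow>
           real a * real w \<ge> c * real m)"
proof (rule conjI)
  show "\<exists>C>0. \<forall>k\<ge>1. \<forall>n\<ge>2. \<forall>m\<in>{1..n}. \<exists>P V a w.
      prescient_scheme {x \<in> turnstile_streams d n. sparsity n x \<le> m} (freq_moment k n) a w P V \<and>
      completeness_error_le {x \<in> turnstile_streams d n. sparsity n x \<le> m} (freq_moment k n) P V 0 \<and>
      real a \<le> C * (real k ^ 2 * real m powr (2/3) * log 2 (real n)) \<and>
      real w \<le> C * (real k * real m powr (2/3) * log 2 (real n))"
    using prescient_scheme_upper_bound assms
    by (intro exI[of _ "1020 * (real d + 1)"] conjI allI impI ballI) simp_all
  show "\<exists>c>0. \<forall>k\<ge>2. \<forall>n\<ge>2. \<forall>m\<in>{1..n}. \<forall>P V a w.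
      prescient_scheme {x \<in> turnstile_streams d n. sparsity n x = m} (freq_moment k n) a w P V \<and> a \<ge> 1 \<longrightarrow>
      real a * real w \<ge> c * real m"
  proof (intro exI[of _ "1/512"] conjI allI impI ballI)
    fix k n m P V a w
    assume "2 \<le> k" "2 \<le> n" "m \<in> {1..n}"
      "prescient_scheme {x \<in> turnstile_streams d n. sparsity n x = m} (freq_moment k n) a w P V \<and> 1 \<le> a"
    hence "m \<le> 512 * (a * w)" using annotation_memory_tradeoff[of d n m k a w P V] assms by blast
    hence "real m \<le> real (512 * (a * w))" by (rule of_nat_mono)
    thus "1 / 512 * real m \<le> real a * real w" by simp
  qed simp
qed


end
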